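(* Let $k$ be a number field and let $f(x)\in k(x)$ be a rational function of degree $2$ whose post-critical set is $\{p_1,\dots,p_r\}$ with $r\ge3$, where $f(p_{m-1})=p_m$ for $1\le m\le r$ (indices modulo $r$), and suppose the two critical points of $f$ are $p_r$ and $p_1$. Then the field of constants associated with $f$ is contained in the cyclotomic field $k(\zeta_{2^n}: n\ge1)$.
   Context: For a transcendental parameter $t$, let $k(f^{-\infty}(t))$ denote the field obtained from $k(t)$ by adjoining all roots of $f^n(x)=t$ for all $n\ge1$ (inside a fixed algebraic closure of $k(t)$ containing $\bar k$). The field of constants associated with $f$ is $k(f^{-\infty}(t))\cap\bar k$. Here $\zeta_{2^n}$ denotes a primitive $2^n$-th root of unity. The post-critical set is $\{f^n(c): n\ge1,\ c\text{ a critical point of } f\}$. *)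

theory Defs
  imports Complex_Main "HOL-Computational_Algebra.Computational_Algebra"
begin

section \<open>Subfields of an ambient field\<close>

text \<open>All fields are subsets of one ambient field \<open>'a\<close>. In the theorem this is an algebraic closure
  of \<open>k(t)\<close>; the algebraic closure of \<open>k\<close> inside it is the set of elements algebraic over \<open>k\<close>.\<close>

definition is_subfield :: "'a::field set \<Rightarrow> bool" where
  "is_subfield K \<longleftrightarrow> 0 \<in> K \<and> 1 \<in> K \<and>
     (\<forall>x\<in>K. \<forall>y\<in>K. x + y \<in> K \<and> x * y \<in> K) \<and> (\<forall>x\<in>K. - x \<in> K \<and> inverse x \<in> K)"

definition adjoin :: "'a::field set \<Rightarrow> 'a set \<Rightarrow> 'a set" where
  "adjoin K S = is_subfield hull (K \<union> S)"

definition poly_over :: "'a::field set \<Rightarrow> 'a poly \<Rightarrow> bool" where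
  "poly_over K p \<longleftrightarrow> (\<forall>i. coeff p i \<in> K)"

definition algebraic_over :: "'a::field set \<Rightarrow> 'a \<Rightarrow> bool" where
  "algebraic_over K x \<longleftrightarrow> (\<exists>p. p \<noteq> 0 \<and> poly_over K p \<and> poly p x = 0)"

definition number_field :: "'a::field_char_0 set \<Rightarrow> bool" where
  "number_field K \<longleftrightarrow> is_subfield K \<and>
     (\<exists>B. finite B \<and> module.span (\<lambda>(q::rat) x. of_rat q * x) B = K)"

definition primitive_root_of_unity :: "nat \<Rightarrow> 'a::field \<Rightarrow> bool" where
  "primitive_root_of_unity m z \<longleftrightarrow> z ^ m = 1 \<and> (\<forall>j. 0 < j \<and> j < m \<longrightarrow> z ^ j \<noteq> 1)"

section \<open>Rational functions as self-maps of the projective line\<close>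

datatype 'a P1 = Fin 'a | Infty

text \<open>A rational function is given by its numerator \<open>P\<close> and denominator \<open>Q\<close> in lowest terms. The
  definitions below that mention \<open>P\<close> and \<open>Q\<close> are only meaningful when \<open>P\<close> and \<open>Q\<close> are coprime, as
  \<open>is_ratfun\<close> demands, and those about ramification only when the function is not constant.\<close>

definition is_ratfun :: "'a::field set \<Rightarrow> 'a poly \<Rightarrow> 'a poly \<Rightarrow> bool" where
  "is_ratfun K P Q \<longleftrightarrow> poly_over K P \<and> poly_over K Q \<and> Q \<noteq> 0 \<and> coprime P Q"

definition ratfun_degree :: "'a::field poly \<Rightarrow> 'a poly \<Rightarrow> nat" where
  "ratfun_degree P Q = max (degree P) (degree Q)"

text \<open>The value at infinity is the ratio of the coefficients of degree \<open>ratfun_degree P Q\<close>, at least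
  one of which is nonzero.\<close>

fun ratfun_map :: "'a::field poly \<Rightarrow> 'a poly \<Rightarrow> 'a P1 \<Rightarrow> 'a P1" where
  "ratfun_map P Q (Fin z) = (if poly Q z = 0 then Infty else Fin (poly P z / poly Q z))"
| "ratfun_map P Q Infty =
     (let d = ratfun_degree P Q
      in if coeff Q d = 0 then Infty else Fin (coeff P d / coeff Q d))"

text \<open>The zeros of \<open>fibre_poly P Q w\<close>, regarded as a binary form of degree \<open>ratfun_degree P Q\<close>, are the
  preimages of \<open>w\<close>; the ramification index at a point is its multiplicity in its own fibre. For the
  point at infinity this is the drop of the degree of \<open>fibre_poly\<close>.\<close>

fun fibre_poly :: "'a::field poly \<Rightarrow> 'a poly \<Rightarrow> 'a P1 \<Rightarrow> 'a poly" where
  "fibre_poly P Q (Fin w) = P - smult w Q"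
| "fibre_poly P Q Infty = Q"

fun ramification_index :: "'a::field poly \<Rightarrow> 'a poly \<Rightarrow> 'a P1 \<Rightarrow> nat" where
  "ramification_index P Q (Fin z) = order z (fibre_poly P Q (ratfun_map P Q (Fin z)))"
| "ramification_index P Q Infty =
     ratfun_degree P Q - degree (fibre_poly P Q (ratfun_map P Q Infty))"

definition critical_points :: "'a::field poly \<Rightarrow> 'a poly \<Rightarrow> 'a P1 set" where
  "critical_points P Q = {c. ramification_index P Q c \<ge> 2}"

definition postcritical_set :: "'a::field poly \<Rightarrow> 'a poly \<Rightarrow> 'a P1 set" where
  "postcritical_set P Q = {(ratfun_map P Q ^^ n) c |n c. n \<ge> 1 \<and> c \<in> critical_points P Q}"

section \<open>The field of constants\<close>

text \<open>For transcendental \<open>t\<close> the point at infinity never lies in a backward orbit of \<open>t\<close>, since its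
  forward orbit is defined over \<open>k\<close>; so only finite preimages are collected.\<close>

definition preimage_field :: "'a::field set \<Rightarrow> 'a poly \<Rightarrow> 'a poly \<Rightarrow> 'a \<Rightarrow> 'a set" where
  "preimage_field k P Q t =
     adjoin (adjoin k {t}) {x. \<exists>n\<ge>1. (ratfun_map P Q ^^ n) (Fin x) = Fin t}"

definition field_of_constants :: "'a::field set \<Rightarrow> 'a poly \<Rightarrow> 'a poly \<Rightarrow> 'a \<Rightarrow> 'a set" where
  "field_of_constants k P Q t = preimage_field k P Q t \<inter> {x. algebraic_over k x}"

end

theory Submission
  imports Defs
begin

text \<open>Galois descent puts the critical points in \<open>P\<^sup>1(k)\<close>, and a Moebius change of coordinate over \<open>k\<close>
  brings \<open>f\<close> to \<open>x \<mapsto> A + B / x\<^sup>2\<close>. Let \<open>C\<close> be the algebraic closure of \<open>k\<close> and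
  \<open>F\<close> the field generated over \<open>k\<close> by the roots of unity of 2-power order. By induction on the level, every automorphism \<open>\<sigma>\<close> of \<open>C\<close> over \<open>F\<close> extends to one
  that fixes the iterated preimages of \<open>t\<close>; so no constant outside \<open>F\<close> lies in their field.

  The tree over \<open>t\<close> consists of the trees over \<open>x\<close> and \<open>- x\<close>, where \<open>t = A + B / x\<^sup>2\<close>. By induction there is
  an extension of \<open>\<sigma>\<close> fixing the first, and conjugation with \<open>x \<mapsto> - x\<close> gives one fixing the second. They
  can be glued if they agree on the intersection of the two tree fields over \<open>C(x)\<close>. The first field is ramified
  only over post-critical points and the second only over their negatives; both happens only over \<open>0\<close> and
  infinity, because the post-critical orbit is injective. As the fields are towers of square roots, the intersection
  lies in the field of all \<open>2\<^sup>n\<close>-th roots of \<open>x\<close>, on which the two extensions agree since \<open>F\<close> contains the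
  necessary roots of unity.\<close>

section \<open>Subfields and polynomials over them\<close>

text \<open>Why 2-power roots of unity: conjugation with x |-> -x moves x, and the inverse of the
  conjugating automorphism multiplies a 2^N-th root of x by some \<eta> with \<eta>^(2^N) = -1. The
  conjugated extension has the same effect on that root as the original one as soon as \<sigma>
  fixes \<eta>, a root of unity of order dividing 2^(N+1). Why nothing but radicals of x is common:
  a larger intersection, being stable under conjugation inside a tower of square roots, would
  contain a new square root e over the field of radicals, and e^2 would have odd order at some
  nonzero value of a 2^N-th root of x. Ramification itself is never defined; its absence at such a
  place is expressed by embedding one of the two subtrees into Laurent series, where squares have
  even valuation. Galois groups are replaced by automorphisms of the algebraically closed ambient
  field, so infinite extensions need no separate treatment. In return, the fields to be fixed must
  be large enough for the ambient field to be algebraic over them.\<close>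

lemma is_subfieldI:
  assumes "0 \<in> K" "1 \<in> K" "\<And>x y. x \<in> K \<Longrightarrow> y \<in> K \<Longrightarrow> x + y \<in> K" "\<And>x y. x \<in> K \<Longrightarrow> y \<in> K \<Longrightarrow> x * y \<in> K"
    and "\<And>x. x \<in> K \<Longrightarrow> - x \<in> K" "\<And>x. x \<in> K \<Longrightarrow> inverse x \<in> K"
  shows "is_subfield K"
  using assms by (auto simp: is_subfield_def)

lemma subfield_0: "is_subfield K \<Longrightarrow> 0 \<in> K"
  and subfield_1: "is_subfield K \<Longrightarrow> 1 \<in> K"
  and subfield_add: "is_subfield K \<Longrightarrow> x \<in> K \<Longrightarrow> y \<in> K \<Longrightarrow> x + y \<in> K"
  and subfield_mult: "is_subfield K \<Longrightarrow> x \<in> K \<Longrightarrow> y \<in> K \<Longrightarrow> x * y \<in> K"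
  and subfield_uminus: "is_subfield K \<Longrightarrow> x \<in> K \<Longrightarrow> - x \<in> K"
  and subfield_inverse: "is_subfield K \<Longrightarrow> x \<in> K \<Longrightarrow> inverse x \<in> K"
  by (auto simp: is_subfield_def)

lemma subfield_diff: "is_subfield K \<Longrightarrow> x \<in> K \<Longrightarrow> y \<in> K \<Longrightarrow> x - y \<in> K"
  using subfield_add[of K x "- y"] subfield_uminus[of K y] by simp

lemma subfield_divide: "is_subfield K \<Longrightarrow> x \<in> K \<Longrightarrow> y \<in> K \<Longrightarrow> x / y \<in> K"
  by (simp add: divide_inverse subfield_mult subfield_inverse)

lemma subfield_power: "is_subfield K \<Longrightarrow> x \<in> K \<Longrightarrow> x ^ n \<in> K"
  by (induction n) (auto intro: subfield_1 subfield_mult)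

lemma subfield_sum: "is_subfield K \<Longrightarrow> (\<And>i. i \<in> I \<Longrightarrow> f i \<in> K) \<Longrightarrow> sum f I \<in> K"
  by (induction I rule: infinite_finite_induct) (auto intro: subfield_0 subfield_add)

lemma subfield_of_nat: "is_subfield K \<Longrightarrow> of_nat n \<in> K"
  by (induction n) (auto intro: subfield_0 subfield_1 subfield_add)

lemmas subfield_closed = subfield_0 subfield_1 subfield_add subfield_mult subfield_uminus
  subfield_inverse subfield_diff subfield_divide subfield_power subfield_of_nat

lemma subfield_half:
  fixes K :: "'a::field_char_0 set"
  assumes "is_subfield K" "2 * x \<in> K"
  shows "x \<in> K"
proof -
  have "2 * x / of_nat 2 \<in> K"
    using assms by (intro subfield_divide subfield_of_nat)
  then show ?thesis by simp
qed

lemma is_subfield_Inter: "(\<And>K. K \<in> \<K> \<Longrightarrow> is_subfield K) \<Longrightarrow> is_subfield (\<Inter>\<K>)"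
  by (auto simp: is_subfield_def)

lemma is_subfield_Int: "is_subfield K \<Longrightarrow> is_subfield L \<Longrightarrow> is_subfield (K \<inter> L)"
  by (auto simp: is_subfield_def)

lemma is_subfield_UNIV: "is_subfield UNIV"
  by (auto simp: is_subfield_def)

lemma is_subfield_adjoin: "is_subfield (adjoin K S)"
  unfolding adjoin_def by (rule hull_in) (auto intro: is_subfield_Inter)

lemma adjoin_base: "K \<subseteq> adjoin K S" and adjoin_gen: "S \<subseteq> adjoin K S"
  unfolding adjoin_def using hull_subset[of "K \<union> S" is_subfield] by auto

lemma adjoin_least: "is_subfield L \<Longrightarrow> K \<subseteq> L \<Longrightarrow> S \<subseteq> L \<Longrightarrow> adjoin K S \<subseteq> L"
  unfolding adjoin_def by (rule hull_minimal) auto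

lemma adjoin_mono: "K \<subseteq> K' \<Longrightarrow> S \<subseteq> S' \<Longrightarrow> adjoin K S \<subseteq> adjoin K' S'"
  by (rule adjoin_least) (use is_subfield_adjoin adjoin_base adjoin_gen in blast)+

section \<open>Polynomials with coefficients in a subfield\<close>

lemma poly_over_0: "is_subfield K \<Longrightarrow> poly_over K 0"
  by (auto simp: poly_over_def intro: subfield_0)

lemma poly_over_pCons: "is_subfield K \<Longrightarrow> poly_over K (pCons a p) \<longleftrightarrow> a \<in> K \<and> poly_over K p"
  by (auto simp: poly_over_def coeff_pCons split: nat.splits)

lemma poly_over_1: "is_subfield K \<Longrightarrow> poly_over K 1"
  by (simp add: one_pCons poly_over_pCons poly_over_0 subfield_1)

lemma poly_over_add: "is_subfield K \<Longrightarrow> poly_over K p \<Longrightarrow> poly_over K q \<Longrightarrow> poly_over K (p + q)"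
  by (auto simp: poly_over_def intro: subfield_add)

lemma poly_over_uminus: "is_subfield K \<Longrightarrow> poly_over K p \<Longrightarrow> poly_over K (- p)"
  by (auto simp: poly_over_def intro: subfield_uminus)

lemma poly_over_diff: "is_subfield K \<Longrightarrow> poly_over K p \<Longrightarrow> poly_over K q \<Longrightarrow> poly_over K (p - q)"
  by (auto simp: poly_over_def intro: subfield_diff)

lemma poly_over_mult: "is_subfield K \<Longrightarrow> poly_over K p \<Longrightarrow> poly_over K q \<Longrightarrow> poly_over K (p * q)"
  by (auto simp: poly_over_def coeff_mult intro!: subfield_sum subfield_mult)

lemma poly_over_smult: "is_subfield K \<Longrightarrow> a \<in> K \<Longrightarrow> poly_over K p \<Longrightarrow> poly_over K (smult a p)"
  by (auto simp: poly_over_def intro: subfield_mult)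

lemma poly_over_power: "is_subfield K \<Longrightarrow> poly_over K p \<Longrightarrow> poly_over K (p ^ n)"
  by (induction n) (auto intro: poly_over_1 poly_over_mult)

lemma poly_over_monom: "is_subfield K \<Longrightarrow> a \<in> K \<Longrightarrow> poly_over K (monom a n)"
  by (auto simp: poly_over_def intro: subfield_0)

lemma poly_over_pderiv: "is_subfield K \<Longrightarrow> poly_over K p \<Longrightarrow> poly_over K (pderiv p)"
  by (auto simp: poly_over_def coeff_pderiv intro!: subfield_closed simp del: of_nat_Suc)

lemma poly_over_prod:
  "is_subfield K \<Longrightarrow> (\<And>i. i \<in> I \<Longrightarrow> poly_over K (f i)) \<Longrightarrow> poly_over K (prod f I)"
  by (induction I rule: infinite_finite_induct) (auto intro: poly_over_1 poly_over_mult)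

lemmas poly_over_closed = poly_over_0 poly_over_1 poly_over_add poly_over_uminus poly_over_diff
  poly_over_mult poly_over_smult poly_over_power poly_over_monom poly_over_pderiv

lemma poly_over_mono: "K \<subseteq> L \<Longrightarrow> poly_over K p \<Longrightarrow> poly_over L p"
  by (auto simp: poly_over_def)

lemma poly_over_value: "is_subfield K \<Longrightarrow> poly_over K p \<Longrightarrow> x \<in> K \<Longrightarrow> poly p x \<in> K"
  by (auto simp: poly_altdef poly_over_def intro!: subfield_sum subfield_mult subfield_power)

text \<open>\<open>div\<close> and \<open>mod\<close> refer to division over the whole ambient
  field. Long division inside \<open>K\<close> yields a quotient and a remainder over
  \<open>K\<close>, and uniqueness identifies them with the ambient ones.\<close>

lemma poly_over_div_mod:
  assumes "is_subfield K" "poly_over K p" "poly_over K m"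
  shows "poly_over K (p div m)" "poly_over K (p mod m)"
proof -
  have "\<exists>q r. poly_over K q \<and> poly_over K r \<and> p = q * m + r \<and> (r = 0 \<or> degree r < degree m)"
    if "m \<noteq> 0" using assms(2)
  proof (induction "degree p" arbitrary: p rule: less_induct)
    case less
    show ?case
    proof (cases "p = 0 \<or> degree p < degree m")
      case True
      then show ?thesis using less.prems poly_over_0[OF assms(1)] by (intro exI[of _ 0] exI[of _ p]) auto
    next
      case False
      then have dp: "degree m \<le> degree p" and p0: "p \<noteq> 0" by auto
      define c where "c = monom (lead_coeff p / lead_coeff m) (degree p - degree m)"
      have cK: "poly_over K c"
        unfolding c_def using less.prems assms by (intro poly_over_monom subfield_divide) (auto simp: poly_over_def)
      define p' where "p' = p - c * m"
      have p'K: "poly_over K p'"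
        unfolding p'_def using less.prems assms cK by (intro poly_over_closed)
      have "degree c = degree p - degree m" "lead_coeff c = lead_coeff p / lead_coeff m" "c \<noteq> 0"
        using p0 that by (auto simp: c_def degree_monom_eq)
      then have cm: "degree (c * m) = degree p" "lead_coeff (c * m) = lead_coeff p"
        using that dp unfolding lead_coeff_mult by (simp_all add: degree_mult_eq)
      show ?thesis
      proof (cases "degree p = 0")
        case True
        then have "p' = 0"
          using cm unfolding p'_def by (metis degree_0_id eq_iff_diff_eq_0)
        then show ?thesis
          using cK poly_over_0[OF assms(1)] by (intro exI[of _ c] exI[of _ 0]) (auto simp: p'_def)
      next
        case False
        have "degree p' < degree p"
        proof (rule le_neq_implies_less)
          show "degree p' \<le> degree p"
            unfolding p'_def using cm by (intro degree_diff_le) auto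
          have "coeff p' (degree p) = 0"
            using cm by (simp add: p'_def)
          then show "degree p' \<noteq> degree p"
            using False by (metis leading_coeff_0_iff degree_0)
        qed
        from less.hyps[OF this p'K] obtain q r where qr: "poly_over K q" "poly_over K r"
          "p' = q * m + r" "r = 0 \<or> degree r < degree m" by blast
        then show ?thesis
          using cK assms by (intro exI[of _ "q + c"] exI[of _ r]) (auto simp: p'_def algebra_simps intro: poly_over_add)
      qed
    qed
  qed
  moreover have "p div m = q \<and> p mod m = r"
    if "p = q * m + r" "r = 0 \<or> degree r < degree m" "m \<noteq> 0" for q r
  proof -
    have "r div m = 0" "r mod m = r"
      using that by (auto simp: div_poly_less mod_poly_less)
    then show ?thesis using that by simp
  qed
  ultimately show "poly_over K (p div m)" "poly_over K (p mod m)"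
    using assms by (cases "m = 0"; auto intro: poly_over_0; metis)+
qed

section \<open>Embeddings of subfields\<close>

text \<open>The maps are total functions controlled only on \<open>K\<close>, so partial embeddings
  are extended without a change of type. The target type is free because Laurent series serve as a
  target later.\<close>

locale field_embedding =
  fixes K :: "'a::field set" and \<psi> :: "'a \<Rightarrow> 'b::field"
  assumes subfield: "is_subfield K"
    and one: "\<psi> 1 = 1"
    and add: "\<And>x y. x \<in> K \<Longrightarrow> y \<in> K \<Longrightarrow> \<psi> (x + y) = \<psi> x + \<psi> y"
    and mult: "\<And>x y. x \<in> K \<Longrightarrow> y \<in> K \<Longrightarrow> \<psi> (x * y) = \<psi> x * \<psi> y"
begin

lemma zero: "\<psi> 0 = 0"
  using add[of 0 0] subfield_0[OF subfield] by (metis add_0 add_cancel_right_right)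

lemma uminus: "x \<in> K \<Longrightarrow> \<psi> (- x) = - \<psi> x"
  using add[of x "- x"] subfield_uminus[OF subfield] zero by (simp add: minus_unique)

lemma diff: "x \<in> K \<Longrightarrow> y \<in> K \<Longrightarrow> \<psi> (x - y) = \<psi> x - \<psi> y"
  using add[of x "- y"] uminus[of y] subfield_uminus[OF subfield] by simp

lemma eq_0_iff: "x \<in> K \<Longrightarrow> \<psi> x = 0 \<longleftrightarrow> x = 0"
  using mult[of x "inverse x"] subfield_inverse[OF subfield] zero one
  by (cases "x = 0") auto

lemma eq_iff: "x \<in> K \<Longrightarrow> y \<in> K \<Longrightarrow> \<psi> x = \<psi> y \<longleftrightarrow> x = y"
  using eq_0_iff[of "x - y"] subfield_diff[OF subfield, of x y] diff[of x y] by auto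

lemma divide: "x \<in> K \<Longrightarrow> y \<in> K \<Longrightarrow> \<psi> (x / y) = \<psi> x / \<psi> y"
  using mult[of "x / y" y] eq_0_iff[of y] subfield_divide[OF subfield, of x y] zero
  by (cases "y = 0") (auto simp: field_simps)

lemma power: "x \<in> K \<Longrightarrow> \<psi> (x ^ n) = \<psi> x ^ n"
  by (induction n) (auto simp: one mult subfield_power[OF subfield])

lemma sum: "(\<And>i. i \<in> I \<Longrightarrow> f i \<in> K) \<Longrightarrow> \<psi> (sum f I) = (\<Sum>i\<in>I. \<psi> (f i))"
  by (induction I rule: infinite_finite_induct) (auto simp: zero add subfield_sum[OF subfield])

lemma coeff_map: "coeff (map_poly \<psi> p) i = \<psi> (coeff p i)"
  by (simp add: coeff_map_poly zero)

lemma map_poly_add: "poly_over K p \<Longrightarrow> poly_over K q \<Longrightarrow> map_poly \<psi> (p + q) = map_poly \<psi> p + map_poly \<psi> q"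
  by (auto simp: poly_eq_iff coeff_map poly_over_def add)

lemma map_poly_diff: "poly_over K p \<Longrightarrow> poly_over K q \<Longrightarrow> map_poly \<psi> (p - q) = map_poly \<psi> p - map_poly \<psi> q"
  by (auto simp: poly_eq_iff coeff_map poly_over_def diff)

lemma map_poly_mult: "poly_over K p \<Longrightarrow> poly_over K q \<Longrightarrow> map_poly \<psi> (p * q) = map_poly \<psi> p * map_poly \<psi> q"
  by (auto simp: poly_eq_iff coeff_map coeff_mult poly_over_def sum mult subfield_mult[OF subfield])

lemma map_poly_pCons: "map_poly \<psi> (pCons a p) = pCons (\<psi> a) (map_poly \<psi> p)"
  by (auto simp: poly_eq_iff coeff_map coeff_pCons split: nat.splits)

lemma map_poly_0: "map_poly \<psi> 0 = 0" and map_poly_1: "map_poly \<psi> 1 = 1"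
  by (auto simp: poly_eq_iff coeff_map zero one coeff_1)

lemma degree_map: "poly_over K p \<Longrightarrow> degree (map_poly \<psi> p) = degree p"
  by (simp add: degree_def coeff_map poly_over_def eq_0_iff)

lemma map_poly_eq_0_iff: "poly_over K p \<Longrightarrow> map_poly \<psi> p = 0 \<longleftrightarrow> p = 0"
  by (auto simp: poly_eq_iff coeff_map zero poly_over_def eq_0_iff)

lemma poly_map: "poly_over K p \<Longrightarrow> x \<in> K \<Longrightarrow> poly (map_poly \<psi> p) (\<psi> x) = \<psi> (poly p x)"
proof (induction p)
  case (pCons a p)
  then show ?case
    using poly_over_pCons[OF subfield, of a p]
    by (simp add: map_poly_pCons add mult subfield_mult[OF subfield] poly_over_value[OF subfield])
qed (simp add: zero)

end

lemma field_embeddingI: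
  assumes "is_subfield K" "\<psi> 1 = 1" "\<And>x y. x \<in> K \<Longrightarrow> y \<in> K \<Longrightarrow> \<psi> (x + y) = \<psi> x + \<psi> y"
    "\<And>x y. x \<in> K \<Longrightarrow> y \<in> K \<Longrightarrow> \<psi> (x * y) = \<psi> x * \<psi> y"
  shows "field_embedding K \<psi>"
  using assms by unfold_locales

lemma field_embedding_subset: "field_embedding L \<psi> \<Longrightarrow> is_subfield K \<Longrightarrow> K \<subseteq> L \<Longrightarrow> field_embedding K \<psi>"
  unfolding field_embedding_def by blast

lemma adjoin_singleton:
  assumes K: "is_subfield K"
  shows "adjoin K {x} = {poly p x / poly q x | p q. poly_over K p \<and> poly_over K q \<and> poly q x \<noteq> 0}"
proof -
  define R where "R = {poly p x / poly q x | p q. poly_over K p \<and> poly_over K q \<and> poly q x \<noteq> 0}"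
  note K_poly = poly_over_closed[OF K]
  have R: "poly p x / poly q x \<in> R" if "poly_over K p" "poly_over K q" "poly q x \<noteq> 0" for p q
    unfolding R_def using that by blast
  have RE: "\<exists>p q. y = poly p x / poly q x \<and> poly_over K p \<and> poly_over K q \<and> poly q x \<noteq> 0" if "y \<in> R" for y
    using that unfolding R_def by blast
  have "is_subfield R"
  proof (rule is_subfieldI)
    show "0 \<in> R" using R[of 0 1] K_poly by simp
    show "1 \<in> R" using R[of 1 1] K_poly by simp
    fix y assume "y \<in> R"
    then obtain p q where y: "y = poly p x / poly q x" "poly_over K p" "poly_over K q" "poly q x \<noteq> 0"
      using RE by metis
    show "- y \<in> R" using R[of "- p" q] y K_poly by simp
    show "inverse y \<in> R" using R[of q p] \<open>0 \<in> R\<close> y by (cases "poly p x = 0") simp_all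
    fix z assume "z \<in> R"
    then obtain p' q' where z: "z = poly p' x / poly q' x" "poly_over K p'" "poly_over K q'" "poly q' x \<noteq> 0"
      using RE by metis
    have "y + z = poly (p * q' + p' * q) x / poly (q * q') x"
      unfolding y(1) z(1) using y(4) z(4) by (simp add: add_frac_eq)
    then show "y + z \<in> R" using R[of "p * q' + p' * q" "q * q'"] y z K_poly by simp
    have "y * z = poly (p * p') x / poly (q * q') x"
      unfolding y(1) z(1) by simp
    then show "y * z \<in> R" using R[of "p * p'" "q * q'"] y z K_poly by simp
  qed
  moreover have "c \<in> R" if "c \<in> K" for c
    using R[of "[:c:]" 1] that K K_poly by (simp add: poly_over_pCons)
  moreover have "x \<in> R"
    using R[of "[:0, 1:]" 1] K K_poly by (simp add: poly_over_pCons subfield_closed)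
  ultimately have "adjoin K {x} \<subseteq> R"
    by (intro adjoin_least) auto
  moreover have "R \<subseteq> adjoin K {x}"
  proof
    fix y assume "y \<in> R"
    then obtain p q where y: "y = poly p x / poly q x" "poly_over K p" "poly_over K q"
      using RE by metis
    then show "y \<in> adjoin K {x}"
      using adjoin_base[of K "{x}"] adjoin_gen[of "{x}" K] is_subfield_adjoin[of K "{x}"]
      by (metis subfield_divide poly_over_value poly_over_mono insert_subset)
  qed
  ultimately show ?thesis unfolding R_def by (rule equalityI)
qed

text \<open>\<open>zero_iff\<close> makes p(x)/q(x) |-> p(y)/q(y) independent of the chosen fraction
  and keeps denominators nonzero. It covers transcendental and algebraic \<open>x\<close> at
  once.\<close>

lemma extend_to_adjoin_singleton:
  assumes "field_embedding K \<psi>"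
    and zero_iff: "\<And>p. poly_over K p \<Longrightarrow> poly p x = 0 \<longleftrightarrow> poly (map_poly \<psi> p) y = 0"
  obtains \<phi> where "field_embedding (adjoin K {x}) \<phi>" "\<And>c. c \<in> K \<Longrightarrow> \<phi> c = \<psi> c" "\<phi> x = y"
proof -
  interpret field_embedding K \<psi> by fact
  note K_poly = poly_over_closed[OF subfield]
  define rep where "rep z pq \<longleftrightarrow> z = poly (fst pq) x / poly (snd pq) x \<and> poly_over K (fst pq) \<and>
    poly_over K (snd pq) \<and> poly (snd pq) x \<noteq> 0" for z pq
  define \<phi> where "\<phi> z = (let pq = SOME pq. rep z pq in poly (map_poly \<psi> (fst pq)) y / poly (map_poly \<psi> (snd pq)) y)" for z
  have \<phi>: "\<phi> (poly p x / poly q x) = poly (map_poly \<psi> p) y / poly (map_poly \<psi> q) y"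
    if pq: "poly_over K p" "poly_over K q" "poly q x \<noteq> 0" for p q
  proof -
    have "rep (poly p x / poly q x) (p, q)" using pq by (simp add: rep_def)
    then have rep: "rep (poly p x / poly q x) (SOME pq. rep (poly p x / poly q x) pq)" by (rule someI)
    obtain p' q' where e: "(SOME pq. rep (poly p x / poly q x) pq) = (p', q')" by fastforce
    have p'q': "poly p x / poly q x = poly p' x / poly q' x" "poly_over K p'" "poly_over K q'" "poly q' x \<noteq> 0"
      using rep[unfolded e] by (auto simp: rep_def)
    have "poly (p * q' - p' * q) x = 0" using pq(3) p'q' by (simp add: frac_eq_eq)
    then have "poly (map_poly \<psi> (p * q' - p' * q)) y = 0"
      using pq p'q' zero_iff[of "p * q' - p' * q"] K_poly by simp
    moreover have "map_poly \<psi> (p * q' - p' * q) = map_poly \<psi> p * map_poly \<psi> q' - map_poly \<psi> p' * map_poly \<psi> q"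
      using pq p'q' by (simp add: map_poly_diff map_poly_mult poly_over_mult[OF subfield])
    ultimately show ?thesis
      using pq p'q' zero_iff[of q] zero_iff[of q'] unfolding \<phi>_def e by (simp add: frac_eq_eq)
  qed
  have frac: "\<exists>p q. z = poly p x / poly q x \<and> poly_over K p \<and> poly_over K q \<and> poly q x \<noteq> 0"
    if "z \<in> adjoin K {x}" for z using that unfolding adjoin_singleton[OF subfield] by blast
  have c: "\<phi> c = \<psi> c" if "c \<in> K" for c
    using \<phi>[of "[:c:]" 1] that subfield K_poly by (simp add: poly_over_pCons map_poly_pCons map_poly_0 map_poly_1)
  have "field_embedding (adjoin K {x}) \<phi>"
  proof (rule field_embeddingI[OF is_subfield_adjoin])
    show "\<phi> 1 = 1" using c[of 1] one subfield by (simp add: subfield_1)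
    fix u v assume "u \<in> adjoin K {x}" "v \<in> adjoin K {x}"
    obtain p q where pq: "u = poly p x / poly q x" "poly_over K p" "poly_over K q" "poly q x \<noteq> 0"
      using frac[OF \<open>u \<in> _\<close>] by metis
    obtain p' q' where p'q': "v = poly p' x / poly q' x" "poly_over K p'" "poly_over K q'" "poly q' x \<noteq> 0"
      using frac[OF \<open>v \<in> _\<close>] by metis
    have nz: "poly (map_poly \<psi> q) y \<noteq> 0" "poly (map_poly \<psi> q') y \<noteq> 0"
      using zero_iff[OF pq(3)] zero_iff[OF p'q'(3)] pq(4) p'q'(4) by simp_all
    have \<phi>u: "\<phi> u = poly (map_poly \<psi> p) y / poly (map_poly \<psi> q) y"
      and \<phi>v: "\<phi> v = poly (map_poly \<psi> p') y / poly (map_poly \<psi> q') y"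
      using \<phi> pq p'q' by simp_all
    have "u + v = poly (p * q' + p' * q) x / poly (q * q') x"
      unfolding pq(1) p'q'(1) using pq(4) p'q'(4) by (simp add: add_frac_eq)
    then show "\<phi> (u + v) = \<phi> u + \<phi> v"
      using \<phi>[of "p * q' + p' * q" "q * q'"] pq(2-4) p'q'(2-4) nz
      unfolding \<phi>u \<phi>v
      by (simp add: map_poly_add map_poly_mult poly_over_mult[OF subfield] poly_over_add[OF subfield] add_frac_eq)
    have "u * v = poly (p * p') x / poly (q * q') x"
      unfolding pq(1) p'q'(1) by simp
    then show "\<phi> (u * v) = \<phi> u * \<phi> v"
      using \<phi>[of "p * p'" "q * q'"] pq(2-4) p'q'(2-4) nz
      unfolding \<phi>u \<phi>v by (simp add: map_poly_mult poly_over_mult[OF subfield])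
  qed
  moreover have "\<phi> x = y"
    using \<phi>[of "[:0, 1:]" 1] subfield K_poly by (simp add: poly_over_pCons map_poly_pCons map_poly_0 map_poly_1 zero one subfield_closed)
  ultimately show thesis using c that by blast
qed

section \<open>Algebraic elements\<close>

lemma algebraic_overI: "poly_over K p \<Longrightarrow> p \<noteq> 0 \<Longrightarrow> poly p x = 0 \<Longrightarrow> algebraic_over K x"
  unfolding algebraic_over_def by blast

lemma algebraic_over_mono: "K \<subseteq> L \<Longrightarrow> algebraic_over K x \<Longrightarrow> algebraic_over L x"
  unfolding algebraic_over_def using poly_over_mono by blast

lemma algebraic_over_self:
  assumes "is_subfield K" "x \<in> K"
  shows "algebraic_over K x"
  by (rule algebraic_overI[of _ "[:- x, 1:]"])
    (use assms in \<open>simp_all add: poly_over_pCons poly_over_0 subfield_closed\<close>)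

text \<open>The scalars form a set and not a type. Building combinations term by term gives
  induction over spans without families of coefficients.\<close>

inductive_set lin_span :: "'a::field set \<Rightarrow> 'a set \<Rightarrow> 'a set" for K W where
  lin_span_0: "0 \<in> lin_span K W"
| lin_span_step: "c \<in> K \<Longrightarrow> w \<in> W \<Longrightarrow> y \<in> lin_span K W \<Longrightarrow> c * w + y \<in> lin_span K W"

lemma lin_span_add: "x \<in> lin_span K W \<Longrightarrow> y \<in> lin_span K W \<Longrightarrow> x + y \<in> lin_span K W"
  by (induction rule: lin_span.induct) (auto simp: add.assoc intro: lin_span.intros)

lemma lin_span_scale:
  assumes "is_subfield K" "a \<in> K" "x \<in> lin_span K W"
  shows "a * x \<in> lin_span K W"
  using assms(3)
proof (induction rule: lin_span.induct)
  case (lin_span_step c w y)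
  then have "(a * c) * w + a * y \<in> lin_span K W"
    using assms by (intro lin_span.lin_span_step subfield_mult[OF assms(1)])
  then show ?case by (simp add: algebra_simps)
qed (simp add: lin_span_0)

lemma lin_span_base: "is_subfield K \<Longrightarrow> w \<in> W \<Longrightarrow> w \<in> lin_span K W"
  using lin_span_step[of 1 K w W 0] by (simp add: lin_span_0 subfield_1)

lemma lin_span_sum:
  "(\<And>i. i \<in> I \<Longrightarrow> f i \<in> lin_span K W) \<Longrightarrow> sum f I \<in> lin_span K W"
  by (induction I rule: infinite_finite_induct) (auto intro: lin_span_0 lin_span_add)

lemma lin_span_insertE:
  assumes K: "is_subfield K" and "y \<in> lin_span K (insert w W)"
  shows "\<exists>c\<in>K. \<exists>y'\<in>lin_span K W. y = c * w + y'"
  using assms(2)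
proof (induction rule: lin_span.induct)
  case lin_span_0
  show ?case using subfield_0[OF K] lin_span.lin_span_0 by (intro bexI[of _ 0]) auto
next
  case (lin_span_step a v y)
  then obtain c y' where c: "c \<in> K" "y' \<in> lin_span K W" "y = c * w + y'" by blast
  show ?case
  proof (cases "v = w")
    case True
    then have "a * v + y = (a + c) * w + y'" using c by (simp add: algebra_simps)
    then show ?thesis using c lin_span_step.hyps subfield_add[OF K] by blast
  next
    case False
    then have "a * v + y' \<in> lin_span K W" "a * v + y = c * w + (a * v + y')"
      using c lin_span_step.hyps by (auto intro: lin_span.lin_span_step)
    then show ?thesis using c by blast
  qed
qed

lemma lin_span_dependent:
  assumes K: "is_subfield K" and "finite W" "finite J" "card W < card J" "\<And>j. j \<in> J \<Longrightarrow> v j \<in> lin_span K W"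
  shows "\<exists>a. (\<forall>j\<in>J. a j \<in> K) \<and> (\<exists>j\<in>J. a j \<noteq> 0) \<and> (\<Sum>j\<in>J. a j * v j) = 0"
  using assms(2-)
proof (induction W arbitrary: J v rule: finite_induct)
  case empty
  have "lin_span K {} = {0}"
    by (auto elim: lin_span.cases intro: lin_span_0)
  then have "v j = 0" if "j \<in> J" for j using empty that by blast
  moreover have "J \<noteq> {}" using empty by auto
  ultimately show ?case using subfield_1[OF K] by (intro exI[of _ "\<lambda>_. 1"]) auto
next
  case (insert w W)
  obtain c v' where cv: "\<And>j. j \<in> J \<Longrightarrow> c j \<in> K \<and> v' j \<in> lin_span K W \<and> v j = c j * w + v' j"
    using lin_span_insertE[OF K insert.prems(3)] by metis
  show ?case
  proof (cases "\<forall>j\<in>J. c j = 0")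
    case True
    then have "v j \<in> lin_span K W" if "j \<in> J" for j using cv[OF that] that by simp
    moreover have "card W < card J" using insert by simp
    ultimately show ?thesis using insert.IH[of J v] insert.prems by blast
  next
    case False
    then obtain i where i: "i \<in> J" "c i \<noteq> 0" by blast
    \<comment> \<open>Gaussian elimination with pivot \<open>i\<close>: subtracting
      \<open>c j / c i\<close> times \<open>v i\<close> removes the component along
      \<open>w\<close>, so the remaining vectors lie in the span of \<open>W\<close>.\<close>
    define u where "u j = v' j - (c j / c i) * v' i" for j
    have "u j \<in> lin_span K W" if "j \<in> J - {i}" for j
    proof -
      have "v' j + (- (c j / c i)) * v' i \<in> lin_span K W"
        using cv i that K by (intro lin_span_add lin_span_scale subfield_closed) auto
      then show ?thesis by (simp add: u_def)
    qed
    moreover have "card W < card (J - {i})" using insert i by simp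
    ultimately obtain a where a: "\<forall>j\<in>J - {i}. a j \<in> K" "\<exists>j\<in>J - {i}. a j \<noteq> 0" "(\<Sum>j\<in>J - {i}. a j * u j) = 0"
      using insert.IH[of "J - {i}" u] insert.prems by blast
    define s where "s = (\<Sum>j\<in>J - {i}. a j * (c j / c i))"
    define b where "b j = (if j = i then - s else a j)" for j
    have "s \<in> K" unfolding s_def using a cv i K by (intro subfield_sum subfield_closed) auto
    have v: "v j = u j + (c j / c i) * v i" if "j \<in> J" for j
      using cv[OF that] cv[OF i(1)] i by (simp add: u_def field_simps)
    have "(\<Sum>j\<in>J - {i}. b j * v j) = (\<Sum>j\<in>J - {i}. a j * u j + a j * (c j / c i) * v i)"
      using v by (intro sum.cong) (auto simp: b_def algebra_simps)
    also have "\<dots> = s * v i"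
      using a by (simp add: sum.distrib sum_distrib_right s_def)
    finally have "(\<Sum>j\<in>J. b j * v j) = 0"
      using i insert.prems by (simp add: sum.remove[of J i] b_def)
    moreover have "\<forall>j\<in>J. b j \<in> K" using a \<open>s \<in> K\<close> K by (auto simp: b_def intro: subfield_uminus)
    moreover have "\<exists>j\<in>J. b j \<noteq> 0" using a by (auto simp: b_def)
    ultimately show ?thesis by blast
  qed
qed

text \<open>\<open>M\<close> may be any subset of a finitely generated span, so the notion applies
  to a ring before it is known to be a field.\<close>

definition finite_over :: "'a::field set \<Rightarrow> 'a set \<Rightarrow> bool" where
  "finite_over K M \<longleftrightarrow> (\<exists>W. finite W \<and> M \<subseteq> lin_span K W)"

lemma finite_over_refl: "is_subfield K \<Longrightarrow> finite_over K K"
  unfolding finite_over_def using lin_span_step[of _ K 1 "{1}" 0] by (intro exI[of _ "{1}"]) (auto simp: lin_span_0)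

lemma finite_over_trans:
  assumes K: "is_subfield K" and "finite_over K L" "finite_over L M"
  shows "finite_over K M"
proof -
  obtain W U where W: "finite W" "L \<subseteq> lin_span K W" and U: "finite U" "M \<subseteq> lin_span L U"
    using assms unfolding finite_over_def by auto
  define Z where "Z = (\<lambda>(w, u). w * u) ` (W \<times> U)"
  have 1: "c * u \<in> lin_span K Z" if "c \<in> lin_span K W" "u \<in> U" for c u
    using that
  proof (induction rule: lin_span.induct)
    case (lin_span_step c w y)
    then have "c * (w * u) + y * u \<in> lin_span K Z"
      by (intro lin_span.lin_span_step) (auto simp: Z_def)
    then show ?case by (simp add: algebra_simps)
  qed (simp add: lin_span_0)
  have "y \<in> lin_span K Z" if "y \<in> lin_span L U" for y
    using that by (induction rule: lin_span.induct) (use 1 W in \<open>auto intro: lin_span_0 lin_span_add\<close>)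
  moreover have "finite Z" using W U by (auto simp: Z_def)
  ultimately show ?thesis using U unfolding finite_over_def by blast
qed

text \<open>More powers of \<open>x\<close> than spanning elements are linearly dependent, and the
  relation is the polynomial sought.\<close>

lemma finite_over_imp_algebraic:
  assumes K: "is_subfield K" and M: "finite_over K M" and "\<And>n. x ^ n \<in> M"
  shows "algebraic_over K x"
proof -
  obtain W where W: "finite W" "M \<subseteq> lin_span K W" using M unfolding finite_over_def by auto
  obtain a where a: "\<forall>j\<in>{..card W}. a j \<in> K" "\<exists>j\<in>{..card W}. a j \<noteq> 0" "(\<Sum>j\<le>card W. a j * x ^ j) = 0"
    using lin_span_dependent[OF K W(1), of "{..card W}" "\<lambda>j. x ^ j"] assms W by auto
  define p where "p = (\<Sum>j\<le>card W. monom (a j) j)"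
  have co: "coeff p i = (if i \<le> card W then a i else 0)" for i
    by (simp add: p_def coeff_sum)
  show ?thesis
  proof (rule algebraic_overI[of _ p])
    show "poly_over K p" using a K by (auto simp: poly_over_def co subfield_0)
    show "p \<noteq> 0" using a(2) co by (metis atMost_iff coeff_0)
    show "poly p x = 0" using a(3) by (simp add: p_def poly_sum poly_monom)
  qed
qed

lemma minimal_poly_exists:
  assumes "algebraic_over K x"
  obtains m where "poly_over K m" "m \<noteq> 0" "poly m x = 0"
    "\<And>p. poly_over K p \<Longrightarrow> p \<noteq> 0 \<Longrightarrow> poly p x = 0 \<Longrightarrow> degree m \<le> degree p"
proof -
  define P where "P p \<longleftrightarrow> poly_over K p \<and> p \<noteq> 0 \<and> poly p x = 0" for p
  have "\<exists>p. P p" using assms unfolding algebraic_over_def P_def by blast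
  then have "P (arg_min degree P)" "\<And>p. P p \<Longrightarrow> degree (arg_min degree P) \<le> degree p"
    using arg_min_natI[of P _ degree] arg_min_nat_le[of P _ degree] by auto
  then show thesis using that unfolding P_def by blast
qed

lemma minimal_poly_dvd:
  assumes K: "is_subfield K" and m: "poly_over K m" "m \<noteq> 0" "poly m x = 0"
    and min: "\<And>q. poly_over K q \<Longrightarrow> q \<noteq> 0 \<Longrightarrow> poly q x = 0 \<Longrightarrow> degree m \<le> degree q"
    and q: "poly_over K q" "poly q x = 0"
  shows "q = q div m * m"
proof -
  have "poly (q mod m) x = 0"
    using q m by (metis add_0 div_mult_mod_eq mult_zero_right poly_add poly_mult)
  then have "q mod m = 0"
    using min[of "q mod m"] poly_over_div_mod(2)[OF K q(1) m(1)] degree_mod_less[OF m(2), of q] by force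
  then show ?thesis by (metis add.right_neutral div_mult_mod_eq)
qed

text \<open>A nonzero \<open>y\<close> has a minimal polynomial c + X g(X) with c nonzero, since
  otherwise g would be smaller; then 1/y = -g(y)/c.\<close>

lemma inverse_as_poly:
  assumes K: "is_subfield K" and "algebraic_over K y"
  obtains g where "poly_over K g" "inverse y = poly g y"
proof (cases "y = 0")
  case True
  then show thesis using that[of 0] poly_over_0[OF K] by simp
next
  case False
  obtain m where m: "poly_over K m" "m \<noteq> 0" "poly m y = 0"
    and min: "\<And>p. poly_over K p \<Longrightarrow> p \<noteq> 0 \<Longrightarrow> poly p y = 0 \<Longrightarrow> degree m \<le> degree p"
    using minimal_poly_exists[OF assms(2)] by blast
  obtain c g where cg: "m = pCons c g" by (cases m)
  then have K': "c \<in> K" "poly_over K g" using m poly_over_pCons[OF K] by auto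
  have "c \<noteq> 0"
  proof
    assume "c = 0"
    then have "g \<noteq> 0" "poly g y = 0" using m cg False by auto
    then show False using min[of g] K' cg by simp
  qed
  moreover have "c + y * poly g y = 0" using m cg by simp
  ultimately have "inverse y = poly (smult (- inverse c) g) y"
    using False by (simp add: field_simps add_eq_0_iff)
  then show thesis using that K' K by (metis poly_over_smult subfield_uminus subfield_inverse)
qed

lemma poly_over_compose:
  assumes "is_subfield K" "poly_over K p" "poly_over K q"
  shows "poly_over K (pcompose p q)"
  using assms(2)
  by (induction p)
    (use assms in \<open>auto simp: pcompose_pCons poly_over_pCons intro!: poly_over_add poly_over_mult poly_over_0\<close>)

text \<open>The polynomial values at \<open>x\<close> form a ring of finite dimension, so each of
  them is algebraic and its inverse is again a polynomial value.\<close>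

lemma adjoin_algebraic:
  assumes K: "is_subfield K" and x: "algebraic_over K x"
  shows "adjoin K {x} = {poly p x | p. poly_over K p}" "finite_over K (adjoin K {x})"
proof -
  define S where "S = {poly p x | p. poly_over K p}"
  note K_poly = poly_over_closed[OF K]
  have S: "poly p x \<in> S" if "poly_over K p" for p using that unfolding S_def by blast
  obtain m where m: "poly_over K m" "m \<noteq> 0" "poly m x = 0"
    using x unfolding algebraic_over_def by blast
  have "S \<subseteq> lin_span K ((\<lambda>i. x ^ i) ` {..degree m})"
  proof
    fix y assume "y \<in> S"
    then obtain p where p: "y = poly p x" "poly_over K p" unfolding S_def by blast
    have "y = poly (p mod m) x"
      using p m by (metis add_0 div_mult_mod_eq mult_zero_right poly_add poly_mult)
    also have "\<dots> = (\<Sum>i\<le>degree (p mod m). coeff (p mod m) i * x ^ i)"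
      by (simp add: poly_altdef)
    also have "\<dots> \<in> lin_span K ((\<lambda>i. x ^ i) ` {..degree m})"
    proof (intro lin_span_sum lin_span_scale[OF K] lin_span_base[OF K])
      fix i assume "i \<in> {..degree (p mod m)}"
      moreover have "degree (p mod m) \<le> degree m"
        using degree_mod_less[OF m(2), of p] by auto
      ultimately show "x ^ i \<in> (\<lambda>i. x ^ i) ` {..degree m}" by auto
      show "coeff (p mod m) i \<in> K"
        using poly_over_div_mod(2)[OF K p(2) m(1)] by (simp add: poly_over_def)
    qed
    finally show "y \<in> lin_span K ((\<lambda>i. x ^ i) ` {..degree m})" .
  qed
  then have fin: "finite_over K S" unfolding finite_over_def by blast
  have SE: "\<exists>p. y = poly p x \<and> poly_over K p" if "y \<in> S" for y using that unfolding S_def by blast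
  have "is_subfield S"
  proof (rule is_subfieldI)
    show "0 \<in> S" using S[of 0] K_poly by simp
    show "1 \<in> S" using S[of 1] K_poly by simp
    fix y assume "y \<in> S"
    then obtain p where p: "y = poly p x" "poly_over K p" using SE by blast
    show "- y \<in> S" using S[of "- p"] p K_poly by simp
    have "y ^ n \<in> S" for n
      using S[of "p ^ n"] p K_poly by simp
    then have "algebraic_over K y" using finite_over_imp_algebraic[OF K fin] by blast
    then obtain g where "poly_over K g" "inverse y = poly g y" using inverse_as_poly[OF K] by blast
    then show "inverse y \<in> S" using S[of "pcompose g p"] p poly_over_compose[OF K] by (simp add: poly_pcompose)
    fix z assume "z \<in> S"
    then obtain q where q: "z = poly q x" "poly_over K q" using SE by blast
    show "y + z \<in> S" using S[of "p + q"] p q K_poly by simp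
    show "y * z \<in> S" using S[of "p * q"] p q K_poly by simp
  qed
  moreover have "c \<in> S" if "c \<in> K" for c
    using S[of "[:c:]"] that K_poly K by (simp add: poly_over_pCons)
  moreover have "x \<in> S"
    using S[of "[:0, 1:]"] K_poly K by (simp add: poly_over_pCons subfield_closed)
  ultimately have "adjoin K {x} \<subseteq> S" by (intro adjoin_least) auto
  moreover have "S \<subseteq> adjoin K {x}"
    using adjoin_base[of K "{x}"] adjoin_gen[of "{x}" K] is_subfield_adjoin[of K "{x}"]
    unfolding S_def by (auto intro!: poly_over_value intro: poly_over_mono)
  ultimately show "adjoin K {x} = {poly p x | p. poly_over K p}" unfolding S_def by (rule equalityI)
  then show "finite_over K (adjoin K {x})" using fin unfolding S_def by simp
qed

lemma finite_over_subfield_imp_algebraic: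
  "is_subfield K \<Longrightarrow> is_subfield M \<Longrightarrow> finite_over K M \<Longrightarrow> x \<in> M \<Longrightarrow> algebraic_over K x"
  by (rule finite_over_imp_algebraic) (auto intro: subfield_power)

lemma finite_over_adjoin_finite:
  assumes K: "is_subfield K" and "finite S" "\<And>s. s \<in> S \<Longrightarrow> algebraic_over K s"
  obtains M where "is_subfield M" "K \<subseteq> M" "S \<subseteq> M" "finite_over K M"
  using assms(2-)
proof (induction S arbitrary: thesis rule: finite_induct)
  case empty
  then show ?case using K finite_over_refl by auto
next
  case (insert s S)
  obtain M where M: "is_subfield M" "K \<subseteq> M" "S \<subseteq> M" "finite_over K M"
    using insert.IH insert.prems(2) by blast
  have "algebraic_over M s" using insert.prems(2) M(2) algebraic_over_mono by blast
  then have "finite_over K (adjoin M {s})"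
    using adjoin_algebraic(2)[OF M(1)] finite_over_trans[OF K M(4)] by blast
  then show ?case
    using insert.prems(1) M adjoin_base[of M "{s}"] adjoin_gen[of "{s}" M] is_subfield_adjoin by blast
qed

lemma is_subfield_algebraics:
  assumes K: "is_subfield K"
  shows "is_subfield {x. algebraic_over K x}"
proof (rule is_subfieldI)
  show "0 \<in> {x. algebraic_over K x}" "1 \<in> {x. algebraic_over K x}"
    using K by (auto intro!: algebraic_over_self subfield_closed)
  fix x assume x: "x \<in> {x. algebraic_over K x}"
  have ex: "\<exists>M. is_subfield M \<and> x \<in> M \<and> y \<in> M \<and> finite_over K M" if "algebraic_over K y" for y
  proof -
    have "algebraic_over K s" if "s \<in> {x, y}" for s using that x \<open>algebraic_over K y\<close> by auto
    then obtain M where "is_subfield M" "K \<subseteq> M" "{x, y} \<subseteq> M" "finite_over K M"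
      by (rule finite_over_adjoin_finite[OF K, of "{x, y}", rotated]) auto
    then show ?thesis by blast
  qed
  from ex[of x] x obtain M where M: "is_subfield M" "x \<in> M" "finite_over K M" by blast
  then show "- x \<in> {x. algebraic_over K x}" "inverse x \<in> {x. algebraic_over K x}"
    using finite_over_subfield_imp_algebraic[OF K M(1,3)] M by (simp_all add: subfield_closed)
  fix y assume "y \<in> {x. algebraic_over K x}"
  with ex[of y] obtain M where M: "is_subfield M" "x \<in> M" "y \<in> M" "finite_over K M" by blast
  then show "x + y \<in> {x. algebraic_over K x}" "x * y \<in> {x. algebraic_over K x}"
    using finite_over_subfield_imp_algebraic[OF K M(1,4)] by (simp_all add: subfield_closed)
qed

lemma algebraic_over_trans:
  assumes K: "is_subfield K" and "\<And>y. y \<in> L \<Longrightarrow> algebraic_over K y" and "algebraic_over L x"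
  shows "algebraic_over K x"
proof -
  obtain p where p: "p \<noteq> 0" "poly_over L p" "poly p x = 0"
    using assms(3) unfolding algebraic_over_def by blast
  have "finite (range (coeff p))" by (simp add: range_coeff)
  moreover have "algebraic_over K s" if "s \<in> range (coeff p)" for s
    using that p(2) assms(2) unfolding poly_over_def by blast
  ultimately obtain M where M: "is_subfield M" "K \<subseteq> M" "range (coeff p) \<subseteq> M" "finite_over K M"
    by (rule finite_over_adjoin_finite[OF K])
  have "algebraic_over M x"
    using M p by (intro algebraic_overI[of _ p]) (auto simp: poly_over_def)
  then have "finite_over K (adjoin M {x})"
    using adjoin_algebraic(2)[OF M(1)] finite_over_trans[OF K M(4)] by blast
  then show ?thesis
    using finite_over_subfield_imp_algebraic[OF K is_subfield_adjoin] adjoin_gen[of "{x}" M] by blast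
qed

section \<open>Extending embeddings\<close>

text \<open>For nonzero \<open>q\<close> this says that \<open>q\<close> is a product of linear factors.\<close>
definition splits :: "'a::field poly \<Rightarrow> bool" where
  "splits q \<longleftrightarrow> (\<forall>m. m dvd q \<longrightarrow> degree m > 0 \<longrightarrow> (\<exists>y. poly m y = 0))"

lemma splits_alg_closed: "splits (q :: 'a::alg_closed_field poly)"
  by (simp add: splits_def alg_closed_imp_poly_has_root)

lemma splits_linear_mult:
  assumes "splits q"
  shows "splits ([:- a, 1:] * q)"
  unfolding splits_def
proof (intro allI impI)
  fix m assume m: "m dvd [:- a, 1:] * q" "0 < degree m"
  show "\<exists>y. poly m y = 0"
  proof (cases "poly m a = 0")
    case False
    obtain h where h: "[:- a, 1:] * q = m * h" using m by (elim dvdE)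
    then have "poly m a * poly h a = 0" by (metis mult_eq_0_iff poly_mult poly_eq_0_iff_dvd dvd_triv_left)
    then obtain h' where "h = [:- a, 1:] * h'" using False by (auto simp: poly_eq_0_iff_dvd elim: dvdE)
    then have "[:- a, 1:] * q = [:- a, 1:] * (m * h')" using h by (simp only: mult.left_commute)
    then have "q = m * h'" by (metis mult_left_cancel pCons_eq_0_iff zero_neq_one)
    then show ?thesis using assms m by (auto simp: splits_def)
  qed blast
qed

lemma splits_1: "splits 1"
  unfolding splits_def by (metis dvd_imp_degree_le degree_1 less_le_not_le one_neq_zero)

lemma splits_square_minus: "splits [:- (s * s), 0, 1:]"
proof -
  have "[:- (s * s), 0, 1:] = [:- s, 1:] * ([:- (- s), 1:] * 1)" by simp
  then show ?thesis using splits_linear_mult splits_1 by metis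
qed

lemma extend_to_root:
  assumes "field_embedding K \<psi>"
    and m: "poly_over K m" "m \<noteq> 0" "poly m x = 0"
    and min: "\<And>q. poly_over K q \<Longrightarrow> q \<noteq> 0 \<Longrightarrow> poly q x = 0 \<Longrightarrow> degree m \<le> degree q"
    and y: "poly (map_poly \<psi> m) y = 0"
  obtains \<phi> where "field_embedding (adjoin K {x}) \<phi>" "\<And>c. c \<in> K \<Longrightarrow> \<phi> c = \<psi> c" "\<phi> x = y"
proof -
  interpret field_embedding K \<psi> by fact
  have map_div: "map_poly \<psi> q = map_poly \<psi> (q div m) * map_poly \<psi> m" if "poly_over K q" "poly q x = 0" for q
    using minimal_poly_dvd[OF subfield m min that] map_poly_mult poly_over_div_mod(1)[OF subfield that(1) m(1)] m(1) by metis
  \<comment> \<open>Euclid's algorithm for \<open>q\<close> and \<open>m\<close> in inductive form: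
    after mapping, remainders keep the root \<open>y\<close>, and minimality of \<open>m\<close>
    leaves only a nonzero constant, which has no root.\<close>
  have nz: "poly (map_poly \<psi> q) y \<noteq> 0" if "poly_over K q" "poly q x \<noteq> 0" for q
    using that
  proof (induction "degree q" arbitrary: q rule: less_induct)
    case less
    then have q0: "q \<noteq> 0" by auto
    have dvm: "poly (map_poly \<psi> (b mod c)) y = 0"
      if "poly (map_poly \<psi> b) y = 0" "poly (map_poly \<psi> c) y = 0" "poly_over K b" "poly_over K c" for b c
    proof -
      have "map_poly \<psi> (b mod c) = map_poly \<psi> b - map_poly \<psi> (b div c) * map_poly \<psi> c"
        using poly_over_div_mod[OF subfield that(3,4)] that(4)
        by (metis map_poly_mult add_diff_cancel_left' div_mult_mod_eq map_poly_add poly_over_mult subfield)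
      then show ?thesis using that by simp
    qed
    show ?case
    proof
      assume q: "poly (map_poly \<psi> q) y = 0"
      show False
      proof (cases "degree q < degree m")
        case True
        define r where "r = m mod q"
        have rK: "poly_over K r" "poly_over K (m div q)"
          using poly_over_div_mod[OF subfield m(1) less.prems(1)] by (auto simp: r_def)
        have ry: "poly (map_poly \<psi> r) y = 0" using dvm[OF y q m(1) less.prems(1)] by (simp add: r_def)
        have mq: "m = m div q * q + r" by (simp add: r_def)
        have "r = 0"
        proof (rule ccontr)
          assume "r \<noteq> 0"
          then have dr: "degree r < degree q" using degree_mod_less[OF q0, of m] by (simp add: r_def)
          then have "poly r x = 0" using less.hyps[OF dr rK(1)] ry by blast
          then show False using min[OF rK(1) \<open>r \<noteq> 0\<close>] dr True by simp
        qed
        then have "poly (m div q) x = 0" using m(3) mq less.prems(2)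
          by (metis add.right_neutral mult_eq_0_iff poly_mult)
        moreover have mq': "m = m div q * q" using mq \<open>r = 0\<close> by simp
        ultimately have "degree m \<le> degree (m div q)" using min[OF rK(2)] m(2) by (metis mult_zero_left)
        moreover have "degree m = degree (m div q) + degree q"
          using mq' m(2) by (metis degree_mult_eq mult_zero_left mult_zero_right)
        ultimately have "degree q = 0" by simp
        then obtain c where "q = [:c:]" by (elim degree_eq_zeroE)
        then show False using q q0 eq_0_iff less.prems(1) poly_over_pCons[OF subfield]
          by (auto simp: map_poly_pCons map_poly_0)
      next
        case False
        define r where "r = q mod m"
        have "poly_over K r" using poly_over_div_mod[OF subfield less.prems(1) m(1)] by (simp add: r_def)
        moreover have "poly r x = poly q x"
          using m(3) unfolding r_def by (metis add_0 div_mult_mod_eq mult_zero_right poly_add poly_mult)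
        moreover from this have "degree r < degree q"
          using degree_mod_less[OF m(2), of q] False less.prems(2) unfolding r_def by auto
        ultimately have "poly (map_poly \<psi> r) y \<noteq> 0" using less.hyps less.prems(2) by simp
        then show False using dvm[OF q y less.prems(1) m(1)] by (simp add: r_def)
      qed
    qed
  qed
  have "poly q x = 0 \<longleftrightarrow> poly (map_poly \<psi> q) y = 0" if "poly_over K q" for q
    using nz[OF that] map_div[OF that] y by (cases "poly q x = 0") auto
  from extend_to_adjoin_singleton[OF assms(1) this] show thesis using that by metis
qed

lemma extend_to_algebraic:
  assumes "field_embedding K \<psi>"
    and x: "p \<noteq> 0" "poly_over K p" "poly p x = 0" and split: "splits (map_poly \<psi> p)"
  obtains \<phi> where "field_embedding (adjoin K {x}) \<phi>" "\<And>c. c \<in> K \<Longrightarrow> \<phi> c = \<psi> c"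
proof -
  interpret field_embedding K \<psi> by fact
  have "algebraic_over K x" using x by (intro algebraic_overI)
  then obtain m where m: "poly_over K m" "m \<noteq> 0" "poly m x = 0"
    and min: "\<And>q. poly_over K q \<Longrightarrow> q \<noteq> 0 \<Longrightarrow> poly q x = 0 \<Longrightarrow> degree m \<le> degree q"
    using minimal_poly_exists by blast
  have "degree m \<noteq> 0"
  proof
    assume "degree m = 0"
    then obtain c where "m = [:c:]" by (elim degree_eq_zeroE)
    then show False using m by simp
  qed
  moreover have "map_poly \<psi> m dvd map_poly \<psi> p"
    using minimal_poly_dvd[OF subfield m min x(2,3)] map_poly_mult poly_over_div_mod(1)[OF subfield x(2) m(1)] m(1)
    by (metis dvd_triv_right)
  ultimately obtain y where y: "poly (map_poly \<psi> m) y = 0"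
    using split degree_map[OF m(1)] unfolding splits_def by auto
  show thesis
    by (rule extend_to_root[OF assms(1) m _ y]) (use min that in blast)+
qed

text \<open>Zorn's lemma, with the adjunction of a single root as the step. The target has only to
  split the polynomials of the generators; this matters for Laurent series, which are not
  algebraically closed.\<close>

lemma extend_embedding:
  fixes \<psi> :: "'a::field \<Rightarrow> 'b::field"
  assumes emb: "field_embedding K \<psi>"
    and Y: "\<And>y. y \<in> Y \<Longrightarrow> \<exists>p. p \<noteq> 0 \<and> poly_over K p \<and> poly p y = 0 \<and> splits (map_poly \<psi> p)"
  obtains \<phi> where "field_embedding (adjoin K Y) \<phi>" "\<And>c. c \<in> K \<Longrightarrow> \<phi> c = \<psi> c"
proof -
  define ext where "ext L \<phi> \<longleftrightarrow> field_embedding L \<phi> \<and> K \<subseteq> L \<and> (\<forall>c\<in>K. \<phi> c = \<psi> c)" for L and \<phi> :: "'a \<Rightarrow> 'b"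
  \<comment> \<open>Extensions are ordered by inclusion of their graphs, since as total functions
    they carry arbitrary values outside their domains.\<close>
  define graph where "graph L \<phi> = (\<lambda>x. (x, \<phi> x)) ` L" for L :: "'a set" and \<phi> :: "'a \<Rightarrow> 'b"
  define \<A> where "\<A> = {graph L \<phi> | L \<phi>. ext L \<phi>}"
  have "\<exists>M\<in>\<A>. \<forall>X\<in>\<A>. M \<subseteq> X \<longrightarrow> X = M"
  proof (rule subset_Zorn_nonempty)
    show "\<A> \<noteq> {}" using emb by (auto simp: \<A>_def ext_def)
    fix \<C> assume ne: "\<C> \<noteq> {}" and ch: "subset.chain \<A> \<C>"
    define L where "L = fst ` \<Union>\<C>"
    define \<phi> where "\<phi> x = (SOME y. (x, y) \<in> \<Union>\<C>)" for x
    have G: "\<exists>L' \<phi>'. G = graph L' \<phi>' \<and> ext L' \<phi>'" if "G \<in> \<C>" for G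
      using ch that unfolding subset.chain_def \<A>_def by blast
    have both: "\<exists>L' \<phi>'. graph L' \<phi>' \<in> \<C> \<and> ext L' \<phi>' \<and> a \<in> graph L' \<phi>' \<and> b \<in> graph L' \<phi>'"
      if ab: "a \<in> \<Union>\<C>" "b \<in> \<Union>\<C>" for a b
    proof -
      obtain G H where "G \<in> \<C>" "H \<in> \<C>" "a \<in> G" "b \<in> H" using ab by blast
      moreover from this have "G \<subseteq> H \<or> H \<subseteq> G" using ch unfolding subset.chain_def by blast
      ultimately show ?thesis using G by (metis subsetD)
    qed
    have \<phi>: "\<phi> x = y" if "(x, y) \<in> \<Union>\<C>" for x y
    proof -
      have "(x, \<phi> x) \<in> \<Union>\<C>" unfolding \<phi>_def using that by (rule someI)
      from both[OF that this] show ?thesis by (auto simp: graph_def)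
    qed
    have two: "\<exists>L' \<phi>'. graph L' \<phi>' \<in> \<C> \<and> ext L' \<phi>' \<and> x \<in> L' \<and> y \<in> L'" if xy: "x \<in> L" "y \<in> L" for x y
    proof -
      obtain a where a: "x = fst a" "a \<in> \<Union>\<C>" using xy(1) unfolding L_def by (rule imageE)
      obtain b where b: "y = fst b" "b \<in> \<Union>\<C>" using xy(2) unfolding L_def by (rule imageE)
      from both[OF a(2) b(2)] show ?thesis unfolding graph_def a(1) b(1) by fastforce
    qed
    have sub: "x \<in> L \<and> \<phi> x = \<phi>' x" if "graph L' \<phi>' \<in> \<C>" "x \<in> L'" for L' \<phi>' x
    proof -
      have "(x, \<phi>' x) \<in> \<Union>\<C>" using that unfolding graph_def by blast
      then show ?thesis using \<phi> unfolding L_def by (metis fst_conv imageI)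
    qed
    have KL: "K \<subseteq> L \<and> (\<forall>c\<in>K. \<phi> c = \<psi> c)"
    proof -
      obtain L' \<phi>' where *: "graph L' \<phi>' \<in> \<C>" "ext L' \<phi>'" using ne G by blast
      then show ?thesis using sub[OF *(1)] unfolding ext_def by auto
    qed
    have clos: "x + y \<in> L \<and> x * y \<in> L \<and> - x \<in> L \<and> inverse x \<in> L \<and> \<phi> (x + y) = \<phi> x + \<phi> y \<and> \<phi> (x * y) = \<phi> x * \<phi> y"
      if xy: "x \<in> L" "y \<in> L" for x y
    proof -
      obtain L' \<phi>' where *: "graph L' \<phi>' \<in> \<C>" "ext L' \<phi>'" "x \<in> L'" "y \<in> L'" using two[OF xy] by blast
      then interpret L': field_embedding L' \<phi>' by (simp add: ext_def)
      show ?thesis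
        using sub[OF *(1)] *(3,4) subfield_closed[OF L'.subfield] L'.add[OF *(3,4)] L'.mult[OF *(3,4)] by simp
    qed
    have "field_embedding L \<phi>"
    proof (rule field_embeddingI[OF is_subfieldI])
      interpret field_embedding K \<psi> by fact
      show "0 \<in> L" "1 \<in> L" "\<phi> 1 = 1"
        using KL subfield_0[OF subfield] subfield_1[OF subfield] one by auto
    qed (use clos in blast)+
    then have "ext L \<phi>" using KL by (simp add: ext_def)
    moreover have "\<Union>\<C> = graph L \<phi>"
    proof (intro equalityI subsetI)
      fix a assume a: "a \<in> \<Union>\<C>"
      have "a = (fst a, \<phi> (fst a))" using \<phi>[of "fst a" "snd a"] a by simp
      moreover have "fst a \<in> L" unfolding L_def using a by (rule imageI)
      ultimately show "a \<in> graph L \<phi>"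
        unfolding graph_def by (rule image_eqI)
    next
      fix a assume "a \<in> graph L \<phi>"
      then obtain x where x: "x \<in> L" "a = (x, \<phi> x)" by (auto simp: graph_def)
      from x(1) obtain b where "x = fst b" "b \<in> \<Union>\<C>" unfolding L_def by (rule imageE)
      then have b: "(x, snd b) \<in> \<Union>\<C>" by simp
      show "a \<in> \<Union>\<C>" unfolding x(2) \<phi>[OF b] by (rule b)
    qed
    ultimately show "\<Union>\<C> \<in> \<A>" unfolding \<A>_def by blast
  qed
  then obtain M where M: "M \<in> \<A>" and Mmax: "\<And>X. X \<in> \<A> \<Longrightarrow> M \<subseteq> X \<Longrightarrow> X = M" by auto
  from M obtain L \<phi> where L: "ext L \<phi>" and M_eq: "M = graph L \<phi>" unfolding \<A>_def by auto
  have max: "graph L' \<phi>' = graph L \<phi>" if "ext L' \<phi>'" "graph L \<phi> \<subseteq> graph L' \<phi>'" for L' \<phi>'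
    using Mmax[of "graph L' \<phi>'"] that unfolding M_eq \<A>_def by auto
  interpret K: field_embedding K \<psi> by fact
  interpret L: field_embedding L \<phi> using L by (simp add: ext_def)
  have KL: "K \<subseteq> L" and \<phi>\<psi>: "\<And>c. c \<in> K \<Longrightarrow> \<phi> c = \<psi> c" using L by (auto simp: ext_def)
  have "y \<in> L" if "y \<in> Y" for y
  proof -
    obtain p where p: "p \<noteq> 0" "poly_over K p" "poly p y = 0" "splits (map_poly \<psi> p)" using Y[OF \<open>y \<in> Y\<close>] by blast
    have "map_poly \<psi> p = map_poly \<phi> p"
      using p(2) \<phi>\<psi> by (auto simp: poly_eq_iff K.coeff_map L.coeff_map poly_over_def)
    then obtain \<phi>' where \<phi>': "field_embedding (adjoin L {y}) \<phi>'" "\<And>c. c \<in> L \<Longrightarrow> \<phi>' c = \<phi> c"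
      using extend_to_algebraic[OF L.field_embedding_axioms p(1) poly_over_mono[OF KL p(2)] p(3)] p(4) by metis
    have "ext (adjoin L {y}) \<phi>'"
      using \<phi>' KL \<phi>\<psi> adjoin_base[of L "{y}"] unfolding ext_def by (metis subset_iff)
    moreover have "graph L \<phi> \<subseteq> graph (adjoin L {y}) \<phi>'"
      using \<phi>'(2) adjoin_base[of L "{y}"] unfolding graph_def by (auto simp: image_iff)
    ultimately have "graph (adjoin L {y}) \<phi>' = graph L \<phi>" using max by blast
    moreover have "y \<in> adjoin L {y}" using adjoin_gen[of "{y}" L] by simp
    ultimately show "y \<in> L" unfolding graph_def by auto
  qed
  then have "adjoin K Y \<subseteq> L" using KL L.subfield by (intro adjoin_least) auto
  then show thesis
    using that[of \<phi>] field_embedding_subset[OF L.field_embedding_axioms is_subfield_adjoin] \<phi>\<psi> by blast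
qed

section \<open>Automorphisms\<close>

definition automorphism :: "('a::field \<Rightarrow> 'a) \<Rightarrow> bool" where
  "automorphism \<phi> \<longleftrightarrow> field_embedding UNIV \<phi> \<and> surj \<phi>"

lemma automorphism_embedding: "automorphism \<phi> \<Longrightarrow> field_embedding UNIV \<phi>"
  by (simp add: automorphism_def)

lemma
  assumes "automorphism \<phi>"
  shows automorphism_0: "\<phi> 0 = 0"
    and automorphism_1: "\<phi> 1 = 1"
    and automorphism_add: "\<phi> (x + y) = \<phi> x + \<phi> y"
    and automorphism_diff: "\<phi> (x - y) = \<phi> x - \<phi> y"
    and automorphism_uminus: "\<phi> (- x) = - \<phi> x"
    and automorphism_mult: "\<phi> (x * y) = \<phi> x * \<phi> y"
    and automorphism_divide: "\<phi> (x / y) = \<phi> x / \<phi> y"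
    and automorphism_power: "\<phi> (x ^ n) = \<phi> x ^ n"
    and automorphism_sum: "\<phi> (sum f I) = (\<Sum>i\<in>I. \<phi> (f i))"
    and automorphism_eq_iff: "\<phi> x = \<phi> y \<longleftrightarrow> x = y"
    and automorphism_eq_0_iff: "\<phi> x = 0 \<longleftrightarrow> x = 0"
proof -
  interpret field_embedding UNIV \<phi> using assms by (rule automorphism_embedding)
  show "\<phi> 0 = 0" "\<phi> 1 = 1" "\<phi> (x + y) = \<phi> x + \<phi> y" "\<phi> (x - y) = \<phi> x - \<phi> y" "\<phi> (- x) = - \<phi> x"
    "\<phi> (x * y) = \<phi> x * \<phi> y" "\<phi> (x / y) = \<phi> x / \<phi> y" "\<phi> (x ^ n) = \<phi> x ^ n"
    "\<phi> (sum f I) = (\<Sum>i\<in>I. \<phi> (f i))" "\<phi> x = \<phi> y \<longleftrightarrow> x = y" "\<phi> x = 0 \<longleftrightarrow> x = 0"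
    by (simp_all add: zero one add diff uminus mult divide power sum eq_iff eq_0_iff)
qed

lemmas automorphism_simps = automorphism_0 automorphism_1 automorphism_add automorphism_diff
  automorphism_uminus automorphism_mult automorphism_divide automorphism_power automorphism_sum

lemma automorphism_of_nat: "automorphism \<phi> \<Longrightarrow> \<phi> (of_nat n) = of_nat n"
  by (induction n) (simp_all add: automorphism_simps)

lemma automorphism_inverse: "automorphism \<phi> \<Longrightarrow> \<phi> (inverse x) = inverse (\<phi> x)"
  using automorphism_divide[of \<phi> 1 x] by (simp add: automorphism_1 inverse_eq_divide)

lemma automorphismI:
  assumes "\<phi> 1 = 1" "\<And>x y. \<phi> (x + y) = \<phi> x + \<phi> y" "\<And>x y. \<phi> (x * y) = \<phi> x * \<phi> y" "surj \<phi>"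
  shows "automorphism \<phi>"
  using assms by (auto simp: automorphism_def is_subfield_UNIV intro!: field_embeddingI)

lemma automorphism_bij: "automorphism \<phi> \<Longrightarrow> bij \<phi>"
  by (simp add: bij_def inj_def automorphism_eq_iff) (simp add: automorphism_def)

lemma automorphism_comp:
  assumes "automorphism \<phi>" "automorphism \<psi>"
  shows "automorphism (\<phi> \<circ> \<psi>)"
proof (rule automorphismI)
  show "surj (\<phi> \<circ> \<psi>)" using assms by (intro comp_surj) (auto simp: automorphism_def)
qed (use assms in \<open>simp_all add: automorphism_simps\<close>)

lemma automorphism_inv_apply:
  assumes "automorphism \<phi>"
  shows "inv \<phi> (\<phi> x) = x" "\<phi> (inv \<phi> x) = x"
  using automorphism_bij[OF assms] by (simp_all add: bij_def surj_f_inv_f)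

lemma automorphism_inv:
  assumes "automorphism \<phi>"
  shows "automorphism (inv \<phi>)"
proof (rule automorphismI)
  note inv_eq = automorphism_inv_apply[OF assms]
  show "surj (inv \<phi>)" using inv_eq(1) by (metis surjI)
  show "inv \<phi> 1 = 1" using inv_eq(1)[of 1] assms by (simp add: automorphism_simps)
  fix x y
  show "inv \<phi> (x + y) = inv \<phi> x + inv \<phi> y" "inv \<phi> (x * y) = inv \<phi> x * inv \<phi> y"
    using inv_eq(1)[of "inv \<phi> x + inv \<phi> y"] inv_eq(1)[of "inv \<phi> x * inv \<phi> y"] assms
    by (simp_all add: automorphism_simps inv_eq(2))
qed

lemma is_subfield_equalizer:
  assumes "automorphism \<phi>" "automorphism \<psi>"
  shows "is_subfield {x. \<phi> x = \<psi> x}"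
  by (rule is_subfieldI) (use assms in \<open>simp_all add: automorphism_simps automorphism_inverse\<close>)

lemma automorphisms_agree_adjoin:
  assumes "automorphism \<phi>" "automorphism \<psi>" "\<And>x. x \<in> K \<Longrightarrow> \<phi> x = \<psi> x" "\<And>x. x \<in> S \<Longrightarrow> \<phi> x = \<psi> x"
    and "x \<in> adjoin K S"
  shows "\<phi> x = \<psi> x"
  using adjoin_least[OF is_subfield_equalizer[OF assms(1,2)], of K S] assms(3-) by blast

lemma automorphism_id: "automorphism (\<lambda>x. x)"
  by (rule automorphismI) auto

lemma automorphism_fixes_adjoin:
  assumes "automorphism \<phi>" "\<And>x. x \<in> K \<Longrightarrow> \<phi> x = x" "\<And>x. x \<in> S \<Longrightarrow> \<phi> x = x" "x \<in> adjoin K S"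
  shows "\<phi> x = x"
  using automorphisms_agree_adjoin[OF assms(1) automorphism_id] assms(2-) by blast

lemma automorphism_maps_adjoin:
  assumes \<phi>: "automorphism \<phi>" and KS: "\<And>x. x \<in> K \<Longrightarrow> \<phi> x \<in> L" "\<And>x. x \<in> S \<Longrightarrow> \<phi> x \<in> L"
    and L: "is_subfield L" and x: "x \<in> adjoin K S"
  shows "\<phi> x \<in> L"
proof -
  have "is_subfield {x. \<phi> x \<in> L}"
    by (rule is_subfieldI)
      (use \<phi> L in \<open>simp_all add: automorphism_simps automorphism_inverse subfield_closed\<close>)
  then show ?thesis using adjoin_least[of "{x. \<phi> x \<in> L}" K S] KS x by blast
qed

lemma map_poly_automorphism:
  assumes "automorphism \<phi>"
  shows "coeff (map_poly \<phi> p) i = \<phi> (coeff p i)" "map_poly \<phi> (p * q) = map_poly \<phi> p * map_poly \<phi> q"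
    "poly (map_poly \<phi> p) (\<phi> x) = \<phi> (poly p x)" "degree (map_poly \<phi> p) = degree p"
    "map_poly \<phi> p = 0 \<longleftrightarrow> p = 0" "map_poly \<phi> (pCons a p) = pCons (\<phi> a) (map_poly \<phi> p)"
    "map_poly \<phi> 0 = 0" "map_poly \<phi> 1 = 1"
proof -
  interpret field_embedding UNIV \<phi> using assms by (rule automorphism_embedding)
  have [simp]: "poly_over UNIV p" for p :: "'a poly" by (simp add: poly_over_def)
  show "coeff (map_poly \<phi> p) i = \<phi> (coeff p i)" "map_poly \<phi> (p * q) = map_poly \<phi> p * map_poly \<phi> q"
    "poly (map_poly \<phi> p) (\<phi> x) = \<phi> (poly p x)" "degree (map_poly \<phi> p) = degree p"
    "map_poly \<phi> p = 0 \<longleftrightarrow> p = 0" "map_poly \<phi> (pCons a p) = pCons (\<phi> a) (map_poly \<phi> p)"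
    "map_poly \<phi> 0 = 0" "map_poly \<phi> 1 = 1"
    by (simp_all add: coeff_map map_poly_mult poly_map degree_map map_poly_eq_0_iff map_poly_pCons map_poly_0 map_poly_1)
qed

lemma automorphism_root:
  assumes "automorphism \<phi>" "\<And>x. x \<in> K \<Longrightarrow> \<phi> x = x" "poly_over K p" "poly p x = 0"
  shows "poly p (\<phi> x) = 0"
proof -
  have "map_poly \<phi> p = p"
    using assms by (auto simp: poly_eq_iff map_poly_automorphism poly_over_def)
  then show ?thesis using map_poly_automorphism(3)[OF assms(1), of p x] assms by (simp add: automorphism_0)
qed

text \<open>The image is isomorphic to an algebraically closed field, so it contains every element
  algebraic over it.\<close>

lemma embedding_surj:
  fixes \<phi> :: "'a::alg_closed_field \<Rightarrow> 'a"
  assumes emb: "field_embedding UNIV \<phi>" and alg: "\<And>y. algebraic_over (range \<phi>) y"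
  shows "surj \<phi>"
proof -
  interpret field_embedding UNIV \<phi> by fact
  have UN: "poly_over UNIV p" for p :: "'a poly" by (simp add: poly_over_def)
  have root: "y \<in> range \<phi>" if "q \<noteq> 0" "poly (map_poly \<phi> q) y = 0" for q y
    using that
  proof (induction "degree q" arbitrary: q rule: less_induct)
    case less
    show ?case
    proof (cases "degree q = 0")
      case True
      then obtain c where "q = [:c:]" by (elim degree_eq_zeroE)
      then show ?thesis using less.prems eq_0_iff by (auto simp: map_poly_pCons map_poly_0)
    next
      case False
      then obtain r where "poly q r = 0" using alg_closed_imp_poly_has_root[of q] by auto
      then obtain q' where q': "q = [:- r, 1:] * q'" by (auto simp: poly_eq_0_iff_dvd elim: dvdE)
      then have "q' \<noteq> 0" using less.prems by auto
      then have "degree q' < degree q" unfolding q' by (subst degree_mult_eq) auto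
      moreover have "map_poly \<phi> q = [:- \<phi> r, 1:] * map_poly \<phi> q'"
        unfolding q' map_poly_mult[OF UN UN] by (simp add: map_poly_pCons map_poly_0 uminus one)
      ultimately show ?thesis using less \<open>q' \<noteq> 0\<close> by auto
    qed
  qed
  have "y \<in> range \<phi>" for y
  proof -
    obtain p where p: "p \<noteq> 0" "poly_over (range \<phi>) p" "poly p y = 0"
      using alg[of y] unfolding algebraic_over_def by blast
    define q where "q = map_poly (inv \<phi>) p"
    have inj: "inj \<phi>" using eq_iff by (simp add: inj_def)
    then have "inv \<phi> 0 = 0" using zero by (metis inv_f_f)
    then have "map_poly \<phi> q = p"
      using p(2) by (auto simp: q_def poly_eq_iff coeff_map coeff_map_poly poly_over_def f_inv_into_f)
    moreover from this have "q \<noteq> 0" using p(1) map_poly_0 by auto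
    ultimately show ?thesis using root[of q y] p(3) by simp
  qed
  then show ?thesis by auto
qed

text \<open>Algebraicity over \<open>K\<close> lets the embedding be extended everywhere;
  algebraicity over its image makes the extension surjective.\<close>

lemma extend_to_automorphism:
  fixes K :: "'a::alg_closed_field set"
  assumes \<psi>: "field_embedding K \<psi>" and alg: "\<And>x. algebraic_over K x" "\<And>x. algebraic_over (\<psi> ` K) x"
  obtains \<phi> where "automorphism \<phi>" "\<And>c. c \<in> K \<Longrightarrow> \<phi> c = \<psi> c"
proof -
  have "\<exists>p. p \<noteq> 0 \<and> poly_over K p \<and> poly p y = 0 \<and> splits (map_poly \<psi> p)" for y
    using alg(1)[of y] splits_alg_closed unfolding algebraic_over_def by blast
  then obtain \<phi> where \<phi>: "field_embedding (adjoin K UNIV) \<phi>" "\<And>c. c \<in> K \<Longrightarrow> \<phi> c = \<psi> c"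
    using extend_embedding[OF \<psi>, of UNIV] by metis
  have "adjoin K UNIV = UNIV" using adjoin_gen[of UNIV K] by auto
  with \<phi>(1) have emb: "field_embedding UNIV \<phi>" by simp
  have "\<psi> ` K \<subseteq> range \<phi>" using \<phi>(2) by (metis image_subsetI rangeI)
  then have "algebraic_over (range \<phi>) y" for y using alg(2) algebraic_over_mono by blast
  then have "surj \<phi>" using embedding_surj[OF emb] by blast
  then show thesis using emb \<phi>(2) that by (simp add: automorphism_def)
qed

text \<open>In characteristic 0 the minimal polynomial of an element outside \<open>K\<close> has a
  second root, to which the element can be sent. This is the half of the Galois correspondence used
  throughout: what all automorphisms over \<open>K\<close> fix lies in \<open>K\<close>.\<close>

lemma exists_automorphism_moving:
  fixes K :: "'a::{alg_closed_field, field_char_0} set"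
  assumes K: "is_subfield K" and alg: "\<And>x. algebraic_over K x" and x: "x \<notin> K"
  obtains \<phi> where "automorphism \<phi>" "\<And>c. c \<in> K \<Longrightarrow> \<phi> c = c" "\<phi> x \<noteq> x"
proof -
  obtain m where m: "poly_over K m" "m \<noteq> 0" "poly m x = 0"
    and min: "\<And>q. poly_over K q \<Longrightarrow> q \<noteq> 0 \<Longrightarrow> poly q x = 0 \<Longrightarrow> degree m \<le> degree q"
    using minimal_poly_exists[OF alg] by blast
  obtain m' where m': "m = [:- x, 1:] * m'" using m by (auto simp: poly_eq_0_iff_dvd elim: dvdE)
  have m'0: "m' \<noteq> 0" using m m' by auto
  have dm: "degree m = Suc (degree m')" unfolding m' using m'0 by (subst degree_mult_eq) auto
  have "poly (pderiv m) x \<noteq> 0"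
  proof
    assume "poly (pderiv m) x = 0"
    moreover have "pderiv m \<noteq> 0" using dm by (simp add: pderiv_eq_0_iff)
    ultimately have "degree m \<le> degree (pderiv m)" using min poly_over_pderiv[OF K m(1)] by blast
    then show False using dm by (simp add: degree_pderiv)
  qed
  moreover have "poly (pderiv m) x = poly m' x"
    unfolding m' by (simp add: pderiv_mult pderiv_pCons del: mult_pCons_left)
  ultimately have m'x: "poly m' x \<noteq> 0" by simp
  have "degree m' \<noteq> 0"
  proof
    assume "degree m' = 0"
    then obtain c where "m' = [:c:]" by (elim degree_eq_zeroE)
    then have "m = [:- (x * c), c:]" "c \<noteq> 0" using m' m by auto
    then have "x * c \<in> K" "c \<in> K" using m(1) poly_over_pCons[OF K] K subfield_uminus[OF K, of "- (x * c)"] by auto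
    then show False using x \<open>c \<noteq> 0\<close> subfield_divide[OF K, of "x * c" c] by simp
  qed
  then obtain y where y: "poly m' y = 0" using alg_closed_imp_poly_has_root[of m'] by auto
  have "y \<noteq> x" using y m'x by auto
  have emb: "field_embedding K (\<lambda>x. x)" by (rule field_embeddingI[OF K]) auto
  have "poly (map_poly (\<lambda>x. x) m) y = 0" using y m' by (simp add: map_poly_idI)
  then obtain \<phi> where \<phi>: "field_embedding (adjoin K {x}) \<phi>" "\<And>c. c \<in> K \<Longrightarrow> \<phi> c = c" "\<phi> x = y"
    using extend_to_root[OF emb m, of y] min by metis
  have sub: "K \<subseteq> adjoin K {x}" "K \<subseteq> \<phi> ` adjoin K {x}"
    using \<phi>(2) adjoin_base[of K "{x}"] by (auto simp: image_iff) (metis subsetD)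
  obtain \<phi>' where \<phi>': "automorphism \<phi>'" "\<And>c. c \<in> adjoin K {x} \<Longrightarrow> \<phi>' c = \<phi> c"
    by (rule extend_to_automorphism[OF \<phi>(1)]) (use alg sub algebraic_over_mono in blast)+
  have "x \<in> adjoin K {x}" using adjoin_gen[of "{x}" K] by simp
  then show thesis using that[of \<phi>'] \<phi>' \<phi> sub \<open>y \<noteq> x\<close> by (metis subsetD)
qed

text \<open>An element outside the relatively closed field \<open>C\<close> is a root of no nonzero
  polynomial over \<open>C\<close>, so both sides of the criterion in
  \<open>extend_to_adjoin_singleton\<close> reduce to p = 0.\<close>

lemma extend_transcendental:
  fixes C :: "'a::alg_closed_field set"
  assumes C: "is_subfield C" and closed: "\<And>x. algebraic_over C x \<Longrightarrow> x \<in> C"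
    and \<sigma>: "field_embedding C \<sigma>" "\<sigma> ` C = C" and x: "x \<notin> C" and y: "y \<notin> C"
    and alg: "\<And>z. algebraic_over (adjoin C {x}) z" "\<And>z. algebraic_over (adjoin C {y}) z"
  obtains \<phi> where "automorphism \<phi>" "\<And>c. c \<in> C \<Longrightarrow> \<phi> c = \<sigma> c" "\<phi> x = y"
proof -
  interpret field_embedding C \<sigma> by fact
  have zero: "poly p z = 0 \<longleftrightarrow> p = 0" if "poly_over C p" "z \<notin> C" for p z
    using that closed algebraic_overI by (metis poly_0)
  have "poly p x = 0 \<longleftrightarrow> poly (map_poly \<sigma> p) y = 0" if "poly_over C p" for p
  proof -
    have "poly_over C (map_poly \<sigma> p)" using that \<sigma>(2) by (auto simp: poly_over_def coeff_map)
    then show ?thesis using zero that x y map_poly_eq_0_iff by metis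
  qed
  then obtain \<phi> where \<phi>: "field_embedding (adjoin C {x}) \<phi>" "\<And>c. c \<in> C \<Longrightarrow> \<phi> c = \<sigma> c" "\<phi> x = y"
    using extend_to_adjoin_singleton[OF \<sigma>(1)] by metis
  interpret \<phi>: field_embedding "adjoin C {x}" \<phi> by fact
  have sub: "C \<subseteq> adjoin C {x}" "x \<in> adjoin C {x}" using adjoin_base[of C] adjoin_gen[of "{x}" C] by auto
  have "is_subfield (\<phi> ` adjoin C {x})"
  proof (rule is_subfieldI)
    note sf = is_subfield_adjoin[of C "{x}"]
    show "0 \<in> \<phi> ` adjoin C {x}" "1 \<in> \<phi> ` adjoin C {x}"
      using \<phi>.zero \<phi>.one subfield_0[OF sf] subfield_1[OF sf] by (metis imageI)+
    fix u assume "u \<in> \<phi> ` adjoin C {x}"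
    then obtain a where a: "a \<in> adjoin C {x}" "u = \<phi> a" by auto
    show "- u \<in> \<phi> ` adjoin C {x}" using a \<phi>.uminus subfield_uminus[OF sf] by (metis imageI)
    have "inverse u = \<phi> (1 / a)" using a \<phi>.divide[of 1 a] \<phi>.one subfield_1[OF sf] by (simp add: inverse_eq_divide)
    then show "inverse u \<in> \<phi> ` adjoin C {x}" using a sf by (simp add: subfield_closed)
    fix v assume "v \<in> \<phi> ` adjoin C {x}"
    then obtain b where b: "b \<in> adjoin C {x}" "v = \<phi> b" by auto
    show "u + v \<in> \<phi> ` adjoin C {x}" "u * v \<in> \<phi> ` adjoin C {x}"
      using a b \<phi>.add \<phi>.mult subfield_add[OF sf] subfield_mult[OF sf] by (metis imageI)+
  qed
  moreover have "C \<subseteq> \<phi> ` adjoin C {x}"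
  proof
    fix c assume "c \<in> C"
    then obtain d where "d \<in> C" "c = \<sigma> d" using \<sigma>(2) by blast
    then show "c \<in> \<phi> ` adjoin C {x}" using \<phi>(2) sub by (metis imageI subsetD)
  qed
  moreover have "y \<in> \<phi> ` adjoin C {x}" using \<phi>(3) sub(2) by blast
  ultimately have "adjoin C {y} \<subseteq> \<phi> ` adjoin C {x}" by (intro adjoin_least) auto
  then obtain \<phi>' where "automorphism \<phi>'" "\<And>c. c \<in> adjoin C {x} \<Longrightarrow> \<phi>' c = \<phi> c"
    by (rule_tac extend_to_automorphism[OF \<phi>(1) alg(1)]) (use alg(2) algebraic_over_mono in blast)+
  then show thesis using that[of \<phi>'] \<phi> sub by (metis subsetD)
qed

text \<open>Artin's theorem. The generic combination \<open>\<Sum>y\<in>Y. m ^ e y * y\<close> is a primitive element: its image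
  under an automorphism determines the values of that automorphism on \<open>Y\<close>.\<close>
lemma artin:
  fixes Y :: "'a::field_char_0 set"
  assumes H: "\<And>h. h \<in> H \<Longrightarrow> automorphism h" "\<And>h g. h \<in> H \<Longrightarrow> g \<in> H \<Longrightarrow> h \<circ> g \<in> H" "(\<lambda>x. x) \<in> H"
    and Y: "finite Y" "\<And>h y. h \<in> H \<Longrightarrow> y \<in> Y \<Longrightarrow> h y \<in> Y"
    and \<delta>: "automorphism \<delta>" and fixed: "\<And>w. w \<in> adjoin K Y \<Longrightarrow> (\<And>h. h \<in> H \<Longrightarrow> h w = w) \<Longrightarrow> \<delta> w = w"
  obtains h where "h \<in> H" "\<And>y. y \<in> Y \<Longrightarrow> h y = \<delta> y"
proof (rule ccontr)
  note found = that
  assume "\<not> thesis"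
  then have ne: "\<exists>y\<in>Y. h y \<noteq> \<delta> y" if "h \<in> H" for h using found[OF that] by blast
  \<comment> \<open>\<open>H\<close> may be infinite, but its restrictions to the finite stable set
    \<open>Y\<close> are finitely many.\<close>
  define \<H> where "\<H> = (\<lambda>h. restrict h Y) ` H"
  have "\<H> \<subseteq> Y \<rightarrow>\<^sub>E Y" using Y(2) by (auto simp: \<H>_def)
  then have fin: "finite \<H>" using finite_PiE[OF Y(1), of "\<lambda>_. Y"] Y(1) by (simp add: finite_subset)
  obtain e :: "'a \<Rightarrow> nat" where e: "inj_on e Y" using finite_imp_inj_to_nat_seg[OF Y(1)] by auto
  \<comment> \<open>The value of \<open>q g\<close> at m is the difference of the generic
    combinations for \<open>g\<close> and \<delta>; avoiding finitely many roots, some m separates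
    \<delta> from every restriction. A natural number m is fixed by all automorphisms.\<close>
  define q where "q g = (\<Sum>y\<in>Y. monom (g y - \<delta> y) (e y))" for g
  have "q g \<noteq> 0" if "g \<in> \<H>" for g
  proof -
    obtain h where h: "h \<in> H" "g = restrict h Y" using \<open>g \<in> \<H>\<close> by (auto simp: \<H>_def)
    obtain y where y: "y \<in> Y" "h y \<noteq> \<delta> y" using ne[OF h(1)] by blast
    have "coeff (q g) (e y) = (\<Sum>z\<in>Y. if z = y then g z - \<delta> z else 0)"
      unfolding q_def coeff_sum using e y(1) by (intro sum.cong) (auto dest: inj_onD)
    then have "coeff (q g) (e y) = g y - \<delta> y" using Y(1) y(1) by simp
    then show ?thesis using y h by auto
  qed
  then have "prod q \<H> \<noteq> 0" using fin by simp
  then have "finite {z. poly (prod q \<H>) z = 0}" by (rule poly_roots_finite)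
  moreover have "infinite (range (of_nat :: nat \<Rightarrow> 'a))" by (simp add: finite_image_iff inj_of_nat range_inj_infinite)
  ultimately obtain m :: nat where m: "poly (prod q \<H>) (of_nat m) \<noteq> 0"
    using finite_subset[of "range (of_nat :: nat \<Rightarrow> 'a)" "{z. poly (prod q \<H>) z = 0}"] by auto
  define s where "s g = (\<Sum>y\<in>Y. of_nat m ^ e y * g y)" for g :: "'a \<Rightarrow> 'a"
  have s_ne: "s g \<noteq> s \<delta>" if "g \<in> \<H>" for g
  proof -
    have "poly (q g) (of_nat m) \<noteq> 0" using m that fin by (simp add: poly_prod)
    then have "s g - s \<delta> \<noteq> 0"
      by (simp add: q_def s_def poly_sum poly_monom sum_subtractf algebra_simps)
    then show ?thesis by simp
  qed
  \<comment> \<open>The orbit polynomial of the primitive element. Composition with members of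
    \<open>H\<close> permutes its factors, so \<open>H\<close>, and hence \<delta>, fixes its
    coefficients; thus \<delta> sends the primitive element to a root of \<open>G\<close>.\<close>
  define G where "G = (\<Prod>g\<in>\<H>. [:- s g, 1:])"
  have s_comp: "h (s g) = s (h \<circ> g)" if "automorphism h" for h g
    using that by (simp add: s_def automorphism_simps automorphism_of_nat)
  have map_prod: "map_poly h (\<Prod>g\<in>A. [:- s g, 1:]) = (\<Prod>g\<in>A. [:- s (h \<circ> g), 1:])"
    if h: "automorphism h" for h and A :: "('a \<Rightarrow> 'a) set"
    by (induction A rule: infinite_finite_induct)
      (simp_all only: prod.infinite prod.empty prod.insert map_poly_automorphism[OF h] automorphism_simps[OF h] s_comp[OF h] not_False_eq_True)
  have sY: "s (restrict g Y) = s g" for g by (simp add: s_def)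
  have "map_poly h G = G" if h: "h \<in> H" for h
  proof -
    define T where "T g = restrict (h \<circ> g) Y" for g
    have T\<H>: "T ` \<H> \<subseteq> \<H>"
    proof
      fix f assume "f \<in> T ` \<H>"
      then obtain g where g: "g \<in> H" "f = T (restrict g Y)" by (auto simp: \<H>_def)
      then have "f = restrict (h \<circ> g) Y" by (auto simp: T_def)
      then show "f \<in> \<H>" using H(2)[OF h g(1)] by (auto simp: \<H>_def)
    qed
    moreover have "inj_on T \<H>"
    proof (rule inj_onI)
      fix f g assume fg: "f \<in> \<H>" "g \<in> \<H>" "T f = T g"
      have "f y = g y" if "y \<in> Y" for y
      proof -
        have "T f y = T g y" using fg by simp
        then show ?thesis using that automorphism_eq_iff[OF H(1)[OF h]] by (simp add: T_def)
      qed
      moreover have "f y = g y" if "y \<notin> Y" for y using fg that by (auto simp: \<H>_def)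
      ultimately show "f = g" by blast
    qed
    ultimately have "bij_betw T \<H> \<H>" using fin by (simp add: bij_betw_def endo_inj_surj)
    have "map_poly h G = (\<Prod>g\<in>\<H>. [:- s (T g), 1:])"
      unfolding G_def map_prod[OF H(1)[OF h]] T_def sY ..
    also have "\<dots> = G"
      unfolding G_def by (rule prod.reindex_bij_betw[OF \<open>bij_betw T \<H> \<H>\<close>])
    finally show ?thesis .
  qed
  then have "h (coeff G i) = coeff G i" if "h \<in> H" for h i
    using that map_poly_automorphism(1)[OF H(1)[OF that], of G i] by simp
  moreover have "coeff G i \<in> adjoin K Y" for i
  proof -
    note sf = is_subfield_adjoin[of K Y]
    have "s g \<in> adjoin K Y" if "g \<in> \<H>" for g
      unfolding s_def
    proof (intro subfield_sum[OF sf] subfield_mult[OF sf] subfield_power[OF sf] subfield_of_nat[OF sf])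
      fix y assume "y \<in> Y"
      then have "g y \<in> Y" using that Y(2) by (auto simp: \<H>_def)
      then show "g y \<in> adjoin K Y" using adjoin_gen by blast
    qed
    then have "poly_over (adjoin K Y) G"
      unfolding G_def
      by (intro poly_over_prod[OF sf]) (simp add: poly_over_pCons[OF sf] poly_over_0[OF sf] subfield_closed[OF sf])
    then show ?thesis by (simp add: poly_over_def)
  qed
  ultimately have "\<delta> (coeff G i) = coeff G i" for i using fixed by blast
  then have "map_poly \<delta> G = G" by (simp add: poly_eq_iff map_poly_automorphism[OF \<delta>])
  then have *: "poly G (\<delta> (s (\<lambda>y. y))) = \<delta> (poly G (s (\<lambda>y. y)))"
    using map_poly_automorphism(3)[OF \<delta>, of G] by metis
  have "restrict (\<lambda>x. x) Y \<in> \<H>" using H(3) by (auto simp: \<H>_def)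
  then have "poly G (s (\<lambda>y. y)) = 0"
    using fin sY[of "\<lambda>y. y"] by (auto simp: G_def poly_prod intro!: prod_zero bexI[of _ "restrict (\<lambda>x. x) Y"])
  then have "poly G (s \<delta>) = 0"
    using * s_comp[OF \<delta>, of "\<lambda>y. y"] by (simp add: automorphism_0[OF \<delta>] comp_def)
  then obtain g where "g \<in> \<H>" "s \<delta> = s g" using fin by (auto simp: G_def poly_prod)
  then show False using s_ne[of g] by simp
qed

text \<open>Clearing denominators in a = p(t)/q(t) gives a polynomial over \<open>C\<close> that
  vanishes at a transcendental \<open>t\<close>. Hence p = a q, and \<open>a\<close> is a quotient
  of coefficients.\<close>

lemma adjoin_transcendental_Int:
  assumes C: "is_subfield C" and closed: "\<And>x. algebraic_over C x \<Longrightarrow> x \<in> C"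
    and K: "is_subfield K" "K \<subseteq> C" and t: "t \<notin> C" and a: "a \<in> C" "a \<in> adjoin K {t}"
  shows "a \<in> K"
proof -
  obtain p q where pq: "a = poly p t / poly q t" "poly_over K p" "poly_over K q" "poly q t \<noteq> 0"
    using a(2) unfolding adjoin_singleton[OF K(1)] by blast
  have "poly_over C (p - smult a q)"
    using pq a(1) K(2) poly_over_mono by (intro poly_over_diff[OF C] poly_over_smult[OF C]) auto
  moreover have "poly (p - smult a q) t = 0" using pq by simp
  ultimately have "p - smult a q = 0" using t closed algebraic_overI by blast
  then have "coeff p i = a * coeff q i" for i by (simp add: poly_eq_iff)
  moreover obtain i where "coeff q i \<noteq> 0" using pq(4) by (metis leading_coeff_0_iff poly_0)
  ultimately have "a = coeff p i / coeff q i" by simp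
  then show ?thesis using pq(2,3) K(1) by (simp add: poly_over_def subfield_divide)
qed

lemma is_subfield_UN_chain:
  fixes K :: "nat \<Rightarrow> 'a::field set"
  assumes K: "\<And>n. is_subfield (K n)" and inc: "\<And>n. K n \<subseteq> K (Suc n)"
  shows "is_subfield (\<Union>n. K n)"
proof -
  have mono: "K m \<subseteq> K n" if "m \<le> n" for m n
    using lift_Suc_mono_le[of K, OF inc that] .
  have two: "\<exists>n. a \<in> K n \<and> b \<in> K n" if ab: "a \<in> (\<Union>n. K n)" "b \<in> (\<Union>n. K n)" for a b
  proof -
    obtain m n where "a \<in> K m" "b \<in> K n" using ab by auto
    then show ?thesis using mono[of m "max m n"] mono[of n "max m n"] by auto
  qed
  show ?thesis
  proof (rule is_subfieldI)
    show "0 \<in> (\<Union>n. K n)" "1 \<in> (\<Union>n. K n)" using K[of 0] by (auto intro: subfield_closed)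
    fix a assume a: "a \<in> (\<Union>n. K n)"
    then obtain n where n: "a \<in> K n" by blast
    from n have "- a \<in> K n" "inverse a \<in> K n" by (simp_all add: K subfield_closed)
    then show "- a \<in> (\<Union>n. K n)" "inverse a \<in> (\<Union>n. K n)" by blast+
    fix b assume "b \<in> (\<Union>n. K n)"
    from two[OF a this] obtain m where m: "a \<in> K m" "b \<in> K m" by blast
    then have "a + b \<in> K m" "a * b \<in> K m" by (simp_all add: K subfield_closed)
    then show "a + b \<in> (\<Union>n. K n)" "a * b \<in> (\<Union>n. K n)" by blast+
  qed
qed

section \<open>Iterated preimages under \<open>x \<mapsto> A + B / x\<^sup>2\<close>\<close>

text \<open>The relation \<open>y = A + B / x\<^sup>2\<close>, freed of division; for \<open>B \<noteq> 0\<close> it forces \<open>x \<noteq> 0\<close> and \<open>y \<noteq> A\<close>.\<close>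
definition maps_to :: "'a::field \<Rightarrow> 'a \<Rightarrow> 'a \<Rightarrow> 'a \<Rightarrow> bool" where
  "maps_to A B x y \<longleftrightarrow> x\<^sup>2 * (y - A) = B"

definition preimages :: "'a::field \<Rightarrow> 'a \<Rightarrow> nat \<Rightarrow> 'a \<Rightarrow> 'a set" where
  "preimages A B n t = {x. (maps_to A B ^^ n) x t}"

lemma preimages_0 [simp]: "preimages A B 0 t = {t}"
  by (auto simp: preimages_def)

lemma preimages_Suc_bottom: "preimages A B (Suc n) t = {x. \<exists>y\<in>preimages A B n t. maps_to A B x y}"
  unfolding preimages_def by (auto intro: relpowp_Suc_I2 elim: relpowp_Suc_E2 simp del: relpowp.simps)

lemma preimages_Suc_top: "preimages A B (Suc n) t = (\<Union>x\<in>{x. maps_to A B x t}. preimages A B n x)"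
  unfolding preimages_def by (auto intro: relpowp_Suc_I elim: relpowp_Suc_E simp del: relpowp.simps)

lemma maps_to_same_value:
  assumes "B \<noteq> 0" "maps_to A B x t"
  shows "maps_to A B y t \<longleftrightarrow> y = x \<or> y = - x"
proof -
  have "t - A \<noteq> 0" using assms by (auto simp: maps_to_def)
  then have "maps_to A B y t \<longleftrightarrow> y\<^sup>2 = x\<^sup>2"
    using assms(2) unfolding maps_to_def by (metis mult_right_cancel)
  then show ?thesis by (simp add: power2_eq_iff)
qed

lemma preimages_Suc:
  assumes "B \<noteq> 0" "maps_to A B x t"
  shows "preimages A B (Suc n) t = preimages A B n x \<union> preimages A B n (- x)"
  unfolding preimages_Suc_top maps_to_same_value[OF assms] by auto

lemma maps_to_uminus: "maps_to A B (- x) y \<longleftrightarrow> maps_to A B x y"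
  by (simp add: maps_to_def)

lemma maps_to_unique:
  assumes "B \<noteq> 0" "maps_to A B x y" "maps_to A B x z"
  shows "y = z"
proof -
  have "x\<^sup>2 \<noteq> 0" using assms by (auto simp: maps_to_def)
  moreover have "x\<^sup>2 * (y - A) = x\<^sup>2 * (z - A)" using assms by (simp add: maps_to_def)
  ultimately have "y - A = z - A" by (metis mult_left_cancel)
  then show ?thesis by simp
qed

lemma finite_preimages:
  assumes "B \<noteq> 0"
  shows "finite (preimages A B n t)"
proof (induction n arbitrary: t)
  case (Suc n)
  show ?case
  proof (cases "\<exists>x. maps_to A B x t")
    case True
    then show ?thesis using preimages_Suc[OF assms] Suc by auto
  qed (auto simp: preimages_Suc_top)
qed simp

lemma automorphism_preimages:
  assumes "automorphism \<phi>" "\<phi> A = A" "\<phi> B = B" "x \<in> preimages A B n t"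
  shows "\<phi> x \<in> preimages A B n (\<phi> t)"
  using assms(4)
proof (induction n arbitrary: x)
  case (Suc n)
  then obtain y where y: "y \<in> preimages A B n t" "maps_to A B x y"
    unfolding preimages_Suc_bottom by blast
  have "\<phi> (x\<^sup>2 * (y - A)) = \<phi> B" using y(2) by (simp add: maps_to_def)
  then have "maps_to A B (\<phi> x) (\<phi> y)"
    using assms by (simp add: maps_to_def automorphism_simps[OF assms(1)])
  then show ?case using Suc.IH[OF y(1)] unfolding preimages_Suc_bottom by blast
qed simp

section \<open>Towers of square roots\<close>

text \<open>A step may adjoin an \<open>s\<close> that is already present, so finite sets of square
  roots are adjoined one by one with no count of degrees.\<close>

inductive quad_tower :: "'a::field set \<Rightarrow> 'a set \<Rightarrow> bool" for V where
  quad_tower_refl: "quad_tower V V"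
| quad_tower_step: "quad_tower V K \<Longrightarrow> s * s \<in> K \<Longrightarrow> quad_tower V (adjoin K {s})"

lemma quad_tower_imp:
  assumes "quad_tower V K" "is_subfield V"
  shows "is_subfield K" "V \<subseteq> K"
  using assms by (induction rule: quad_tower.induct) (auto intro: is_subfield_adjoin dest: subsetD[OF adjoin_base])

lemma quad_tower_adjoin_finite:
  assumes "finite S" "quad_tower V K" "\<And>s. s \<in> S \<Longrightarrow> s * s \<in> K"
  shows "\<exists>L. quad_tower V L \<and> K \<subseteq> L \<and> S \<subseteq> L"
  using assms
proof (induction S rule: finite_induct)
  case (insert s S)
  then obtain L where L: "quad_tower V L" "K \<subseteq> L" "S \<subseteq> L" by auto
  moreover have "quad_tower V (adjoin L {s})" using L insert.prems by (intro quad_tower_step) auto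
  ultimately show ?case
    using adjoin_base[of L "{s}"] adjoin_gen[of "{s}" L] by (intro exI[of _ "adjoin L {s}"]) auto
qed auto

lemma quad_tower_preimages:
  assumes V: "is_subfield V" "A \<in> V" "B \<in> V" "t \<in> V" and B: "B \<noteq> 0"
  shows "\<exists>K. quad_tower V K \<and> preimages A B n t \<subseteq> K"
proof (induction n)
  case 0
  then show ?case using V quad_tower_refl by auto
next
  case (Suc n)
  then obtain K where K: "quad_tower V K" "preimages A B n t \<subseteq> K" by blast
  note sf = quad_tower_imp[OF K(1) V(1)]
  have "s * s \<in> K" if s: "s \<in> preimages A B (Suc n) t" for s
  proof -
    obtain y where y: "y \<in> preimages A B n t" "maps_to A B s y" using s unfolding preimages_Suc_bottom by blast
    then have "y - A \<noteq> 0" using B by (auto simp: maps_to_def)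
    then have "s * s = B / (y - A)" using y(2) by (auto simp: maps_to_def power2_eq_square)
    moreover have "B / (y - A) \<in> K" using y(1) K(2) sf V by (intro subfield_divide subfield_diff) auto
    ultimately show ?thesis by simp
  qed
  then show ?case using quad_tower_adjoin_finite[OF finite_preimages[OF B] K(1)] by blast
qed

lemma adjoin_sqrt:
  assumes K: "is_subfield K" and s: "s * s \<in> K" and x: "x \<in> adjoin K {s}"
  obtains a b where "a \<in> K" "b \<in> K" "x = a + b * s"
proof -
  have "algebraic_over K s"
    by (rule algebraic_overI[of _ "[:- (s * s), 0, 1:]"])
      (use K s in \<open>auto simp: poly_over_pCons poly_over_0 subfield_closed\<close>)
  then obtain p where p: "x = poly p s" "poly_over K p" using adjoin_algebraic(1)[OF K] x by blast
  have "\<exists>a\<in>K. \<exists>b\<in>K. poly p s = a + b * s" using p(2)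
  proof (induction p)
    case (pCons c p)
    then obtain a b where "a \<in> K" "b \<in> K" "poly p s = a + b * s" "c \<in> K"
      using poly_over_pCons[OF K] by blast
    moreover from this have "c + b * (s * s) \<in> K" using s by (simp add: subfield_add[OF K] subfield_mult[OF K])
    ultimately show ?case by (intro bexI[of _ "c + b * (s * s)"] bexI[of _ a]) (auto simp: algebra_simps)
  qed (use subfield_0[OF K] in \<open>auto intro!: bexI[of _ 0]\<close>)
  then show thesis using p(1) that by blast
qed

text \<open>At the lowest step where \<open>W\<close> leaves \<open>V\<close>, an automorphism over
  \<open>K\<close> sends w = a + b s to a - b s. Stability of \<open>W\<close> puts the trace 2 a
  into \<open>W\<close>, so a lies in \<open>V\<close>, and e = b s is the required square
  root.\<close>

lemma quad_tower_square_root: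
  fixes V :: "'a::{alg_closed_field, field_char_0} set"
  assumes V: "is_subfield V" "\<And>x. algebraic_over V x"
    and W: "is_subfield W" "\<And>\<phi> w. automorphism \<phi> \<Longrightarrow> (\<And>v. v \<in> V \<Longrightarrow> \<phi> v = v) \<Longrightarrow> w \<in> W \<Longrightarrow> \<phi> w \<in> W"
    and "quad_tower V K" "w \<in> W" "w \<in> K" "w \<notin> V"
  shows "\<exists>e\<in>W. e \<notin> V \<and> e * e \<in> V"
  using assms(5-)
proof (induction arbitrary: w rule: quad_tower.induct)
  case (quad_tower_step K s)
  note K = quad_tower_imp[OF quad_tower_step.hyps(1) V(1)]
  show ?case
  proof (cases "K \<inter> W \<subseteq> V")
    case False
    then show ?thesis using quad_tower_step.IH by blast
  next
    case True
    have "w \<notin> K" using True quad_tower_step.prems by blast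
    have algK: "algebraic_over K x" for x using V(2) K(2) algebraic_over_mono by blast
    obtain \<phi> where \<phi>: "automorphism \<phi>" "\<And>c. c \<in> K \<Longrightarrow> \<phi> c = c" "\<phi> w \<noteq> w"
      using exists_automorphism_moving[OF K(1) algK \<open>w \<notin> K\<close>] by metis
    obtain a b where ab: "a \<in> K" "b \<in> K" "w = a + b * s"
      using adjoin_sqrt[OF K(1)] quad_tower_step by metis
    have "\<phi> s * \<phi> s = s * s" using \<phi>(2)[OF quad_tower_step.hyps(2)] by (simp add: automorphism_simps[OF \<phi>(1)])
    then have "\<phi> s = s \<or> \<phi> s = - s" by (simp add: square_eq_iff)
    moreover have \<phi>w: "\<phi> w = a + b * \<phi> s" using ab \<phi>(2) by (simp add: automorphism_simps[OF \<phi>(1)])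
    ultimately have "\<phi> w = a - b * s" using \<phi>(3) ab(3) by auto
    moreover have "\<phi> w \<in> W" using W(2)[OF \<phi>(1)] \<phi>(2) K(2) quad_tower_step.prems by blast
    ultimately have "2 * a \<in> W"
      using subfield_add[OF W(1) quad_tower_step.prems(1), of "\<phi> w"] ab(3) by simp
    then have "a \<in> W" by (rule subfield_half[OF W(1)])
    then have "a \<in> V" using True ab by blast
    define e where "e = b * s"
    have "e \<in> W" using subfield_diff[OF W(1) quad_tower_step.prems(1) \<open>a \<in> W\<close>] ab(3) by (simp add: e_def)
    moreover have "e \<notin> V" using subfield_add[OF V(1) \<open>a \<in> V\<close>, of e] ab(3) quad_tower_step.prems(3) by (auto simp: e_def)
    moreover have "e * e \<in> K"
    proof -
      have "e * e = b * b * (s * s)" by (simp add: e_def)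
      then show ?thesis using ab(2) quad_tower_step.hyps(2) K(1) by (simp add: subfield_mult)
    qed
    ultimately show ?thesis using True subfield_mult[OF W(1)] by blast
  qed
qed simp

section \<open>Embeddings into Laurent series\<close>

lemma field_embedding_fls_const: "is_subfield K \<Longrightarrow> field_embedding K fls_const"
  by (rule field_embeddingI) (auto simp: fls_plus_const)

lemma fps_square_root:
  fixes D :: "'a::{alg_closed_field, field_char_0} fps"
  assumes "D $ 0 \<noteq> 0"
  obtains E where "E * E = D"
proof -
  define r where "r = (\<lambda>(n::nat) c::'a. SOME y. y ^ n = c)"
  have "r (Suc 1) (D $ 0) ^ Suc 1 = D $ 0"
    unfolding r_def by (rule someI_ex) (rule nth_root_exists, simp)
  then have "fps_radical r (Suc 1) D ^ Suc 1 = D"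
    using power_radical[OF assms] by blast
  then show thesis using that by simp
qed

lemma fls_value_regular:
  fixes r :: "'a::field poly"
  shows "\<exists>R. poly (map_poly fls_const r) (fls_const a + fls_X) = fps_to_fls R \<and> R $ 0 = poly r a"
proof (induction r)
  case 0
  then show ?case by (intro exI[of _ 0]) simp
next
  case (pCons c r)
  interpret field_embedding "UNIV :: 'a set" fls_const by (rule field_embedding_fls_const[OF is_subfield_UNIV])
  obtain R where R: "poly (map_poly fls_const r) (fls_const a + fls_X) = fps_to_fls R" "R $ 0 = poly r a"
    using pCons.IH by blast
  have "fls_const a + fls_X = fps_to_fls (fps_const a + fps_X)" by simp
  then have "poly (map_poly fls_const (pCons c r)) (fls_const a + fls_X) = fps_to_fls (fps_const c + (fps_const a + fps_X) * R)"
    using R(1) by (simp add: map_poly_pCons fls_times_fps_to_fls)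
  then show ?case using R(2) by (intro exI[of _ "fps_const c + (fps_const a + fps_X) * R"]) simp
qed

text \<open>Substituting a + X expands \<open>p\<close> at the point \<open>a\<close>: the factor (x
  - a)^order becomes a power of the parameter, and the cofactor becomes a unit. Orders of zeros thus
  become valuations, whose parity detects non-squares.\<close>

lemma fls_value_subdegree:
  fixes p :: "'a::field poly"
  assumes "p \<noteq> 0"
  shows "poly (map_poly fls_const p) (fls_const a + fls_X) \<noteq> 0"
    "fls_subdegree (poly (map_poly fls_const p) (fls_const a + fls_X)) = int (order a p)"
proof -
  interpret field_embedding "UNIV :: 'a set" fls_const by (rule field_embedding_fls_const[OF is_subfield_UNIV])
  have UN: "poly_over UNIV q" for q :: "'a poly" by (simp add: poly_over_def)
  obtain r where r: "p = [:- a, 1:] ^ order a p * r" "\<not> [:- a, 1:] dvd r" using order_decomp[OF assms] by blast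
  have pw: "map_poly fls_const ([:- a, 1:] ^ n) = [:- fls_const a, 1:] ^ n" for n
    by (induction n) (simp_all only: power_0 power_Suc map_poly_1 map_poly_mult[OF UN UN] map_poly_pCons map_poly_0 fls_const_uminus fls_const_1)
  obtain R where R: "poly (map_poly fls_const r) (fls_const a + fls_X) = fps_to_fls R" "R $ 0 = poly r a"
    using fls_value_regular by blast
  then have R0: "R $ 0 \<noteq> 0" using r(2) by (simp add: poly_eq_0_iff_dvd)
  have eq: "poly (map_poly fls_const p) (fls_const a + fls_X) = fls_X ^ order a p * fps_to_fls R"
    by (subst r(1)) (simp add: map_poly_mult[OF UN UN] pw R(1))
  have Rne: "fps_to_fls R \<noteq> 0" using R0 by auto
  have "fls_subdegree (fps_to_fls R) = 0" using R0 by (simp add: fls_subdegree_fls_to_fps subdegree_eq_0)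
  then show "fls_subdegree (poly (map_poly fls_const p) (fls_const a + fls_X)) = int (order a p)"
    unfolding eq using Rne by (simp add: fls_subdegree_pow)
  show "poly (map_poly fls_const p) (fls_const a + fls_X) \<noteq> 0"
    unfolding eq using Rne by simp
qed

text \<open>The embeddings of a field with a point \<open>z\<close> of good reduction extend to all iterated preimages
  of \<open>z\<close>: off the branch locus \<open>S\<close> the equation for a preimage has a power series solution.\<close>
lemma extend_to_preimages:
  fixes \<psi> :: "'a::{alg_closed_field, field_char_0} \<Rightarrow> 'a fls"
  assumes \<psi>: "field_embedding K \<psi>" and AB: "A \<in> K" "B \<in> K" "\<psi> A = fls_const A" "\<psi> B = fls_const B" "B \<noteq> 0"
    and S: "A \<in> S" "\<And>c d. c \<notin> S \<Longrightarrow> maps_to A B d c \<Longrightarrow> d \<notin> S"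
    and z: "z \<in> K" "\<psi> z = fps_to_fls Z" "Z $ 0 \<notin> S"
  shows "\<exists>L \<phi>. field_embedding L \<phi> \<and> K \<subseteq> L \<and> preimages A B n z \<subseteq> L \<and> (\<forall>c\<in>K. \<phi> c = \<psi> c) \<and>
    (\<forall>w\<in>preimages A B n z. \<exists>W. \<phi> w = fps_to_fls W \<and> W $ 0 \<notin> S)"
proof (induction n)
  case 0
  show ?case by (intro exI[of _ K] exI[of _ \<psi>]) (use \<psi> z in auto)
next
  case (Suc n)
  then obtain L \<phi> where L: "field_embedding L \<phi>" "K \<subseteq> L" "preimages A B n z \<subseteq> L" "\<And>c. c \<in> K \<Longrightarrow> \<phi> c = \<psi> c"
    and W: "\<And>w. w \<in> preimages A B n z \<Longrightarrow> \<exists>W. \<phi> w = fps_to_fls W \<and> W $ 0 \<notin> S" by blast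
  interpret L: field_embedding L \<phi> by fact
  have ABL: "A \<in> L" "B \<in> L" "\<phi> A = fls_const A" "\<phi> B = fls_const B" using AB L by auto
  define Y where "Y = preimages A B (Suc n) z"
  have Y: "\<exists>w E W. w \<in> L \<and> maps_to A B y w \<and> \<phi> w = fps_to_fls W \<and> W $ 0 \<notin> S \<and>
      E * E * (W - fps_const A) = fps_const B" if y: "y \<in> Y" for y
  proof -
    obtain w where w: "w \<in> preimages A B n z" "maps_to A B y w"
      using y unfolding Y_def preimages_Suc_bottom by blast
    obtain W where W: "\<phi> w = fps_to_fls W" "W $ 0 \<notin> S" using W[OF w(1)] by blast
    \<comment> \<open>As \<open>A\<close> lies in \<open>S\<close>, the constant term of
      \<open>W\<close> differs from \<open>A\<close>; the denominator is a unit, and the quotient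
      has a square root among the power series.\<close>
    have W0: "(W - fps_const A) $ 0 \<noteq> 0" using W(2) S(1) by auto
    obtain E where E: "E * E = fps_const B * inverse (W - fps_const A)"
      by (rule fps_square_root[of "fps_const B * inverse (W - fps_const A)"]) (use W0 AB(5) in auto)
    have "E * E * (W - fps_const A) = fps_const B"
      unfolding E using inverse_mult_eq_1[OF W0] by (simp add: mult.assoc)
    then show ?thesis using w W L(3) by blast
  qed
  have "\<exists>p. p \<noteq> 0 \<and> poly_over L p \<and> poly p y = 0 \<and> splits (map_poly \<phi> p)" if y: "y \<in> Y" for y
  proof -
    obtain w E W where w: "w \<in> L" "maps_to A B y w" "\<phi> w = fps_to_fls W" "W $ 0 \<notin> S"
      "E * E * (W - fps_const A) = fps_const B" using Y[OF y] by blast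
    define d where "d = B / (w - A)"
    have wA: "w - A \<noteq> 0" using w(2) AB(5) by (auto simp: maps_to_def)
    have dL: "d \<in> L" unfolding d_def using w(1) ABL L.subfield by (intro subfield_divide subfield_diff)
    have "\<phi> (w - A) = fps_to_fls (W - fps_const A)" using w ABL L.diff by simp
    moreover have "\<phi> (w - A) \<noteq> 0" using wA w(1) ABL L.eq_0_iff[of "w - A"] L.subfield by (simp add: subfield_diff)
    moreover have "fps_to_fls E * fps_to_fls E * fps_to_fls (W - fps_const A) = fls_const B"
      using w(5) by (metis fls_times_fps_to_fls fps_const_to_fls)
    moreover have "\<phi> d = fls_const B / \<phi> (w - A)"
      using L.divide[of B "w - A"] w(1) ABL subfield_diff[OF L.subfield] by (simp add: d_def)
    ultimately have "\<phi> d = fps_to_fls E * fps_to_fls E"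
      by (metis nonzero_mult_div_cancel_right)
    then have "map_poly \<phi> [:- d, 0, 1:] = [:- (fps_to_fls E * fps_to_fls E), 0, 1:]"
      using dL by (simp add: L.map_poly_pCons L.map_poly_0 L.uminus L.zero L.one)
    then have "splits (map_poly \<phi> [:- d, 0, 1:])" using splits_square_minus by metis
    moreover have "poly_over L [:- d, 0, 1:]"
      using dL L.subfield by (simp add: poly_over_pCons poly_over_0 subfield_closed)
    moreover have "poly [:- d, 0, 1:] y = 0"
      using w(2) wA by (simp add: d_def maps_to_def power2_eq_square field_simps)
    ultimately show ?thesis by (intro exI[of _ "[:- d, 0, 1:]"]) auto
  qed
  then obtain \<phi>' where \<phi>': "field_embedding (adjoin L Y) \<phi>'" "\<And>c. c \<in> L \<Longrightarrow> \<phi>' c = \<phi> c"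
    using extend_embedding[OF L(1), of Y] by metis
  interpret \<phi>': field_embedding "adjoin L Y" \<phi>' by fact
  have "\<exists>W. \<phi>' y = fps_to_fls W \<and> W $ 0 \<notin> S" if y: "y \<in> Y" for y
  proof -
    obtain w E W where w: "w \<in> L" "maps_to A B y w" "\<phi> w = fps_to_fls W" "W $ 0 \<notin> S"
      "E * E * (W - fps_const A) = fps_const B" using Y[OF y] by blast
    have yL: "y \<in> adjoin L Y" "w \<in> adjoin L Y" "A \<in> adjoin L Y"
      using adjoin_gen[of Y L] adjoin_base[of L Y] y w(1) ABL by auto
    note sf = is_subfield_adjoin[of L Y]
    have "\<phi>' (y\<^sup>2 * (w - A)) = \<phi>' B" using w(2) by (simp add: maps_to_def)
    then have "\<phi>' y * \<phi>' y * fps_to_fls (W - fps_const A) = fls_const B"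
      using yL ABL w(1,3) \<phi>'(2) \<phi>'.mult \<phi>'.diff subfield_mult[OF sf] subfield_diff[OF sf]
      by (simp add: power2_eq_square)
    moreover have "fps_to_fls E * fps_to_fls E * fps_to_fls (W - fps_const A) = fls_const B"
      using w(5) by (metis fls_times_fps_to_fls fps_const_to_fls)
    ultimately have "(\<phi>' y * \<phi>' y) * fps_to_fls (W - fps_const A) = (fps_to_fls E * fps_to_fls E) * fps_to_fls (W - fps_const A)"
      by simp
    moreover have "fps_to_fls (W - fps_const A) \<noteq> 0" using w(5) AB(5) by (metis fps_to_fls_eq_0_iff mult_zero_right fps_const_eq_0_iff)
    ultimately have "\<phi>' y * \<phi>' y = fps_to_fls E * fps_to_fls E" by (metis mult_right_cancel)
    then have y': "\<phi>' y = fps_to_fls E \<or> \<phi>' y = fps_to_fls (- E)" by (simp add: square_eq_iff)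
    \<comment> \<open>Constant terms obey the same relation \<open>maps_to\<close>, for both signs
      of \<open>E\<close>, so avoidance of \<open>S\<close> passes to the next level.\<close>
    have "(E * E * (W - fps_const A)) $ 0 = B" using w(5) by simp
    then have E0: "(E $ 0) * (E $ 0) * (W $ 0 - A) = B" by simp
    then have "maps_to A B (E $ 0) (W $ 0)" "maps_to A B ((- E) $ 0) (W $ 0)"
      by (simp_all add: maps_to_def power2_eq_square)
    then show ?thesis using y' S(2)[OF w(4)] by blast
  qed
  moreover have "K \<subseteq> adjoin L Y" "Y \<subseteq> adjoin L Y" using L(2) adjoin_base[of L Y] adjoin_gen[of Y L] by auto
  moreover have "\<forall>c\<in>K. \<phi>' c = \<psi> c" using \<phi>'(2) L(2,4) by auto
  ultimately show ?case using \<phi>'(1) unfolding Y_def by blast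
qed


section \<open>The common part of the two subtrees\<close>

text \<open>\<open>S\<close> stands for the finite post-critical points of the normal form. Read
  contrapositively, the second condition says that \<open>S\<close> is closed under forward images;
  \<open>S_uminus\<close> is what injectivity of the post-critical orbit contributes.\<close>

locale backward_orbits =
  fixes C :: "'a::{alg_closed_field, field_char_0} set" and A B :: 'a and S :: "'a set"
  assumes C: "is_subfield C" and closed: "\<And>x. algebraic_over C x \<Longrightarrow> x \<in> C"
    and AB: "A \<in> C" "B \<in> C" "B \<noteq> 0"
    and S: "A \<in> S" "\<And>c d. c \<notin> S \<Longrightarrow> maps_to A B d c \<Longrightarrow> d \<notin> S"
    and S_uminus: "\<And>c. c \<in> S \<Longrightarrow> - c \<in> S \<Longrightarrow> c = 0"
begin

lemma root_in_C: "poly_over C p \<Longrightarrow> p \<noteq> 0 \<Longrightarrow> poly p a = 0 \<Longrightarrow> a \<in> C"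
  using algebraic_overI closed by blast

text \<open>Roots away from 0 are split off in pairs, a root at 0 singly. The leftover power of the
  variable becomes a square once the next radical is adjoined.\<close>

lemma even_order_imp_square:
  assumes "poly_over C h" "h \<noteq> 0" "\<And>a. a \<noteq> 0 \<Longrightarrow> even (order a h)"
  shows "\<exists>c m g. c \<in> C \<and> poly_over C g \<and> h = smult c (monom 1 m * (g * g))"
  using assms
proof (induction "degree h" arbitrary: h rule: less_induct)
  case less
  show ?case
  proof (cases "degree h = 0")
    case True
    then obtain c where c: "h = [:c:]" by (elim degree_eq_zeroE)
    then have "c \<in> C" using less.prems(1) poly_over_pCons[OF C] by blast
    moreover have "h = smult c (monom 1 0 * (1 * 1))" using c by simp
    ultimately show ?thesis using poly_over_1[OF C] by blast
  next
    case False
    then obtain a where a: "poly h a = 0" using alg_closed_imp_poly_has_root[of h] by auto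
    then have aC: "a \<in> C" using root_in_C less.prems by blast
    have lin: "poly_over C [:- a, 1:]" using aC C by (simp add: poly_over_pCons poly_over_0 subfield_closed)
    define k where "k = (if a = 0 then 1 else 2 :: nat)"
    have "order a h \<noteq> 0" using a less.prems(2) by (simp add: order_root)
    then have "k \<le> order a h" using less.prems(3)[of a] by (cases "order a h = 1") (auto simp: k_def)
    then have "[:- a, 1:] ^ k dvd h" using less.prems(2) by (simp add: order_divides)
    then obtain h' where h': "h = [:- a, 1:] ^ k * h'" by (elim dvdE)
    have ne: "h' \<noteq> 0" using h' less.prems(2) by auto
    have "h' = h div [:- a, 1:] ^ k" using h' by (metis nonzero_mult_div_cancel_left pCons_eq_0_iff power_not_zero zero_neq_one)
    then have "poly_over C h'" using poly_over_div_mod(1)[OF C less.prems(1) poly_over_power[OF C lin]] by simp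
    moreover have "degree h' < degree h"
      unfolding h' using ne by (simp add: degree_mult_eq degree_power_eq k_def)
    moreover have "even (order b h')" if "b \<noteq> 0" for b
    proof -
      have "order b h = order b ([:- a, 1:] ^ k) + order b h'"
        using less.prems(2) unfolding h' by (rule order_mult)
      moreover have "even (order b ([:- a, 1:] ^ k))"
      proof (cases "b = a")
        case True
        then show ?thesis using that by (simp add: order_power_n_n k_def)
      next
        case False
        then have "poly ([:- a, 1:] ^ k) b \<noteq> 0" by simp
        then show ?thesis by (simp add: order_0I)
      qed
      ultimately show ?thesis using less.prems(3)[OF that] by simp
    qed
    ultimately obtain c m g where cmg: "c \<in> C" "poly_over C g" "h' = smult c (monom 1 m * (g * g))"
      using less.hyps ne by metis
    show ?thesis
    proof (cases "a = 0")
      case True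
      then have "h = smult c (monom 1 (Suc m) * (g * g))"
        unfolding h' cmg(3) by (simp add: k_def monom_Suc)
      then show ?thesis using cmg by blast
    next
      case False
      then have "h = smult c (monom 1 m * (([:- a, 1:] * g) * ([:- a, 1:] * g)))"
        unfolding h' cmg(3) by (simp only: k_def if_False power2_eq_square mult_smult_right ac_simps)
      then show ?thesis using cmg poly_over_mult[OF C lin] by blast
    qed
  qed
qed

text \<open>A counterexample yields, by \<open>quad_tower_square_root\<close>, a common e with e^2
  rational in some \<open>u N\<close>. If all orders away from 0 were even, e would lie in the field
  of radicals; at an odd one, a subtree of good reduction turns e into a Laurent series whose square
  has odd valuation.\<close>

lemma common_part_subset:
  assumes x: "x \<notin> C" and alg: "\<And>z. algebraic_over (adjoin C {x}) z"
    and u: "u 0 = x" "\<And>N. u (Suc N) * u (Suc N) = u N"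
    and w: "w \<in> adjoin C (preimages A B n x)" "w \<in> adjoin C (preimages A B n (- x))"
  shows "w \<in> (\<Union>N. adjoin C {u N})"
proof (rule ccontr)
  define V where "V = (\<Union>N. adjoin C {u N})"
  define W where "W = adjoin C (preimages A B n x) \<inter> adjoin C (preimages A B n (- x))"
  assume "w \<notin> (\<Union>N. adjoin C {u N})"
  then have wV: "w \<notin> V" by (simp add: V_def)
  have uV: "u N \<in> adjoin C {u N}" for N using adjoin_gen[of "{u N}" C] by simp
  have CN: "C \<subseteq> adjoin C {u N}" for N by (rule adjoin_base)
  have "u N \<in> adjoin C {u (Suc N)}" for N
    using uV[of "Suc N"] u(2)[of N] subfield_mult[OF is_subfield_adjoin] by metis
  then have inc: "adjoin C {u N} \<subseteq> adjoin C {u (Suc N)}" for N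
    by (intro adjoin_least[OF is_subfield_adjoin]) (auto simp: CN)
  have mono: "adjoin C {u M} \<subseteq> adjoin C {u N}" if "M \<le> N" for M N
    using lift_Suc_mono_le[of "\<lambda>N. adjoin C {u N}", OF inc that] .
  have NV: "adjoin C {u N} \<subseteq> V" for N by (auto simp: V_def)
  have V: "is_subfield V" unfolding V_def using inc by (rule is_subfield_UN_chain[OF is_subfield_adjoin])
  have CV: "C \<subseteq> V" using NV CN by blast
  have xV: "x \<in> V" using NV[of 0] uV[of 0] u(1) by auto
  have pow: "u N ^ (2 ^ N) = x" for N
  proof (induction N)
    case (Suc N)
    have "u (Suc N) ^ (2 ^ Suc N) = (u (Suc N) * u (Suc N)) ^ (2 ^ N)"
      by (simp add: power_mult power2_eq_square)
    then show ?case using u(2)[of N] Suc by simp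
  qed (simp add: u(1))
  have uC: "u N \<notin> C" for N using pow[of N] x subfield_power[OF C] by metis
  have algV: "algebraic_over V z" for z
    using alg algebraic_over_mono[of "adjoin C {x}" V z] NV[of 0] u(1) by simp
  have "is_subfield W" unfolding W_def by (intro is_subfield_Int is_subfield_adjoin)
  moreover have "\<phi> w \<in> W" if \<phi>: "automorphism \<phi>" "\<And>v. v \<in> V \<Longrightarrow> \<phi> v = v" and w: "w \<in> W" for \<phi> w
  proof -
    have fixed: "\<phi> A = A" "\<phi> B = B" "\<phi> x = x" "\<phi> (- x) = - x"
      using \<phi>(2) CV AB xV subfield_uminus[OF V xV] by auto
    have "\<phi> w \<in> adjoin C (preimages A B n y)" if "w \<in> adjoin C (preimages A B n y)" "\<phi> y = y" for y
    proof (rule automorphism_maps_adjoin[OF \<phi>(1) _ _ is_subfield_adjoin that(1)])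
      show "\<phi> c \<in> adjoin C (preimages A B n y)" if "c \<in> C" for c
        using that \<phi>(2) CV adjoin_base by (metis subsetD)
      show "\<phi> s \<in> adjoin C (preimages A B n y)" if "s \<in> preimages A B n y" for s
        using automorphism_preimages[OF \<phi>(1) fixed(1,2) that] \<open>\<phi> y = y\<close> adjoin_gen by (metis subsetD)
    qed
    then show ?thesis using w fixed unfolding W_def by blast
  qed
  moreover obtain K where K: "quad_tower V K" "preimages A B n x \<subseteq> K"
    using quad_tower_preimages[OF V, of A B x n] AB CV xV by blast
  moreover have "adjoin C (preimages A B n x) \<subseteq> K"
    using quad_tower_imp[OF K(1) V] K(2) CV by (intro adjoin_least) auto
  ultimately obtain e where e: "e \<in> W" "e \<notin> V" "e * e \<in> V"
    using quad_tower_square_root[OF V algV, of W K w] w wV unfolding W_def by blast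
  obtain N where N: "e * e \<in> adjoin C {u N}" using e(3) by (auto simp: V_def)
  then obtain p q where pq: "e * e = poly p (u N) / poly q (u N)" "poly_over C p" "poly_over C q" "poly q (u N) \<noteq> 0"
    unfolding adjoin_singleton[OF C] by blast
  \<comment> \<open>Multiplying e by the denominator replaces p/q by p q, a polynomial in the same
    square class.\<close>
  define h where "h = p * q"
  have hC: "poly_over C h" unfolding h_def using pq by (intro poly_over_mult[OF C])
  have eq: "(e * poly q (u N)) * (e * poly q (u N)) = poly h (u N)"
  proof -
    have "(e * poly q (u N)) * (e * poly q (u N)) = (e * e) * (poly q (u N) * poly q (u N))" by (simp only: ac_simps)
    then show ?thesis using pq(1,4) by (simp add: h_def)
  qed
  have "e \<noteq> 0" using e(2) subfield_0[OF V] by auto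
  then have h0: "h \<noteq> 0" using eq pq(4) by auto
  have qV: "poly q (u N) \<in> V"
    using poly_over_value[OF V poly_over_mono[OF CV pq(3)]] NV[of N] uV[of N] by auto
  have "\<exists>a. a \<noteq> 0 \<and> odd (order a h)"
  proof (rule ccontr)
    assume "\<nexists>a. a \<noteq> 0 \<and> odd (order a h)"
    then obtain c m g where cmg: "c \<in> C" "poly_over C g" "h = smult c (monom 1 m * (g * g))"
      using even_order_imp_square[OF hC h0] by blast
    obtain d where d: "d ^ 2 = c" using nth_root_exists[of 2 c] by auto
    have "d \<in> C"
    proof (rule root_in_C)
      show "poly_over C [:- c, 0, 1:]" using cmg(1) C by (simp add: poly_over_pCons poly_over_0 subfield_closed)
      show "poly [:- c, 0, 1:] d = 0" using d by (simp add: power2_eq_square)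
    qed simp
    define v where "v = d * u (Suc N) ^ m * poly g (u N)"
    have "v * v = (d * d) * (u (Suc N) * u (Suc N)) ^ m * (poly g (u N) * poly g (u N))"
      unfolding v_def power_mult_distrib by (simp only: ac_simps)
    then have "v * v = poly h (u N)"
      using d u(2)[of N] by (simp add: cmg(3) poly_monom power2_eq_square mult.assoc)
    then have "(e * poly q (u N)) * (e * poly q (u N)) = v * v" using eq by simp
    then have "e * poly q (u N) = v \<or> e * poly q (u N) = - v" by (simp add: square_eq_iff)
    moreover have "v \<in> V"
    proof -
      have "u (Suc N) \<in> V" "u N \<in> V" using NV uV by blast+
      then show ?thesis unfolding v_def using \<open>d \<in> C\<close> CV cmg(2) V
        by (intro subfield_mult[OF V] subfield_power[OF V] poly_over_value[OF V] poly_over_mono[OF CV]) auto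
    qed
    ultimately have "e * poly q (u N) \<in> V" using subfield_uminus[OF V] by auto
    then have "(e * poly q (u N)) / poly q (u N) \<in> V" using qV by (rule subfield_divide[OF V])
    then show False using e(2) pq(4) by simp
  qed
  then obtain a where a: "a \<noteq> 0" "odd (order a h)" by blast
  \<comment> \<open>At the place where \<open>u N\<close> takes the value \<open>a\<close>, x takes
    the value a0. By \<open>S_uminus\<close> one of a0 and -a0 avoids \<open>S\<close>, and z is the
    root, x or -x, of a subtree with good reduction there.\<close>
  define a0 where "a0 = a ^ (2 ^ N)"
  have "a0 \<noteq> 0" using a(1) by (simp add: a0_def)
  then obtain z where z: "z = x \<and> a0 \<notin> S \<or> z = - x \<and> - a0 \<notin> S" using S_uminus by blast
  \<comment> \<open>Expansion at this place embeds C(u N) into Laurent series: \<open>u N\<close> is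
    transcendental over \<open>C\<close>, and no nonzero polynomial expands to zero.\<close>
  have zero_iff: "poly r (u N) = 0 \<longleftrightarrow> poly (map_poly fls_const r) (fls_const a + fls_X) = 0" if r: "poly_over C r" for r
    using root_in_C[OF r _, of "u N"] uC fls_value_subdegree(1)[of r a] by (cases "r = 0") auto
  obtain \<psi> where \<psi>: "field_embedding (adjoin C {u N}) \<psi>" "\<And>c. c \<in> C \<Longrightarrow> \<psi> c = fls_const c" "\<psi> (u N) = fls_const a + fls_X"
    using extend_to_adjoin_singleton[OF field_embedding_fls_const[OF C] zero_iff] by metis
  interpret \<psi>: field_embedding "adjoin C {u N}" \<psi> by fact
  have xN: "x \<in> adjoin C {u N}" using mono[of 0 N] uV[of 0] u(1) by auto
  have \<psi>x: "\<psi> x = fps_to_fls ((fps_const a + fps_X) ^ (2 ^ N))"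
    using \<psi>.power[OF uV, of "2 ^ N"] by (simp add: pow \<psi>(3) fps_to_fls_power)
  have a0': "((fps_const a + fps_X) ^ (2 ^ N)) $ 0 = a0" by (simp add: a0_def fps_nth_power_0)
  have "\<exists>Z. z \<in> adjoin C {u N} \<and> \<psi> z = fps_to_fls Z \<and> Z $ 0 \<notin> S"
  proof (cases "z = x \<and> a0 \<notin> S")
    case True
    then show ?thesis using xN \<psi>x a0' by metis
  next
    case False
    then have zx: "z = - x" "- a0 \<notin> S" using z by auto
    then have "\<psi> z = fps_to_fls (- ((fps_const a + fps_X) ^ (2 ^ N)))"
      using \<psi>.uminus[OF xN] \<psi>x by simp
    moreover have "(- ((fps_const a + fps_X) ^ (2 ^ N))) $ 0 \<notin> S" using zx a0' by simp
    ultimately show ?thesis using zx(1) xN subfield_uminus[OF is_subfield_adjoin] by blast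
  qed
  then obtain Z where Z: "z \<in> adjoin C {u N}" "\<psi> z = fps_to_fls Z" "Z $ 0 \<notin> S" by blast
  have "\<exists>L \<phi>. field_embedding L \<phi> \<and> adjoin C {u N} \<subseteq> L \<and> preimages A B n z \<subseteq> L \<and>
    (\<forall>c\<in>adjoin C {u N}. \<phi> c = \<psi> c) \<and> (\<forall>w\<in>preimages A B n z. \<exists>W. \<phi> w = fps_to_fls W \<and> W $ 0 \<notin> S)"
  proof (rule extend_to_preimages[OF \<psi>(1) _ _ _ _ AB(3) S(1) _ Z])
    show "A \<in> adjoin C {u N}" "B \<in> adjoin C {u N}" using AB CN by blast+
    show "\<psi> A = fls_const A" "\<psi> B = fls_const B" using AB \<psi>(2) by blast+
  qed (rule S(2))
  then obtain L \<phi> where L: "field_embedding L \<phi>" "adjoin C {u N} \<subseteq> L" "preimages A B n z \<subseteq> L"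
    "\<And>c. c \<in> adjoin C {u N} \<Longrightarrow> \<phi> c = \<psi> c" by auto
  interpret L: field_embedding L \<phi> by fact
  have "e \<in> adjoin C (preimages A B n z)" using e(1) z unfolding W_def by auto
  then have eL: "e \<in> L" using adjoin_least[OF L.subfield _ L(3), of C] CN[of N] L(2) by blast
  have uL: "u N \<in> L" using uV L(2) by blast
  have CL: "C \<subseteq> L" using CN L(2) by blast
  have qL: "poly q (u N) \<in> L"
    using poly_over_value[OF L.subfield poly_over_mono[OF CL pq(3)] uL] .
  have "\<phi> (e * poly q (u N)) * \<phi> (e * poly q (u N)) = \<phi> (poly h (u N))"
    using eq L.mult subfield_mult[OF L.subfield eL qL] by metis
  also have "\<phi> (poly h (u N)) = poly (map_poly \<phi> h) (\<phi> (u N))"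
    using L.poly_map[OF poly_over_mono[OF CL hC] uL] by simp
  also have "map_poly \<phi> h = map_poly fls_const h"
    using hC L(4) \<psi>(2) CN by (auto simp: poly_eq_iff L.coeff_map coeff_map_poly poly_over_def subset_iff)
  also have "\<phi> (u N) = fls_const a + fls_X" using L(4) uV \<psi>(3) by simp
  finally have sq: "\<phi> (e * poly q (u N)) * \<phi> (e * poly q (u N)) = poly (map_poly fls_const h) (fls_const a + fls_X)" .
  then have "\<phi> (e * poly q (u N)) \<noteq> 0" using fls_value_subdegree(1)[OF h0, of a] by auto
  then have "2 * fls_subdegree (\<phi> (e * poly q (u N))) = int (order a h)"
    using fls_value_subdegree(2)[OF h0, of a] fls_subdegree_mult sq by (metis mult_2)
  then show False using a(2) by presburger
qed

end

section \<open>Gluing automorphisms over the two subtrees\<close>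

context backward_orbits
begin

lemma maps_to_notin:
  assumes "y \<notin> C" "maps_to A B x y"
  shows "x \<notin> C"
proof
  assume x: "x \<in> C"
  have "x \<noteq> 0" using assms(2) AB(3) by (auto simp: maps_to_def)
  then have "y = A + B / x\<^sup>2" using assms(2) by (auto simp: maps_to_def field_simps)
  also have "\<dots> \<in> C" using x AB C by (intro subfield_add subfield_divide subfield_power)
  finally show False using assms(1) by simp
qed

lemma preimages_notin: "t \<notin> C \<Longrightarrow> x \<in> preimages A B n t \<Longrightarrow> x \<notin> C"
  by (induction n arbitrary: x) (auto simp: preimages_Suc_bottom dest: maps_to_notin[rotated])

lemma maps_to_exists:
  assumes "t \<notin> C"
  obtains x where "maps_to A B x t"
proof -
  obtain x where "x ^ 2 = B / (t - A)" using nth_root_exists[of 2 "B / (t - A)"] by auto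
  moreover have "t - A \<noteq> 0" using assms AB by auto
  ultimately show thesis using that[of x] by (simp add: maps_to_def)
qed

lemma mem_of_maps_to:
  assumes "is_subfield K" "A \<in> K" "B \<in> K" "x \<in> K" "maps_to A B x t"
  shows "t \<in> K"
proof -
  have "x \<noteq> 0" using assms(5) AB(3) by (auto simp: maps_to_def)
  then have "t = A + B / x\<^sup>2" using assms(5) by (auto simp: maps_to_def field_simps)
  also have "\<dots> \<in> K" using assms by (intro subfield_add subfield_divide subfield_power)
  finally show ?thesis .
qed

text \<open>\<open>preimages\<close> collects a single level. A parent is A + B/x^2 for any child x,
  so the root of the tree is recovered from that level.\<close>

lemma mem_adjoin_preimages:
  assumes "A \<in> K" "B \<in> K" "t \<notin> C"
  shows "t \<in> adjoin K (preimages A B n t)"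
  using assms(3)
proof (induction n arbitrary: t)
  case 0
  then show ?case using adjoin_gen[of "{t}" K] by simp
next
  case (Suc n)
  obtain x where x: "maps_to A B x t" using maps_to_exists[OF Suc.prems] .
  have "x \<in> adjoin K (preimages A B n x)" using Suc maps_to_notin x by blast
  then have "x \<in> adjoin K (preimages A B (Suc n) t)"
    using adjoin_mono[of K K "preimages A B n x" "preimages A B (Suc n) t"] preimages_Suc[OF AB(3) x] by auto
  then show ?case
    using mem_of_maps_to[OF is_subfield_adjoin _ _ _ x] adjoin_base[of K] assms by blast
qed

text \<open>\<open>\<tau>A\<close> fixes the subtree over \<open>x\<close>, and its conjugate \<open>\<tau>B\<close> under an involution \<open>x \<mapsto> - x\<close> fixes
  the one over \<open>- x\<close>. They agree on the radicals of \<open>x\<close> because these are multiplied by roots of unity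
  in \<open>F\<close>, hence on the common part of the two subtrees, so they can be glued.\<close>
lemma automorphism_fixing_preimages:
  assumes F: "is_subfield F" "F \<subseteq> C" "A \<in> F" "B \<in> F" "\<And>\<zeta> n. \<zeta> ^ (2 ^ n) = 1 \<Longrightarrow> \<zeta> \<in> F"
    and \<sigma>: "automorphism \<sigma>" "\<And>c. c \<in> F \<Longrightarrow> \<sigma> c = c" "\<sigma> ` C = C"
    and t: "t \<notin> C" "\<And>z. algebraic_over (adjoin C {t}) z"
  shows "\<exists>\<tau>. automorphism \<tau> \<and> (\<forall>c\<in>C. \<tau> c = \<sigma> c) \<and> (\<forall>w\<in>preimages A B n t. \<tau> w = w)"
  using t
proof (induction n arbitrary: t)
  case 0
  have "field_embedding C \<sigma>"
    using field_embedding_subset[OF automorphism_embedding[OF \<sigma>(1)] C] by simp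
  from extend_transcendental[OF C closed this \<sigma>(3) 0(1,1,2,2)]
  show ?case by (metis preimages_0 singletonD)
next
  case (Suc n)
  obtain x where x: "maps_to A B x t" using maps_to_exists[OF Suc.prems(1)] .
  have xC: "x \<notin> C" using maps_to_notin[OF Suc.prems(1) x] .
  then have mxC: "- x \<notin> C" using subfield_uminus[OF C, of "- x"] by auto
  have alg_if: "algebraic_over K z" if "is_subfield K" "C \<subseteq> K" "x \<in> K" for K z
  proof -
    have "t \<in> K" using mem_of_maps_to[OF that(1) _ _ that(3) x] AB that(2) by blast
    then have "adjoin C {t} \<subseteq> K" using that by (intro adjoin_least) auto
    then show ?thesis using Suc.prems(2) algebraic_over_mono by blast
  qed
  have xx: "x \<in> adjoin C {x}" "x \<in> adjoin C {- x}"
    using adjoin_gen[of "{x}" C] adjoin_gen[of "{- x}" C] subfield_uminus[OF is_subfield_adjoin, of "- x"] by auto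
  have algx: "algebraic_over (adjoin C {x}) z" "algebraic_over (adjoin C {- x}) z" for z
    using alg_if[OF is_subfield_adjoin adjoin_base] xx by auto
  define Y Y' where "Y = preimages A B n x" and "Y' = preimages A B n (- x)"
  obtain \<tau>A where \<tau>A: "automorphism \<tau>A" "\<And>c. c \<in> C \<Longrightarrow> \<tau>A c = \<sigma> c" "\<And>w. w \<in> Y \<Longrightarrow> \<tau>A w = w"
    using Suc.IH[OF xC algx(1)] unfolding Y_def by blast
  have \<tau>AF: "\<tau>A c = c" if "c \<in> F" for c using that \<tau>A(2) \<sigma>(2) F(2) by auto
  have \<tau>Ax: "\<tau>A x = x"
    using automorphism_fixes_adjoin[OF \<tau>A(1) \<tau>AF \<tau>A(3)] mem_adjoin_preimages[OF F(3,4) xC, of n]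
    unfolding Y_def by blast
  have idC: "field_embedding C (\<lambda>c. c)" by (rule field_embeddingI[OF C]) auto
  obtain \<iota> where \<iota>: "automorphism \<iota>" "\<And>c. c \<in> C \<Longrightarrow> \<iota> c = c" "\<iota> x = - x"
    using extend_transcendental[OF C closed idC _ xC mxC algx] by auto
  note \<iota>_inv = automorphism_inv_apply[OF \<iota>(1)] and \<tau>A_inv = automorphism_inv_apply[OF \<tau>A(1)]
  have \<iota>_invC: "inv \<iota> c = c" if "c \<in> C" for c using \<iota>(2)[OF that] \<iota>_inv(1)[of c] by simp
  have "\<iota> (- x) = x" using \<iota>(3) by (simp add: automorphism_uminus[OF \<iota>(1)])
  then have \<iota>_invx: "inv \<iota> x = - x" "inv \<iota> (- x) = x" using \<iota>_inv(1)[of "- x"] \<iota>_inv(1)[of x] \<iota>(3) by auto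
  define \<tau>B where "\<tau>B = \<iota> \<circ> (\<tau>A \<circ> inv \<iota>)"
  have \<tau>B: "automorphism \<tau>B"
    unfolding \<tau>B_def by (intro automorphism_comp automorphism_inv \<iota>(1) \<tau>A(1))
  \<comment> \<open>It suffices to find \<open>h\<close> that fixes C(Y) and agrees with \<delta> on
    \<open>Y'\<close>: then \<open>\<tau>A \<circ> h\<close> acts as \<tau>A on \<open>Y\<close> and
    as \<tau>B on \<open>Y'\<close>, which is the identity in both cases.\<close>
  define \<delta> where "\<delta> = inv \<tau>A \<circ> \<tau>B"
  have \<delta>: "automorphism \<delta>"
    unfolding \<delta>_def by (intro automorphism_comp automorphism_inv \<tau>B \<tau>A(1))
  have \<tau>BC: "\<tau>B c = \<tau>A c" if "c \<in> C" for c
  proof -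
    have "\<sigma> c \<in> C" using \<sigma>(3) that by blast
    then show ?thesis using that \<iota>(2) \<iota>_invC \<tau>A(2) by (simp add: \<tau>B_def)
  qed
  have \<tau>BY': "\<tau>B w = w" if w: "w \<in> Y'" for w
  proof -
    have "inv \<iota> w \<in> Y"
      using automorphism_preimages[OF automorphism_inv[OF \<iota>(1)], of A B w n "- x"] w AB \<iota>_invC \<iota>_invx
      by (simp add: Y_def Y'_def)
    then show ?thesis using \<tau>A(3) \<iota>_inv by (simp add: \<tau>B_def)
  qed
  obtain u where u: "u 0 = x" "\<And>N. u (Suc N) * u (Suc N) = u N"
  proof -
    define sq where "sq y = (SOME z. z ^ 2 = y)" for y :: 'a
    have "sq y ^ 2 = y" for y unfolding sq_def by (rule someI_ex) (rule nth_root_exists, simp)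
    then have "sq y * sq y = y" for y by (simp add: power2_eq_square)
    then show thesis using that[of "rec_nat x (\<lambda>_. sq)"] by simp
  qed
  have pow: "u N ^ (2 ^ N) = x" for N
  proof (induction N)
    case (Suc N)
    have "u (Suc N) ^ (2 ^ Suc N) = (u (Suc N) * u (Suc N)) ^ (2 ^ N)"
      by (simp add: power_mult power2_eq_square)
    then show ?case using u(2)[of N] Suc by simp
  qed (simp add: u(1))
  have x0: "x \<noteq> 0" using xC subfield_0[OF C] by auto
  have \<tau>Bu: "\<tau>B (u N) = \<tau>A (u N)" for N
  proof -
    have uN0: "u N \<noteq> 0" using pow[of N] x0 by auto
    \<comment> \<open>\<tau>A fixes x, so \<xi> has order dividing 2^N; the inverse of \<iota>
      negates x, so \<eta> needs the exponent 2^(N+1).\<close>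
    define \<xi> \<eta> where "\<xi> = \<tau>A (u N) / u N" and "\<eta> = inv \<iota> (u N) / u N"
    have eqs: "\<tau>A (u N) = \<xi> * u N" "inv \<iota> (u N) = \<eta> * u N" using uN0 by (simp_all add: \<xi>_def \<eta>_def)
    have "\<tau>A (u N) ^ (2 ^ N) = x"
      using \<tau>Ax pow[of N] by (metis automorphism_power[OF \<tau>A(1)])
    then have "\<xi> ^ (2 ^ N) = 1" using pow[of N] x0 by (simp add: \<xi>_def power_divide)
    then have \<xi>: "\<xi> \<in> F" using F(5) by blast
    have "inv \<iota> (u N) ^ (2 ^ N) = - x"
      using \<iota>_invx(1) pow[of N] by (metis automorphism_power[OF automorphism_inv[OF \<iota>(1)]])
    then have "\<eta> ^ (2 ^ N) = - 1" using pow[of N] x0 by (simp add: \<eta>_def power_divide)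
    then have "\<eta> ^ (2 ^ Suc N) = 1" by (simp add: power_mult mult.commute[of 2])
    then have \<eta>: "\<eta> \<in> F" using F(5) by blast
    have "\<tau>B (u N) = \<iota> (\<tau>A (\<eta> * u N))" by (simp add: \<tau>B_def eqs(2))
    also have "\<tau>A (\<eta> * u N) = \<xi> * inv \<iota> (u N)"
      using \<tau>AF[OF \<eta>] by (simp add: automorphism_mult[OF \<tau>A(1)] eqs)
    also have "\<iota> \<dots> = \<xi> * u N"
      using \<iota>(2)[of \<xi>] \<xi> F(2) \<iota>_inv(2) by (auto simp: automorphism_mult[OF \<iota>(1)])
    finally show ?thesis using eqs(1) by simp
  qed
  have \<delta>fix: "\<delta> w = w" if "w \<in> adjoin C {u N}" for w N
  proof (rule automorphism_fixes_adjoin[OF \<delta> _ _ that])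
    show "\<delta> c = c" if "c \<in> C" for c using \<tau>BC[OF that] \<tau>A_inv by (simp add: \<delta>_def)
    show "\<delta> s = s" if "s \<in> {u N}" for s using \<tau>Bu[of N] \<tau>A_inv that by (simp add: \<delta>_def)
  qed
  \<comment> \<open>The automorphisms over C(Y). They fix x, hence also -x, and so map the finite
    set \<open>Y'\<close> into itself, as \<open>artin\<close> requires.\<close>
  define H where "H = {h. automorphism h \<and> (\<forall>c\<in>C. h c = c) \<and> (\<forall>w\<in>Y. h w = w)}"
  have xY: "x \<in> adjoin C Y" unfolding Y_def by (rule mem_adjoin_preimages[OF AB(1,2) xC])
  obtain h where h: "h \<in> H" "\<And>y. y \<in> Y' \<Longrightarrow> h y = \<delta> y"
  proof (rule artin[of H Y' \<delta> C])
    show "automorphism h" if "h \<in> H" for h using that by (simp add: H_def)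
    show "h \<circ> g \<in> H" if "h \<in> H" "g \<in> H" for h g using that by (simp add: H_def automorphism_comp)
    show "(\<lambda>x. x) \<in> H" by (simp add: H_def automorphism_id)
    show "finite Y'" unfolding Y'_def by (rule finite_preimages[OF AB(3)])
    show "h y \<in> Y'" if "h \<in> H" "y \<in> Y'" for h y
    proof -
      have h: "automorphism h" "\<And>c. c \<in> C \<Longrightarrow> h c = c" "\<And>w. w \<in> Y \<Longrightarrow> h w = w" using that by (auto simp: H_def)
      then have "h x = x" using automorphism_fixes_adjoin[OF h xY] by simp
      then show ?thesis
        using automorphism_preimages[OF h(1), of A B y n "- x"] h AB that(2)
        by (simp add: Y'_def automorphism_uminus[OF h(1)])
    qed
    show "automorphism \<delta>" by (rule \<delta>)
    show "\<delta> w = w" if w: "w \<in> adjoin C Y'" "\<And>h. h \<in> H \<Longrightarrow> h w = w" for w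
    proof -
      \<comment> \<open>What all of \<open>H\<close> fixes lies in C(Y); as w is also in C(Y'), it
        belongs to the common part, where \<delta> is the identity.\<close>
      have "w \<in> adjoin C Y"
      proof (rule ccontr)
        assume "w \<notin> adjoin C Y"
        then obtain \<phi> where \<phi>: "automorphism \<phi>" "\<And>c. c \<in> adjoin C Y \<Longrightarrow> \<phi> c = c" "\<phi> w \<noteq> w"
          using exists_automorphism_moving[OF is_subfield_adjoin alg_if[OF is_subfield_adjoin adjoin_base xY]] by metis
        then have "\<phi> \<in> H" using adjoin_base[of C Y] adjoin_gen[of Y C] by (auto simp: H_def)
        then show False using w(2) \<phi>(3) by blast
      qed
      then have "w \<in> (\<Union>N. adjoin C {u N})"
        using common_part_subset[OF xC algx(1) u, of w n] w(1) unfolding Y_def Y'_def by blast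
      then show ?thesis using \<delta>fix by blast
    qed
  qed blast
  have "automorphism (\<tau>A \<circ> h)" using h(1) by (simp add: H_def automorphism_comp \<tau>A(1))
  moreover have "(\<tau>A \<circ> h) c = \<sigma> c" if "c \<in> C" for c using h(1) that \<tau>A(2) by (simp add: H_def)
  moreover have "(\<tau>A \<circ> h) w = w" if "w \<in> preimages A B (Suc n) t" for w
  proof -
    have "w \<in> Y \<union> Y'" using that preimages_Suc[OF AB(3) x] by (simp add: Y_def Y'_def)
    then show ?thesis
    proof
      assume "w \<in> Y"
      then show ?thesis using h(1) \<tau>A(3) by (simp add: H_def)
    next
      assume "w \<in> Y'"
      then show ?thesis using h(2) \<tau>BY' \<tau>A_inv by (simp add: \<delta>_def)
    qed
  qed
  ultimately show ?case by blast
qed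

lemma constants_subset:
  assumes F: "is_subfield F" "F \<subseteq> C" "A \<in> F" "B \<in> F" "\<And>\<zeta> n. \<zeta> ^ (2 ^ n) = 1 \<Longrightarrow> \<zeta> \<in> F"
    and C_alg: "\<And>c. c \<in> C \<Longrightarrow> algebraic_over F c"
    and t: "t \<notin> C" "\<And>z. algebraic_over (adjoin F {t}) z"
    and a: "a \<in> adjoin F (\<Union>n. preimages A B n t)" "a \<in> C"
  shows "a \<in> F"
proof (rule ccontr)
  assume "a \<notin> F"
  \<comment> \<open>An automorphism moving \<open>a\<close> is available over a field over which the
    ambient field is algebraic, hence the passage from \<open>F\<close> to F(t).\<close>
  then have "a \<notin> adjoin F {t}" using adjoin_transcendental_Int[OF C closed F(1,2) t(1) a(2)] by blast
  then obtain \<sigma> where \<sigma>: "automorphism \<sigma>" "\<And>c. c \<in> adjoin F {t} \<Longrightarrow> \<sigma> c = c" "\<sigma> a \<noteq> a"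
    using exists_automorphism_moving[OF is_subfield_adjoin t(2)] by metis
  have \<sigma>F: "\<sigma> c = c" if "c \<in> F" for c using that \<sigma>(2) adjoin_base[of F] by blast
  \<comment> \<open>Conjugates over \<open>F\<close> of elements of \<open>C\<close> are roots of
    the same polynomials. Applied to \<sigma> and its inverse this gives \<sigma>(C) = C, which the
    gluing lemma requires.\<close>
  have img: "\<phi> c \<in> C" if \<phi>: "automorphism \<phi>" "\<And>c. c \<in> F \<Longrightarrow> \<phi> c = c" and c: "c \<in> C" for \<phi> c
  proof -
    obtain p where p: "p \<noteq> 0" "poly_over F p" "poly p c = 0" using C_alg[OF c] unfolding algebraic_over_def by blast
    then show ?thesis
      using root_in_C[OF poly_over_mono[OF F(2) p(2)] p(1)] automorphism_root[OF \<phi> p(2,3)] by blast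
  qed
  have "inv \<sigma> c = c" if "c \<in> F" for c using \<sigma>F[OF that] automorphism_inv_apply(1)[OF \<sigma>(1), of c] by simp
  then have "inv \<sigma> c \<in> C" if "c \<in> C" for c using img[OF automorphism_inv[OF \<sigma>(1)]] that by blast
  then have "C \<subseteq> \<sigma> ` C" using automorphism_inv_apply(2)[OF \<sigma>(1)] by (metis imageI subsetI)
  moreover have "\<sigma> ` C \<subseteq> C" using img[OF \<sigma>(1) \<sigma>F] by blast
  ultimately have \<sigma>C: "\<sigma> ` C = C" by blast
  have alg: "algebraic_over (adjoin C {t}) z" for z
    using t(2) algebraic_over_mono adjoin_mono[OF F(2) order_refl] by blast
  \<comment> \<open>The fields generated by single levels are nested, since each point is recovered
    from its own preimages; hence \<open>a\<close> already lies in one of them.\<close>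
  define K where "K n = adjoin F (preimages A B n t)" for n
  have "K n \<subseteq> K (Suc n)" for n
    unfolding K_def
  proof (rule adjoin_least[OF is_subfield_adjoin adjoin_base])
    show "preimages A B n t \<subseteq> adjoin F (preimages A B (Suc n) t)"
    proof
      fix y assume y: "y \<in> preimages A B n t"
      have "y \<in> adjoin F (preimages A B (Suc 0) y)"
        by (rule mem_adjoin_preimages[OF F(3,4) preimages_notin[OF t(1) y]])
      moreover have "preimages A B (Suc 0) y \<subseteq> preimages A B (Suc n) t"
        using y by (auto simp: preimages_Suc_bottom)
      ultimately show "y \<in> adjoin F (preimages A B (Suc n) t)"
        using adjoin_mono[OF order_refl, of "preimages A B (Suc 0) y" "preimages A B (Suc n) t" F] by blast
    qed
  qed
  then have "is_subfield (\<Union>n. K n)"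
    by (rule is_subfield_UN_chain[rotated]) (simp add: K_def is_subfield_adjoin)
  moreover have "F \<subseteq> K n" "preimages A B n t \<subseteq> K n" for n
    unfolding K_def by (rule adjoin_base, rule adjoin_gen)
  ultimately have "adjoin F (\<Union>n. preimages A B n t) \<subseteq> (\<Union>n. K n)"
    by (intro adjoin_least) blast+
  then obtain n where n: "a \<in> adjoin F (preimages A B n t)" using a(1) by (auto simp: K_def)
  have "\<exists>\<tau>. automorphism \<tau> \<and> (\<forall>c\<in>C. \<tau> c = \<sigma> c) \<and> (\<forall>w\<in>preimages A B n t. \<tau> w = w)"
    by (rule automorphism_fixing_preimages[OF F(1-4) _ \<sigma>(1) _ \<sigma>C t(1) alg]) (fact F(5) \<sigma>F)+
  then obtain \<tau> where \<tau>: "automorphism \<tau>" "\<And>c. c \<in> C \<Longrightarrow> \<tau> c = \<sigma> c" "\<And>w. w \<in> preimages A B n t \<Longrightarrow> \<tau> w = w"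
    by blast
  have "\<tau> c = c" if "c \<in> F" for c using \<tau>(2) \<sigma>F that F(2) by auto
  then have "\<tau> a = a" using automorphism_fixes_adjoin[OF \<tau>(1) _ \<tau>(3) n] by blast
  then show False using \<tau>(2)[OF a(2)] \<sigma>(3) by simp
qed

end

section \<open>Quadratic rational functions in homogeneous coordinates\<close>

fun hx :: "'a::field P1 \<Rightarrow> 'a" and hy :: "'a P1 \<Rightarrow> 'a" where
  "hx (Fin a) = a" | "hx Infty = 1" | "hy (Fin a) = 1" | "hy Infty = 0"

text \<open>The determinant of the homogeneous coordinates of v and w; as a function of v it is the
  linear form that vanishes exactly at w. It treats infinity like any other point.\<close>

definition bracket :: "'a::field P1 \<Rightarrow> 'a P1 \<Rightarrow> 'a" where
  "bracket v w = hy w * hx v - hx w * hy v"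

text \<open>For \<open>p\<close> of degree at most 2, its homogenisation to degree exactly 2: a drop
  of the degree appears as a zero at infinity.\<close>

definition form2 :: "'a::field poly \<Rightarrow> 'a \<Rightarrow> 'a \<Rightarrow> 'a" where
  "form2 p X Y = coeff p 2 * X\<^sup>2 + coeff p 1 * X * Y + coeff p 0 * Y\<^sup>2"

definition rational_point :: "'a::field set \<Rightarrow> 'a P1 \<Rightarrow> bool" where
  "rational_point k c \<longleftrightarrow> hx c \<in> k \<and> hy c \<in> k"

lemma bracket_eq_0_iff: "bracket v w = 0 \<longleftrightarrow> v = w"
  by (cases v; cases w) (auto simp: bracket_def)

lemma form2_1:
  assumes "degree p \<le> 2"
  shows "form2 p z 1 = poly p z"
proof -
  have "poly p z = poly (\<Sum>i\<le>2. monom (coeff p i) i) z"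
    using poly_as_sum_of_monoms'[OF assms] by simp
  then show ?thesis by (simp add: form2_def poly_sum poly_monom numeral_2_eq_2)
qed

lemma form2_diff_smult: "form2 (smult a p - smult b q) X Y = a * form2 p X Y - b * form2 q X Y"
  by (simp add: form2_def algebra_simps)

context
  fixes P Q :: "'a::{alg_closed_field, field_char_0} poly"
  assumes Q0: "Q \<noteq> 0" and cop: "coprime P Q" and deg: "ratfun_degree P Q = 2"
begin

lemma degree_le_2: "degree P \<le> 2" "degree Q \<le> 2"
  using deg by (auto simp: ratfun_degree_def)

lemma coprime_no_common_root: "poly P z = 0 \<Longrightarrow> poly Q z \<noteq> 0"
proof
  assume "poly P z = 0" "poly Q z = 0"
  then have "[:- z, 1:] dvd P" "[:- z, 1:] dvd Q" by (simp_all add: poly_eq_0_iff_dvd)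
  then have "is_unit [:- z, 1:]" using cop coprime_common_divisor by blast
  then show False by (simp add: is_unit_pCons_iff)
qed

text \<open>Coprimality keeps the two forms from vanishing together, so their ratio agrees with
  \<open>ratfun_map\<close> at poles and at infinity too; \<mu> is the scalar of
  normalisation.\<close>

lemma ratfun_map_homogeneous:
  "\<exists>\<mu>. \<mu> \<noteq> 0 \<and> form2 P (hx c) (hy c) = \<mu> * hx (ratfun_map P Q c) \<and>
    form2 Q (hx c) (hy c) = \<mu> * hy (ratfun_map P Q c)"
proof (cases c)
  case (Fin z)
  show ?thesis
  proof (cases "poly Q z = 0")
    case True
    then show ?thesis using coprime_no_common_root[of z] Fin degree_le_2
      by (intro exI[of _ "poly P z"]) (auto simp: form2_1)
  next
    case False
    then show ?thesis using Fin degree_le_2 by (intro exI[of _ "poly Q z"]) (auto simp: form2_1)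
  qed
next
  case Infty
  show ?thesis
  proof (cases "coeff Q 2 = 0")
    case True
    have "coeff P 2 \<noteq> 0"
    proof
      assume P2: "coeff P 2 = 0"
      have "degree P = 2 \<or> degree Q = 2" using deg by (auto simp: ratfun_degree_def max_def split: if_splits)
      then show False using P2 True by (metis coeff_0 degree_0 leading_coeff_0_iff zero_neq_numeral)
    qed
    then show ?thesis using True Infty by (intro exI[of _ "coeff P 2"]) (auto simp: form2_def deg)
  next
    case False
    then show ?thesis using Infty by (intro exI[of _ "coeff Q 2"]) (auto simp: form2_def deg Let_def)
  qed
qed

lemma fibre_poly_nonzero: "fibre_poly P Q w \<noteq> 0"
proof (cases w)
  case (Fin b)
  show ?thesis
  proof
    assume "fibre_poly P Q w = 0"
    then have P: "P = smult b Q" using Fin by simp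
    then have "Q dvd P" by (simp add: dvd_smult)
    then have "is_unit Q" using cop by (metis coprime_common_divisor dvd_refl)
    then have "degree Q = 0" using is_unit_iff_degree[OF Q0] by blast
    then show False using P deg by (simp add: ratfun_degree_def split: if_splits)
  qed
qed (simp add: Q0)

lemma degree_fibre_poly: "degree (fibre_poly P Q w) \<le> 2"
  using degree_le_2 by (cases w) (auto intro!: degree_diff_le order.trans[OF degree_smult_le])

lemma critical_Fin_iff:
  "Fin z \<in> critical_points P Q \<longleftrightarrow> [:- z, 1:]\<^sup>2 dvd fibre_poly P Q (ratfun_map P Q (Fin z))"
  using fibre_poly_nonzero by (simp add: critical_points_def order_divides del: ratfun_map.simps)

lemma critical_Infty_iff:
  "Infty \<in> critical_points P Q \<longleftrightarrow> degree (fibre_poly P Q (ratfun_map P Q Infty)) = 0"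
  by (auto simp: critical_points_def deg simp del: ratfun_map.simps)

text \<open>In degree 2 a critical point exhausts its fibre, so the fibre form is a constant times
  the square of the linear form vanishing at \<open>c\<close>. This is the source of the normal
  form.\<close>

lemma critical_fibre_form:
  assumes "c \<in> critical_points P Q"
  shows "\<exists>d. d \<noteq> 0 \<and> (\<forall>X Y. hy (ratfun_map P Q c) * form2 P X Y - hx (ratfun_map P Q c) * form2 Q X Y =
    d * (hy c * X - hx c * Y)\<^sup>2)"
proof -
  define w where "w = ratfun_map P Q c"
  define G where "G = fibre_poly P Q w"
  have G0: "G \<noteq> 0" unfolding G_def by (rule fibre_poly_nonzero)
  have "\<exists>d. d \<noteq> 0 \<and> (\<forall>X Y. form2 G X Y = d * (hy c * X - hx c * Y)\<^sup>2)"
  proof (cases c)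
    case (Fin z)
    then have "[:- z, 1:]\<^sup>2 dvd G" using assms critical_Fin_iff unfolding G_def w_def by blast
    then obtain H where H: "G = [:- z, 1:]\<^sup>2 * H" by (elim dvdE)
    then have "H \<noteq> 0" using G0 by auto
    then have "degree G = 2 + degree H" unfolding H by (simp add: degree_mult_eq degree_power_eq)
    then have "degree H = 0" using degree_fibre_poly[of w] unfolding G_def by simp
    then obtain d where d: "H = [:d:]" by (elim degree_eq_zeroE)
    then have G: "G = [:d * z\<^sup>2, - (2 * d * z), d:]" by (simp add: H power2_eq_square algebra_simps)
    have "form2 G X Y = d * (hy c * X - hx c * Y)\<^sup>2" for X Y
      unfolding G form2_def Fin by (simp add: numeral_2_eq_2 algebra_simps)
    then show ?thesis using d \<open>H \<noteq> 0\<close> by (intro exI[of _ d]) auto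
  next
    case Infty
    then have "degree G = 0" using assms critical_Infty_iff unfolding G_def w_def by simp
    then obtain d where d: "G = [:d:]" by (elim degree_eq_zeroE)
    then show ?thesis using G0 Infty by (intro exI[of _ d]) (auto simp: form2_def numeral_2_eq_2)
  qed
  then obtain d where d: "d \<noteq> 0" "\<And>X Y. form2 G X Y = d * (hy c * X - hx c * Y)\<^sup>2" by blast
  show ?thesis
  proof (cases w)
    case (Fin b)
    then have "form2 G X Y = form2 P X Y - b * form2 Q X Y" for X Y
      using form2_diff_smult[of 1 P b Q X Y] by (simp add: G_def)
    then show ?thesis using d Fin unfolding w_def[symmetric] by (intro exI[of _ d]) simp
  next
    case Infty
    then show ?thesis using d unfolding w_def[symmetric] G_def by (intro exI[of _ "- d"]) simp
  qed
qed

text \<open>A double root of P - b Q, or of Q, is a zero of the Wronskian. Together with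
  \<open>wronskian_nonzero\<close> this makes finite critical points algebraic over the field of
  definition.\<close>

lemma critical_wronskian:
  assumes "Fin z \<in> critical_points P Q"
  shows "poly (pderiv P * Q - P * pderiv Q) z = 0"
proof -
  obtain w where "[:- z, 1:]\<^sup>2 dvd fibre_poly P Q w" using assms critical_Fin_iff by blast
  then obtain H where "fibre_poly P Q w = [:- z, 1:]\<^sup>2 * H" by (elim dvdE)
  then have H: "fibre_poly P Q w = [:- z, 1:] * ([:- z, 1:] * H)"
    by (simp only: power2_eq_square mult.assoc)
  have *: "poly (fibre_poly P Q w) z = 0" "poly (pderiv (fibre_poly P Q w)) z = 0"
    unfolding H by (simp_all add: pderiv_mult pderiv_pCons del: mult_pCons_left)
  show ?thesis
  proof (cases w)
    case (Fin b)
    then have "poly P z = b * poly Q z" "poly (pderiv P) z = b * poly (pderiv Q) z"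
      using * by (simp_all add: pderiv_diff pderiv_smult)
    then show ?thesis by simp
  qed (use * in simp)
qed

text \<open>In characteristic 0 the derivative of q has smaller order than q at a zero of q. Where p
  does not vanish, this excludes p' q = p q'; so \<open>P\<close> and \<open>Q\<close> would both be
  constant.\<close>

lemma wronskian_nonzero: "pderiv P * Q - P * pderiv Q \<noteq> 0"
proof
  assume "pderiv P * Q - P * pderiv Q = 0"
  then have eq: "pderiv P * Q = P * pderiv Q" by simp
  have const: "degree q = 0"
    if eq: "pderiv p * q = p * pderiv q" and no_root: "\<And>z. poly q z = 0 \<Longrightarrow> poly p z \<noteq> 0" for p q :: "'a poly"
  proof (rule ccontr)
    assume dq: "degree q \<noteq> 0"
    then obtain z where z: "poly q z = 0" using alg_closed_imp_poly_has_root[of q] by auto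
    have q': "pderiv q \<noteq> 0" using dq by (simp add: pderiv_eq_0_iff)
    have pz: "poly p z \<noteq> 0" using no_root z by blast
    then have "p * pderiv q \<noteq> 0" using q' by auto
    then have "order z (pderiv p) + order z q = order z p + order z (pderiv q)"
      using eq order_mult by metis
    moreover have "order z p = 0" using pz by (simp add: order_0I)
    moreover have "order z q = Suc (order z (pderiv q))" using dq z by (intro order_pderiv) auto
    ultimately show False by simp
  qed
  have "degree Q = 0" using const[OF eq] coprime_no_common_root by blast
  moreover have "degree P = 0" using const[of Q P] eq coprime_no_common_root by (auto simp: mult.commute)
  ultimately show False using deg by (simp add: ratfun_degree_def)
qed

section \<open>Galois equivariance and rational points\<close>

lemma map_P1_ratfun_map:
  assumes \<sigma>: "automorphism \<sigma>" "map_poly \<sigma> P = P" "map_poly \<sigma> Q = Q"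
  shows "ratfun_map P Q (map_P1 \<sigma> c) = map_P1 \<sigma> (ratfun_map P Q c)"
proof -
  have co: "\<sigma> (coeff P i) = coeff P i" "\<sigma> (coeff Q i) = coeff Q i" for i
    using map_poly_automorphism(1)[OF \<sigma>(1), of P i] map_poly_automorphism(1)[OF \<sigma>(1), of Q i] \<sigma> by auto
  have va: "poly P (\<sigma> z) = \<sigma> (poly P z)" "poly Q (\<sigma> z) = \<sigma> (poly Q z)" for z
    using map_poly_automorphism(3)[OF \<sigma>(1), of P z] map_poly_automorphism(3)[OF \<sigma>(1), of Q z] \<sigma> by auto
  show ?thesis
    by (cases c) (auto simp: va co automorphism_eq_0_iff[OF \<sigma>(1)] automorphism_divide[OF \<sigma>(1)] Let_def)
qed

lemma map_poly_fibre_poly: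
  assumes \<sigma>: "automorphism \<sigma>" "map_poly \<sigma> P = P" "map_poly \<sigma> Q = Q"
  shows "map_poly \<sigma> (fibre_poly P Q w) = fibre_poly P Q (map_P1 \<sigma> w)"
proof (cases w)
  case (Fin b)
  have "\<sigma> (coeff P i) = coeff P i" "\<sigma> (coeff Q i) = coeff Q i" for i
    using map_poly_automorphism(1)[OF \<sigma>(1), of P i] map_poly_automorphism(1)[OF \<sigma>(1), of Q i] \<sigma> by auto
  then show ?thesis using Fin
    by (simp add: poly_eq_iff map_poly_automorphism(1)[OF \<sigma>(1)] automorphism_simps[OF \<sigma>(1)])
qed (simp add: \<sigma>)

lemma map_P1_critical:
  assumes \<sigma>: "automorphism \<sigma>" "map_poly \<sigma> P = P" "map_poly \<sigma> Q = Q" and c: "c \<in> critical_points P Q"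
  shows "map_P1 \<sigma> c \<in> critical_points P Q"
proof (cases c)
  case (Fin z)
  then obtain H where H: "fibre_poly P Q (ratfun_map P Q (Fin z)) = [:- z, 1:]\<^sup>2 * H"
    using c critical_Fin_iff by (auto elim: dvdE simp del: ratfun_map.simps)
  have "fibre_poly P Q (ratfun_map P Q (Fin (\<sigma> z))) = map_poly \<sigma> (fibre_poly P Q (ratfun_map P Q (Fin z)))"
    unfolding map_poly_fibre_poly[OF \<sigma>] map_P1_ratfun_map[OF \<sigma>, symmetric] by simp
  also have "\<dots> = [:- \<sigma> z, 1:]\<^sup>2 * map_poly \<sigma> H"
    unfolding H power2_eq_square map_poly_automorphism(2)[OF \<sigma>(1)]
    by (simp only: map_poly_automorphism(6,7)[OF \<sigma>(1)] automorphism_simps[OF \<sigma>(1)])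
  finally show ?thesis using Fin critical_Fin_iff by (simp del: ratfun_map.simps)
next
  case Infty
  then have "degree (fibre_poly P Q (ratfun_map P Q Infty)) = 0" using c critical_Infty_iff by blast
  moreover have "fibre_poly P Q (ratfun_map P Q Infty) = map_poly \<sigma> (fibre_poly P Q (ratfun_map P Q Infty))"
    unfolding map_poly_fibre_poly[OF \<sigma>] map_P1_ratfun_map[OF \<sigma>, symmetric] by simp
  ultimately show ?thesis using c Infty by simp
qed

lemma rational_point_ratfun_map:
  assumes k: "is_subfield k" "poly_over k P" "poly_over k Q" and c: "rational_point k c"
  shows "rational_point k (ratfun_map P Q c)"
proof (cases c)
  case (Fin z)
  then show ?thesis
    using c poly_over_value[OF k(1,2), of z] poly_over_value[OF k(1,3), of z] k(1)
    by (auto simp: rational_point_def subfield_closed)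
next
  case Infty
  then show ?thesis using k by (auto simp: rational_point_def poly_over_def Let_def subfield_closed)
qed

end

text \<open>The exact order of \<zeta> divides 2^n, so it is some 2^i. The order 1 is treated apart
  because the exponents of the generators start at 1.\<close>

lemma power_2_root_in_adjoin:
  fixes k :: "'a::field set"
  assumes "\<zeta> ^ (2 ^ n) = 1"
  shows "\<zeta> \<in> adjoin k {\<zeta>. \<exists>n\<ge>1. primitive_root_of_unity (2 ^ n) \<zeta>}"
proof -
  define d where "d = (LEAST d. d > 0 \<and> \<zeta> ^ d = 1)"
  have "d > 0 \<and> \<zeta> ^ d = 1" unfolding d_def by (rule LeastI[of _ "2 ^ n"]) (use assms in simp)
  then have d: "d > 0" "\<zeta> ^ d = 1" by auto
  have min: "\<zeta> ^ j \<noteq> 1" if "0 < j" "j < d" for j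
    using not_less_Least[of j "\<lambda>d. d > 0 \<and> \<zeta> ^ d = 1"] that unfolding d_def by blast
  have "\<zeta> ^ (2 ^ n) = (\<zeta> ^ d) ^ (2 ^ n div d) * \<zeta> ^ (2 ^ n mod d)"
    by (metis mult_div_mod_eq power_add power_mult)
  then have "\<zeta> ^ (2 ^ n mod d) = 1" using d assms by simp
  then have "2 ^ n mod d = 0" using min[of "2 ^ n mod d"] d(1) by (metis gr0I mod_less_divisor)
  then have "d dvd 2 ^ n" by auto
  then obtain i where i: "d = 2 ^ i" using divides_primepow_nat[of 2 d n] by auto
  show ?thesis
  proof (cases "i = 0")
    case True
    then show ?thesis using d i subfield_1[OF is_subfield_adjoin] by simp
  next
    case False
    then have "primitive_root_of_unity (2 ^ i) \<zeta>" using d min i by (auto simp: primitive_root_of_unity_def)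
    then show ?thesis
      using False adjoin_gen[of "{\<zeta>. \<exists>n\<ge>1. primitive_root_of_unity (2 ^ n) \<zeta>}" k] by (auto simp: Suc_le_eq)
  qed
qed

theorem theorem1p3:
  fixes k :: "'a::{alg_closed_field, field_char_0} set"
    and t :: 'a
    and P Q :: "'a poly"
    and r :: nat
    and p :: "nat \<Rightarrow> 'a P1"
  assumes "number_field k"
    and "\<not> algebraic_over k t"
    and "\<forall>x. algebraic_over (adjoin k {t}) x"
    and "is_ratfun k P Q"
    and "ratfun_degree P Q = 2"
    and "r \<ge> 3"
    and "inj_on p {1..r}"
    and "postcritical_set P Q = p ` {1..r}"
    and "p 0 = p r"
    and "\<forall>m\<in>{1..r}. ratfun_map P Q (p (m - 1)) = p m"
    and "critical_points P Q = {p r, p 1}"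
  shows "field_of_constants k P Q t \<subseteq>
         adjoin k {\<zeta>. \<exists>n\<ge>1. primitive_root_of_unity (2 ^ n) \<zeta>}"
proof -
  define f where "f = ratfun_map P Q"
  define C where "C = {x. algebraic_over k x}"
  define F where "F = adjoin k {\<zeta>. \<exists>n\<ge>1. primitive_root_of_unity (2 ^ n) \<zeta>}"
  have k: "is_subfield k" using assms(1) by (simp add: number_field_def)
  have PQ: "poly_over k P" "poly_over k Q" "Q \<noteq> 0" "coprime P Q"
    using assms(4) by (auto simp: is_ratfun_def)
  note quad = PQ(3,4) assms(5)

  have C: "is_subfield C" unfolding C_def by (rule is_subfield_algebraics[OF k])
  have closed: "x \<in> C" if "algebraic_over C x" for x
    using algebraic_over_trans[OF k _ that] by (auto simp: C_def)
  have kC: "k \<subseteq> C" using algebraic_over_self[OF k] by (auto simp: C_def)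
  have tC: "t \<notin> C" using assms(2) by (simp add: C_def)
  have F: "is_subfield F" unfolding F_def by (rule is_subfield_adjoin)
  have kF: "k \<subseteq> F" unfolding F_def by (rule adjoin_base)
  have FC: "F \<subseteq> C"
    unfolding F_def
  proof (intro adjoin_least C kC subsetI)
    fix \<zeta> :: 'a assume "\<zeta> \<in> {\<zeta>. \<exists>n\<ge>1. primitive_root_of_unity (2 ^ n) \<zeta>}"
    then obtain n :: nat where n: "\<zeta> ^ (2 ^ n) = 1" by (auto simp: primitive_root_of_unity_def)
    have "poly_over k (monom 1 (2 ^ n) - 1)"
      using k by (intro poly_over_diff poly_over_monom poly_over_1 subfield_1)
    moreover have "monom (1::'a) (2 ^ n) - 1 \<noteq> 0"
    proof
      assume "monom (1::'a) (2 ^ n) - 1 = 0"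
      then have "coeff (monom (1::'a) (2 ^ n) - 1) 0 = 0" by simp
      then show False by simp
    qed
    moreover have "poly (monom 1 (2 ^ n) - 1) \<zeta> = 0" using n by (simp add: poly_monom)
    ultimately show "\<zeta> \<in> C" unfolding C_def using algebraic_overI by blast
  qed

  have f: "f (p m) = p (Suc m)" if "m < r" for m
    using assms(10)[rule_format, of "Suc m"] that by (simp add: f_def)
  have f_r: "f (p r) = p 1" using f[of 0] assms(6,9) by simp
  have p_eq: "p i = p j \<longleftrightarrow> i = j" if "i \<in> {1..r}" "j \<in> {1..r}" for i j
    using assms(7) that by (auto dest: inj_onD)
  \<comment> \<open>Here r >= 3 enters: \<open>p 2\<close>, the image of the critical point
    \<open>p 1\<close>, is itself neither critical point. The descent below and the nonvanishing of
    \<alpha> rest on these inequalities.\<close>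
  have ne: "p 1 \<noteq> p r" "p 2 \<noteq> p 1" "p 2 \<noteq> p r" using assms(6) p_eq[of 1 r] p_eq[of 2 1] p_eq[of 2 r] by auto
  have f_1: "f (p 1) = p 2" using f[of 1] assms(6) by (simp add: numeral_2_eq_2)

  text \<open>A Galois conjugation that swapped the critical points would send \<open>p 1 = f (p r)\<close> to \<open>p 2\<close>.\<close>
  have fixed: "map_P1 \<sigma> (p r) = p r" if \<sigma>: "automorphism \<sigma>" "\<And>c. c \<in> k \<Longrightarrow> \<sigma> c = c" for \<sigma>
  proof (rule ccontr)
    assume no: "map_P1 \<sigma> (p r) \<noteq> p r"
    have \<sigma>PQ: "map_poly \<sigma> P = P" "map_poly \<sigma> Q = Q"
      using \<sigma> PQ(1,2) by (auto simp: poly_eq_iff map_poly_automorphism(1)[OF \<sigma>(1)] poly_over_def)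
    have crit: "map_P1 \<sigma> (p r) \<in> {p r, p 1}" "map_P1 \<sigma> (p 1) \<in> {p r, p 1}"
      using map_P1_critical[OF quad \<sigma>(1) \<sigma>PQ] assms(11) by auto
    then have "map_P1 \<sigma> (p r) = p 1" using no by blast
    then have "map_P1 \<sigma> (p 1) = p 2"
      using map_P1_ratfun_map[OF quad \<sigma>(1) \<sigma>PQ, of "p r"] f_r f_1 by (simp add: f_def)
    then show False using crit(2) ne by simp
  qed
  \<comment> \<open>Only \<open>p r\<close> needs descent, as \<open>p 1\<close> and
    \<open>p 2\<close> are its forward images. If finite, it is algebraic over \<open>k\<close> by
    the Wronskian and fixed by all conjugations.\<close>
  have rat_r: "rational_point k (p r)"
  proof (cases "p r")
    case (Fin z)
    define W where "W = pderiv P * Q - P * pderiv Q"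
    have "poly_over k W"
      unfolding W_def using k PQ by (intro poly_over_diff poly_over_mult poly_over_pderiv)
    moreover have "W \<noteq> 0" unfolding W_def by (rule wronskian_nonzero[OF quad])
    moreover have "poly W z = 0"
      unfolding W_def by (rule critical_wronskian[OF quad]) (use assms(11) Fin in auto)
    ultimately have zC: "z \<in> C" unfolding C_def using algebraic_overI by blast
    have "z \<in> k"
    proof (rule ccontr)
      assume "z \<notin> k"
      then have "z \<notin> adjoin k {t}" using adjoin_transcendental_Int[OF C closed k kC tC zC] by blast
      then obtain \<sigma> where \<sigma>: "automorphism \<sigma>" "\<And>c. c \<in> adjoin k {t} \<Longrightarrow> \<sigma> c = c" "\<sigma> z \<noteq> z"
        using exists_automorphism_moving[OF is_subfield_adjoin assms(3)[rule_format]] by metis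
      have "map_P1 \<sigma> (p r) = p r" using \<sigma> adjoin_base[of k "{t}"] by (intro fixed) auto
      then show False using \<sigma>(3) Fin by simp
    qed
    then show ?thesis using k Fin by (simp add: rational_point_def subfield_1)
  qed (use k in \<open>simp add: rational_point_def subfield_closed\<close>)
  have rat_f: "rational_point k (f c)" if "rational_point k c" for c
    unfolding f_def by (rule rational_point_ratfun_map[OF quad k PQ(1,2) that])
  have rat_1: "rational_point k (p 1)" using rat_f[OF rat_r] f_r by simp
  have rat_2: "rational_point k (p 2)" using rat_f[OF rat_1] f_1 by simp

  have bracket_k: "bracket v w \<in> k" if "rational_point k v" "rational_point k w" for v w
    using that k by (auto simp: rational_point_def bracket_def intro!: subfield_diff subfield_mult)
  have form2_k: "form2 q X Y \<in> k" if "poly_over k q" "X \<in> k" "Y \<in> k" for q X Y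
    unfolding form2_def using that k
    by (intro subfield_add subfield_mult subfield_power) (auto simp: poly_over_def)
  define br where "br = bracket (p 1) (p r)"
  have br0: "br \<noteq> 0" "bracket (p r) (p 1) = - br" "br \<in> k"
    using ne(1) bracket_k[OF rat_1 rat_r] by (simp_all add: br_def bracket_eq_0_iff) (simp add: bracket_def)

  obtain c where c: "c \<noteq> 0" "\<And>X Y. hy (p 1) * form2 P X Y - hx (p 1) * form2 Q X Y = c * (hy (p r) * X - hx (p r) * Y)\<^sup>2"
    using critical_fibre_form[OF quad, of "p r"] assms(11) f_r by (auto simp: f_def)
  obtain d where d: "d \<noteq> 0" "\<And>X Y. hy (p 2) * form2 P X Y - hx (p 2) * form2 Q X Y = d * (hy (p 1) * X - hx (p 1) * Y)\<^sup>2"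
    using critical_fibre_form[OF quad, of "p 1"] assms(11) f_1 by (auto simp: f_def)
  \<comment> \<open>The identity for c is evaluated at \<open>p 1\<close> and that for d at
    \<open>p r\<close>; there the linear form on the right is \<open>br\<close> up to sign, and the
    left side lies in \<open>k\<close>.\<close>
  have "c * br\<^sup>2 \<in> k" "d * br\<^sup>2 \<in> k"
  proof -
    have hk: "hx (p 1) \<in> k" "hy (p 1) \<in> k" "hx (p r) \<in> k" "hy (p r) \<in> k" "hx (p 2) \<in> k" "hy (p 2) \<in> k"
      using rat_1 rat_r rat_2 by (simp_all add: rational_point_def)
    have "c * br\<^sup>2 = hy (p 1) * form2 P (hx (p 1)) (hy (p 1)) - hx (p 1) * form2 Q (hx (p 1)) (hy (p 1))"
      unfolding c(2) by (simp add: br_def bracket_def)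
    then show "c * br\<^sup>2 \<in> k" using hk form2_k PQ(1,2) k by (simp add: subfield_diff subfield_mult)
    have "bracket (p r) (p 1) ^ 2 = br\<^sup>2" using br0(2) by simp
    then have "d * br\<^sup>2 = hy (p 2) * form2 P (hx (p r)) (hy (p r)) - hx (p 2) * form2 Q (hx (p r)) (hy (p r))"
      unfolding d(2) by (simp add: bracket_def)
    then show "d * br\<^sup>2 \<in> k" using hk form2_k PQ(1,2) k by (simp add: subfield_diff subfield_mult)
  qed
  then have cdk: "c * br\<^sup>2 / br\<^sup>2 \<in> k" "d * br\<^sup>2 / br\<^sup>2 \<in> k"
    using subfield_divide[OF k _ subfield_power[OF k br0(3)]] by blast+
  have cd: "c \<in> k" "d \<in> k" using cdk br0(1) by simp_all

  text \<open>In the coordinate \<open>M\<close> the critical points \<open>p r\<close> and \<open>p 1\<close> are \<open>0\<close> and infinity, so that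
    \<open>f\<close> becomes even with a pole at \<open>0\<close>.\<close>
  define M where "M v = bracket v (p r) / bracket v (p 1)" for v
  \<comment> \<open>In the coordinate \<open>M\<close> the linear form vanishing at
    \<open>p 2\<close> becomes \<alpha> M + \<beta>. So A is M (p 2), the image of infinity, and B
    collects the constants of the two fibre forms.\<close>
  define \<alpha> \<beta> where "\<alpha> = bracket (p 1) (p 2) / br" and "\<beta> = - (bracket (p r) (p 2) / br)"
  define A B where "A = - \<beta> / \<alpha>" and "B = d / (c * \<alpha>)"
  have \<alpha>0: "\<alpha> \<noteq> 0" using ne br0(1) by (auto simp: \<alpha>_def bracket_eq_0_iff)
  have abk: "\<alpha> \<in> k" "\<beta> \<in> k"
    unfolding \<alpha>_def \<beta>_def using bracket_k rat_1 rat_2 rat_r br0(3) k by (simp_all add: subfield_closed)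
  have ABk: "A \<in> k" "B \<in> k" unfolding A_def B_def using abk cd k by (simp_all add: subfield_closed)
  have B0: "B \<noteq> 0" using d(1) c(1) \<alpha>0 by (simp add: B_def)
  have plucker: "bracket v (p 2) = \<alpha> * bracket v (p r) + \<beta> * bracket v (p 1)" for v
  proof -
    have "bracket v (p 2) * br = bracket (p 1) (p 2) * bracket v (p r) - bracket (p r) (p 2) * bracket v (p 1)"
      by (simp add: bracket_def br_def algebra_simps)
    then show ?thesis using br0(1) by (simp add: \<alpha>_def \<beta>_def field_simps)
  qed
  have M_f: "maps_to A B (M v) (M (f v))" if v: "v \<noteq> p r" "v \<noteq> p 1" for v
  proof -
    obtain \<mu> where \<mu>: "\<mu> \<noteq> 0" "form2 P (hx v) (hy v) = \<mu> * hx (f v)" "form2 Q (hx v) (hy v) = \<mu> * hy (f v)"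
      using ratfun_map_homogeneous[OF quad, of v] unfolding f_def by blast
    have 1: "\<mu> * bracket (f v) (p 1) = c * (bracket v (p r))\<^sup>2"
      using c(2)[of "hx v" "hy v"] \<mu> by (simp add: bracket_def algebra_simps)
    have 2: "\<mu> * bracket (f v) (p 2) = d * (bracket v (p 1))\<^sup>2"
      using d(2)[of "hx v" "hy v"] \<mu> by (simp add: bracket_def algebra_simps)
    have nz: "bracket v (p r) \<noteq> 0" "bracket v (p 1) \<noteq> 0" using v by (simp_all add: bracket_eq_0_iff)
    then have nz1: "bracket (f v) (p 1) \<noteq> 0" using 1 c(1) by auto
    have "\<alpha> * M (f v) + \<beta> = bracket (f v) (p 2) / bracket (f v) (p 1)"
      unfolding plucker M_def using nz1 by (simp add: field_simps)
    also have "\<dots> = (\<mu> * bracket (f v) (p 2)) / (\<mu> * bracket (f v) (p 1))" using \<mu>(1) by simp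
    also have "\<dots> = (d / c) * (bracket v (p 1) / bracket v (p r))\<^sup>2"
      unfolding 1 2 by (simp add: power_divide)
    finally have eq: "\<alpha> * (M (f v) - A) = (d / c) * (bracket v (p 1) / bracket v (p r))\<^sup>2"
      using \<alpha>0 by (simp add: A_def algebra_simps)
    have "M (f v) - A = \<alpha> * (M (f v) - A) / \<alpha>" using \<alpha>0 by simp
    also have "\<dots> = B * (bracket v (p 1) / bracket v (p r))\<^sup>2"
      unfolding eq by (simp add: B_def mult.commute)
    finally show ?thesis
      using nz by (simp add: maps_to_def M_def power_divide)
  qed
  \<comment> \<open>Division by zero gives M (p 1) = 0 = M (p r), so \<open>p 1\<close>, which ought
    to be infinity, has to be excluded.\<close>
  have M_inj: "v = w" if "M v = M w" "v \<noteq> p 1" "w \<noteq> p 1" for v w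
  proof -
    have "bracket v (p r) * bracket w (p 1) = bracket w (p r) * bracket v (p 1)"
      using that by (simp add: M_def bracket_eq_0_iff frac_eq_eq)
    moreover have "bracket v w * br = bracket w (p r) * bracket v (p 1) - bracket v (p r) * bracket w (p 1)"
      by (simp add: bracket_def br_def algebra_simps)
    ultimately show ?thesis using br0(1) bracket_eq_0_iff[of v w] by auto
  qed
  have M_r: "M (p r) = 0" by (simp add: M_def bracket_def)

  \<comment> \<open>Indices start at 2 because \<open>p 1\<close> is infinity in this coordinate;
    the index r contributes 0.\<close>
  define S where "S = (\<lambda>m. M (p m)) ` {2..r}"
  have step: "maps_to A B (M (p m)) (M (p (Suc m)))" if "2 \<le> m" "m < r" for m
    using M_f[of "p m"] f[of m] p_eq[of m r] p_eq[of m 1] that by simp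
  interpret backward_orbits C A B S
  proof
    show "is_subfield C" by (rule C)
    show "x \<in> C" if "algebraic_over C x" for x using that by (rule closed)
    show "A \<in> C" "B \<in> C" using ABk kC by auto
    show "B \<noteq> 0" by (rule B0)
    have "\<alpha> * M (p 2) + \<beta> = 0"
    proof -
      have "bracket (p 2) (p 1) \<noteq> 0" using ne by (simp add: bracket_eq_0_iff)
      moreover have "\<alpha> * bracket (p 2) (p r) + \<beta> * bracket (p 2) (p 1) = 0"
        using plucker[of "p 2"] by (simp add: bracket_def)
      ultimately show ?thesis by (simp add: M_def field_simps)
    qed
    then have "M (p 2) = A" using \<alpha>0 by (simp add: A_def field_simps eq_neg_iff_add_eq_0)
    then show "A \<in> S" using assms(6) by (auto simp: S_def)
    show "y \<notin> S" if "x \<notin> S" "maps_to A B y x" for x y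
    proof
      assume "y \<in> S"
      then obtain m where m: "m \<in> {2..r}" "y = M (p m)" by (auto simp: S_def)
      \<comment> \<open>\<open>maps_to\<close> admits no source 0. This excludes the index r, whose
        successor in the orbit is infinity.\<close>
      have y0: "y \<noteq> 0" using that(2) B0 by (auto simp: maps_to_def)
      then have mr: "m < r" using m M_r by (cases "m = r") auto
      then have "maps_to A B y (M (p (Suc m)))" using step m by simp
      then have "x = M (p (Suc m))" using maps_to_unique[OF B0 that(2)] by blast
      then show False using that(1) mr m(1) by (auto simp: S_def)
    qed
    show "x = 0" if "x \<in> S" "- x \<in> S" for x
    proof (rule ccontr)
      assume x0: "x \<noteq> 0"
      obtain i j where ij: "i \<in> {2..r}" "x = M (p i)" "j \<in> {2..r}" "- x = M (p j)"
        using \<open>x \<in> S\<close> \<open>- x \<in> S\<close> unfolding S_def by blast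
      then have lt: "i < r" "j < r" using x0 M_r by (cases "i = r"; cases "j = r"; auto)+
      \<comment> \<open>x and -x have the same image, so the successors of \<open>p i\<close> and
        \<open>p j\<close> coincide; injectivity of the orbit gives i = j and hence x = -x.\<close>
      have "maps_to A B x (M (p (Suc i)))" "maps_to A B (- x) (M (p (Suc j)))" using step ij lt by auto
      then have "M (p (Suc i)) = M (p (Suc j))" using maps_to_unique[OF B0] maps_to_uminus by blast
      then have "p (Suc i) = p (Suc j)"
        using M_inj p_eq[of "Suc i" 1] p_eq[of "Suc j" 1] ij lt by auto
      then have "i = j" using p_eq[of "Suc i" "Suc j"] lt by auto
      then have "2 * x = 0" using ij by (simp add: eq_neg_iff_add_eq_0)
      then show False using x0 by simp
    qed
  qed

  \<comment> \<open>The Moebius coordinate is inverted over \<open>k\<close>; a vanishing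
    denominator would make the coordinate vectors of \<open>p r\<close> and \<open>p 1\<close>
    proportional.\<close>
  have M_inv: "x \<in> K" if K: "is_subfield K" "k \<subseteq> K" "M (Fin x) \<in> K" "Fin x \<noteq> p 1" for x K
  proof -
    define m where "m = M (Fin x)"
    have "bracket (Fin x) (p 1) \<noteq> 0" using K(4) by (simp add: bracket_eq_0_iff)
    then have "m * bracket (Fin x) (p 1) = bracket (Fin x) (p r)" by (simp add: m_def M_def)
    then have eq: "x * (m * hy (p 1) - hy (p r)) = m * hx (p 1) - hx (p r)"
      by (simp add: bracket_def algebra_simps)
    have "m * hy (p 1) - hy (p r) \<noteq> 0"
    proof
      assume "m * hy (p 1) - hy (p r) = 0"
      then have "hy (p r) = m * hy (p 1)" "hx (p r) = m * hx (p 1)" using eq by simp_all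
      then have "br = 0" by (simp add: br_def bracket_def)
      then show False using br0(1) by simp
    qed
    then have "x = (m * hx (p 1) - hx (p r)) / (m * hy (p 1) - hy (p r))" using eq by (simp add: field_simps)
    also have "\<dots> \<in> K"
      using K(1-3) rat_1 rat_r unfolding m_def rational_point_def
      by (intro subfield_divide subfield_diff subfield_mult) auto
    finally show ?thesis .
  qed
  define t' where "t' = M (Fin t)"
  \<comment> \<open>The forward orbit of a rational point stays rational, while t is not in
    \<open>k\<close>. So the backward orbit of t avoids \<open>p r\<close> and \<open>p 1\<close>,
    which \<open>M_f\<close> excludes.\<close>
  have not_rat: "\<not> rational_point k v" if "(f ^^ n) v = Fin t" for n v
  proof
    assume "rational_point k v"
    then have "rational_point k ((f ^^ n) v)" by (induction n) (simp_all add: rat_f)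
    then show False using that tC kC by (auto simp: rational_point_def)
  qed
  have t_ne: "Fin t \<noteq> p 1" using not_rat[of 0] rat_1 by auto
  have t'C: "t' \<notin> C" using M_inv[OF C kC _ t_ne] tC unfolding t'_def by blast
  have in_pre: "M v \<in> preimages A B n t'" if "(f ^^ n) v = Fin t" for n v
    using that
  proof (induction n arbitrary: v)
    case (Suc n)
    have "v \<noteq> p r" "v \<noteq> p 1" using not_rat[OF Suc.prems] rat_r rat_1 by auto
    then have "maps_to A B (M v) (M (f v))" by (rule M_f)
    moreover have "M (f v) \<in> preimages A B n t'" using Suc by (simp add: funpow_Suc_right del: funpow.simps)
    ultimately show ?case unfolding preimages_Suc_bottom by blast
  qed (simp add: t'_def)

  define L where "L = adjoin F (\<Union>n. preimages A B n t')"
  have L: "is_subfield L" unfolding L_def by (rule is_subfield_adjoin)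
  have kL: "k \<subseteq> L" unfolding L_def using kF adjoin_base by (rule order_trans)
  have pre_L: "preimages A B n t' \<subseteq> L" for n
    using adjoin_gen[of "\<Union>n. preimages A B n t'" F] unfolding L_def by blast
  have in_L: "x \<in> L" if "(f ^^ n) (Fin x) = Fin t" for n x
  proof (rule M_inv[OF L kL])
    show "M (Fin x) \<in> L" using in_pre[OF that] pre_L by blast
    show "Fin x \<noteq> p 1" using not_rat[OF that] rat_1 by auto
  qed
  have "preimage_field k P Q t \<subseteq> L"
    unfolding preimage_field_def
  proof (intro adjoin_least L kL subsetI)
    show "x \<in> L" if "x \<in> {t}" for x using that in_L[of 0 t] by simp
    show "x \<in> L" if "x \<in> {x. \<exists>n\<ge>1. (ratfun_map P Q ^^ n) (Fin x) = Fin t}" for x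
      using that in_L unfolding f_def by blast
  qed
  moreover have "a \<in> F" if "a \<in> L" "a \<in> C" for a
  proof (rule constants_subset[OF F FC _ _ _ _ t'C _ that(1)[unfolded L_def] that(2)])
    show "A \<in> F" "B \<in> F" using ABk kF by auto
    show "\<zeta> \<in> F" if "\<zeta> ^ (2 ^ n) = 1" for \<zeta> and n :: nat
      unfolding F_def by (rule power_2_root_in_adjoin[OF that])
    show "algebraic_over F x" if "x \<in> C" for x
      using that algebraic_over_mono[OF kF] by (simp add: C_def)
    \<comment> \<open>t is recovered from its coordinate t', so algebraicity over k(t) carries over
      to F(t').\<close>
    have "t \<in> adjoin F {t'}"
    proof (rule M_inv[OF is_subfield_adjoin _ _ t_ne])
      show "k \<subseteq> adjoin F {t'}" using kF adjoin_base by (rule order_trans)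
      show "M (Fin t) \<in> adjoin F {t'}" using adjoin_gen[of "{t'}" F] by (simp add: t'_def)
    qed
    then have "adjoin k {t} \<subseteq> adjoin F {t'}"
      using kF adjoin_base[of F "{t'}"] by (intro adjoin_least is_subfield_adjoin) auto
    then show "algebraic_over (adjoin F {t'}) z" for z using assms(3) algebraic_over_mono by blast
  qed
  ultimately show ?thesis unfolding field_of_constants_def F_def C_def by blast
qed

end
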